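(* Let $\mathbb{K}$ be a field. For every finite simple graph $G$ with at least one edge, with edge ideal $I(G)$, and for every integer $s\geq 1$, we have $$\max\{2s+\text{ind-match}(G)-1,\ 2s+\text{ind-match}_{\{K_2,C_5\}}(G)-2\}\leq \mathrm{reg}(I(G)^s).$$ If moreover $\text{ind-match}_{\{K_2,C_5\}}(G)$ is an odd integer, then $$2s+\text{ind-match}_{\{K_2,C_5\}}(G)-1\leq \mathrm{reg}(I(G)^s)\quad\text{for all } s\geq 1.$$
   Context: All graphs are finite and simple. For a graph $G$ with vertex set $V(G)=\{v_1,\ldots,v_n\}$, let $S=\mathbb{K}[x_1,\ldots,x_n]$ be the standard graded polynomial ring over $\mathbb{K}$; the edge ideal of $G$ is $I(G)=(x_ix_j : v_iv_j\in E(G))\subseteq S$. For a finitely generated graded $S$-module $M$ with graded Betti numbers $\beta_{i,j}(M)$ (so the $i$-th module in the minimal graded free resolution of $M$ is $\bigoplus_j S(-j)^{\beta_{i,j}(M)}$), the Castelnuovo--Mumford regularity is $\mathrm{reg}(M)=\max\{j-i : \beta_{i,j}(M)\neq 0\}$. A matching of a graph is a set of pairwise disjoint edges; $\mathrm{match}(H)$ denotes the largest cardinality of a matching of $H$. A matching $M$ of $G$ is an induced matching if for every pair of edges $e,e'\in M$ there is no edge $f\in E(G)\setminus M$ with $f\subset e\cup e'$; $\text{ind-match}(G)$ is the largest cardinality of an induced matching of $G$. $K_2$ is the complete graph on 2 vertices (a single edge) and $C_5$ is the cycle on 5 vertices. An induced $\{K_2,C_5\}$-subgraph of $G$ is an induced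 subgraph $H$ of $G$ each of whose connected components is isomorphic to $K_2$ or $C_5$. For $G$ with at least one edge define $$\text{ind-match}_{\{K_2,C_5\}}(G)=\max\{\mathrm{match}(H) : H \text{ is an induced } \{K_2,C_5\}\text{-subgraph of } G\}.$$ *)

theory Defs
  imports
    "HOL-Library.Poly_Mapping"
    "Jordan_Normal_Form.Matrix_Kernel"
begin

section \<open>Finite simple graphs\<close>

record 'v ugraph =
  verts :: "'v set"
  edges :: "'v set set"

definition simple_graph :: "'v ugraph \<Rightarrow> bool" where
  "simple_graph G \<longleftrightarrow>
     finite (verts G) \<and> (\<forall>e\<in>edges G. e \<subseteq> verts G \<and> card e = 2)"

definition induced_subgraph :: "'v ugraph \<Rightarrow> 'v set \<Rightarrow> 'v ugraph" where
  "induced_subgraph G W = \<lparr>verts = W, edges = {e \<in> edges G. e \<subseteq> W}\<rparr>"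

definition graph_isomorphic :: "'v ugraph \<Rightarrow> 'w ugraph \<Rightarrow> bool" where
  "graph_isomorphic G H \<longleftrightarrow>
     (\<exists>f. bij_betw f (verts G) (verts H) \<and>
          (\<forall>u\<in>verts G. \<forall>v\<in>verts G. {u, v} \<in> edges G \<longleftrightarrow> {f u, f v} \<in> edges H))"

definition complete_graph :: "nat \<Rightarrow> nat ugraph" where
  "complete_graph n = \<lparr>verts = {..<n}, edges = {e. e \<subseteq> {..<n} \<and> card e = 2}\<rparr>"

text \<open>The cycle for \<open>n \<ge> 3\<close>.\<close>

definition cycle_graph :: "nat \<Rightarrow> nat ugraph" where
  "cycle_graph n = \<lparr>verts = {..<n}, edges = {{i, (i + 1) mod n} | i. i < n}\<rparr>"

definition connected_components :: "'v ugraph \<Rightarrow> 'v ugraph set" where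
  "connected_components G =
     {induced_subgraph G {v \<in> verts G. (u, v) \<in> {(x, y). {x, y} \<in> edges G}\<^sup>*} | u. u \<in> verts G}"

definition matching :: "'v ugraph \<Rightarrow> 'v set set \<Rightarrow> bool" where
  "matching G M \<longleftrightarrow> M \<subseteq> edges G \<and> pairwise disjnt M"

definition match :: "'v ugraph \<Rightarrow> nat" where
  "match G = Max {card M | M. matching G M}"

definition induced_matching :: "'v ugraph \<Rightarrow> 'v set set \<Rightarrow> bool" where
  "induced_matching G M \<longleftrightarrow>
     matching G M \<and> (\<forall>e\<in>M. \<forall>e'\<in>M. \<not> (\<exists>f \<in> edges G - M. f \<subseteq> e \<union> e'))"

definition ind_match :: "'v ugraph \<Rightarrow> nat" where
  "ind_match G = Max {card M | M. induced_matching G M}"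

definition K2_C5_graph :: "'v ugraph \<Rightarrow> bool" where
  "K2_C5_graph H \<longleftrightarrow>
     (\<forall>C\<in>connected_components H.
        graph_isomorphic C (complete_graph 2) \<or> graph_isomorphic C (cycle_graph 5))"

definition ind_match_K2_C5 :: "'v ugraph \<Rightarrow> nat" where
  "ind_match_K2_C5 G =
     Max {match (induced_subgraph G W) | W.
            W \<subseteq> verts G \<and> K2_C5_graph (induced_subgraph G W)}"


section \<open>Ideals of the polynomial ring\<close>

text \<open>
  For a finite type \<^typ>\<open>'v\<close>, the type \<open>('v, 'k) mpoly\<close> is the polynomial ring
  over \<^typ>\<open>'k\<close> with one variable for each element of \<^typ>\<open>'v\<close>.  A monomial is its
  exponent function.
\<close>

type_synonym ('v, 'k) mpoly = "('v \<Rightarrow>\<^sub>0 nat) \<Rightarrow>\<^sub>0 'k"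

definition pvar :: "'v \<Rightarrow> ('v, 'k::field) mpoly" where
  "pvar v = Poly_Mapping.single (Poly_Mapping.single v 1) 1"

definition monom_degree :: "('v \<Rightarrow>\<^sub>0 nat) \<Rightarrow> nat" where
  "monom_degree m = (\<Sum>v\<in>Poly_Mapping.keys m. Poly_Mapping.lookup m v)"

text \<open>The degree-\<open>d\<close> component of the standard grading; it is zero for negative \<open>d\<close>.\<close>

definition homogeneous_component :: "int \<Rightarrow> ('v, 'k::field) mpoly set" where
  "homogeneous_component d =
     {p. \<forall>m\<in>Poly_Mapping.keys p. int (monom_degree m) = d}"

lemma module_times: "Modules.module ((*) :: 'a::comm_ring_1 \<Rightarrow> 'a \<Rightarrow> 'a)"
  by unfold_locales (simp_all add: algebra_simps)

text \<open>The qualifiers avoid the locale of the same name in HOL-Algebra.\<close>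

definition ideal_gen :: "'a::comm_ring_1 set \<Rightarrow> 'a set" where
  "ideal_gen B = Modules.module.span (*) B"

definition ideal_times :: "'a::comm_ring_1 set \<Rightarrow> 'a set \<Rightarrow> 'a set" where
  "ideal_times I J = ideal_gen {a * b | a b. a \<in> I \<and> b \<in> J}"

fun ideal_power :: "'a::comm_ring_1 set \<Rightarrow> nat \<Rightarrow> 'a set" where
  "ideal_power I 0 = UNIV"
| "ideal_power I (Suc s) = ideal_times I (ideal_power I s)"

definition edge_ideal :: "'v ugraph \<Rightarrow> ('v, 'k::field) mpoly set" where
  "edge_ideal G = ideal_gen {pvar u * pvar v | u v. {u, v} \<in> edges G}"

definition irrelevant_ideal :: "('v, 'k::field) mpoly set" where
  "irrelevant_ideal = ideal_gen (range pvar)"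


section \<open>Graded Betti numbers and regularity\<close>

text \<open>
  A sequence of maps \<open>\<dots> \<rightarrow> F\<^sub>2 \<rightarrow> F\<^sub>1 \<rightarrow> F\<^sub>0 \<rightarrow> S\<close> of
  graded free modules of finite rank: \<open>F\<^sub>i\<close> has \<open>rk i\<close> basis elements, the \<open>k\<close>-th of
  them of degree \<open>shift i k\<close>, i.e. \<open>F\<^sub>i\<close> is the direct sum of the modules
  \<open>S(- shift i k)\<close> for \<open>k < rk i\<close>.  The matrix \<open>bd i\<close> represents
  \<open>F\<^sub>i\<^sub>+\<^sub>1 \<rightarrow> F\<^sub>i\<close>, and \<open>aug\<close> lists the images in \<open>S\<close> of the basis
  elements of \<open>F\<^sub>0\<close>.  The type parameter is the ring \<open>S\<close>.
\<close>

record 'p free_complex =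
  rk :: "nat \<Rightarrow> nat"
  shift :: "nat \<Rightarrow> nat \<Rightarrow> int"
  aug :: "'p vec"
  bd :: "nat \<Rightarrow> 'p mat"

text \<open>
  The first four conditions say that the maps are homogeneous of degree zero, the last three
  that \<open>\<dots> \<rightarrow> F\<^sub>1 \<rightarrow> F\<^sub>0 \<rightarrow> J \<rightarrow> 0\<close> is exact.
\<close>

definition graded_free_resolution ::
  "('v, 'k::field) mpoly set \<Rightarrow> ('v, 'k) mpoly free_complex \<Rightarrow> bool" where
  "graded_free_resolution J F \<longleftrightarrow>
     aug F \<in> carrier_vec (rk F 0) \<and>
     (\<forall>k < rk F 0. aug F $ k \<in> homogeneous_component (shift F 0 k)) \<and>
     (\<forall>i. bd F i \<in> carrier_mat (rk F i) (rk F (Suc i))) \<and>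
     (\<forall>i. \<forall>l < rk F i. \<forall>k < rk F (Suc i).
        bd F i $$ (l, k) \<in> homogeneous_component (shift F (Suc i) k - shift F i l)) \<and>
     {aug F \<bullet> c | c. c \<in> carrier_vec (rk F 0)} = J \<and>
     {c \<in> carrier_vec (rk F 0). aug F \<bullet> c = 0} =
       {bd F 0 *\<^sub>v c | c. c \<in> carrier_vec (rk F 1)} \<and>
     (\<forall>i. mat_kernel (bd F i) =
       {bd F (Suc i) *\<^sub>v c | c. c \<in> carrier_vec (rk F (Suc (Suc i)))})"

definition minimal_graded_free_resolution ::
  "('v, 'k::field) mpoly set \<Rightarrow> ('v, 'k) mpoly free_complex \<Rightarrow> bool" where
  "minimal_graded_free_resolution J F \<longleftrightarrow>
     graded_free_resolution J F \<and>
     (\<forall>i. \<forall>l < rk F i. \<forall>k < rk F (Suc i). bd F i $$ (l, k) \<in> irrelevant_ideal)"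

text \<open>
  A homogeneous ideal \<open>J\<close> of a polynomial ring in finitely many variables has a minimal graded
  free resolution, unique up to isomorphism, so the choice below is immaterial.
\<close>

definition graded_betti :: "('v, 'k::field) mpoly set \<Rightarrow> nat \<Rightarrow> int \<Rightarrow> nat" where
  "graded_betti J i j =
     (let F = (SOME F. minimal_graded_free_resolution J F)
      in card {k. k < rk F i \<and> shift F i k = j})"

text \<open>For a nonzero homogeneous ideal the set is finite by Hilbert's syzygy theorem, and nonempty.\<close>

definition regularity :: "('v, 'k::field) mpoly set \<Rightarrow> int" where
  "regularity J = Max {j - int i | i j. graded_betti J i j \<noteq> 0}"

end

theory Submission
  imports Defs "HOL-Library.Function_Algebras"
begin

text \<open>
  The regularity of an ideal is bounded from below by exhibiting one nonzero graded Betti number, and Betti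
  numbers are detected by Koszul homology: if the degree \<open>j\<close> part of the \<open>i\<close>-th Koszul homology of a
  homogeneous ideal is nonzero, then the \<open>i\<close>-th module of each of its graded free resolutions has a
  generator of degree \<open>j\<close>.  This is a diagram chase in the tensor product of the Koszul complex with
  the resolution (\<open>chase\<close>, \<open>generator_of_degree\<close>).  For a monomial ideal the Koszul complex splits
  into multidegrees, and in each multidegree it is the complex of cochains on the faces
  \<open>\<sigma>\<close> for which the multidegree divided by the variables outside \<open>\<sigma>\<close> lies in the ideal.

  Let \<open>W\<close> be a set of vertices such that every component of the induced subgraph on \<open>W\<close> is an edge
  or a pentagon, and let at least one component be an edge \<open>{x, y}\<close>.  Let \<open>d\<close> be the matching
  number of this subgraph.  Consider the multidegree in which \<open>x\<close> and \<open>y\<close> have exponent \<open>s\<close>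
  and the other vertices of \<open>W\<close> have exponent \<open>1\<close>.  There the faces that do not belong to the
  \<open>s\<close>-th power of the edge ideal are exactly the independent sets of the subgraph, whatever \<open>s\<close> is
  (\<open>edge_power_regularity\<close>).  They form a join of pairs of points and of pentagons, which is a sphere of
  dimension \<open>d - 1\<close>; its fundamental cycle (\<open>independent_cycle_blocks\<close>) shows that the Koszul
  homology does not vanish.  The multidegree has degree \<open>2 * s - 2 + card W\<close>, and the homological degree
  is \<open>card W - d - 1\<close>, so the regularity is at least \<open>2 * s + d - 1\<close>
  (\<open>blocks_regularity\<close>).

  Induced matchings are the case without pentagons.  If all components are pentagons, one of them is replaced by
  one of its edges, which lowers \<open>d\<close> by one.  Then \<open>d\<close> was even, which explains the role of
  parity in the theorem.

  Since the regularity is defined through a chosen minimal resolution as the maximum of a set, two more facts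
  are needed: a minimal resolution exists (\<open>minimal_resolution_exists\<close>), and every minimal resolution
  has finite length (\<open>minimal_rank_zero\<close>), so that the maximum is taken over a finite set.
\<close>

section \<open>Signs and simplicial cochains\<close>

text \<open>
  The Koszul signs need a linear order on the variables; any enumeration will do.
\<close>

definition vindex :: "'v::finite \<Rightarrow> nat" where
  "vindex = (SOME f. inj f)"

lemma inj_vindex: "inj (vindex :: 'v::finite \<Rightarrow> nat)"
proof -
  have "\<exists>f::'v \<Rightarrow> nat. inj f"
    using finite_imp_inj_to_nat_seg[of "UNIV :: 'v set"] by auto
  then show ?thesis unfolding vindex_def by (rule someI_ex)
qed

definition koszul_sign :: "'v::finite \<Rightarrow> 'v set \<Rightarrow> 'a::comm_ring_1" where
  "koszul_sign v \<sigma> = (- 1) ^ card {u \<in> \<sigma>. vindex u < vindex v}"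

lemma koszul_sign_cases: "koszul_sign v \<sigma> = (1::'a::comm_ring_1) \<or> koszul_sign v \<sigma> = (- 1 :: 'a)"
  unfolding koszul_sign_def by (metis neg_one_even_power neg_one_odd_power)

lemma koszul_sign_square [simp]: "koszul_sign v \<sigma> * koszul_sign v \<sigma> = (1::'a::comm_ring_1)"
  using koszul_sign_cases[of v \<sigma>, where 'a = 'a] by auto

lemma koszul_sign_square_left [simp]: "koszul_sign v \<sigma> * (koszul_sign v \<sigma> * x) = (x::'a::comm_ring_1)"
  by (simp flip: mult.assoc)

lemma koszul_sign_insert:
  assumes "u \<notin> \<sigma>"
  shows "(koszul_sign v (insert u \<sigma>) :: 'a::comm_ring_1) =
    (if vindex u < vindex v then - koszul_sign v \<sigma> else koszul_sign v \<sigma>)"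
proof -
  have "{w \<in> insert u \<sigma>. vindex w < vindex v} =
      (if vindex u < vindex v then insert u {w \<in> \<sigma>. vindex w < vindex v}
       else {w \<in> \<sigma>. vindex w < vindex v})"
    by auto
  then show ?thesis using assms by (simp add: koszul_sign_def)
qed

text \<open>
  Exactly one of the two insertions changes a sign, because exactly one of \<open>u\<close>, \<open>v\<close> precedes the
  other.  All cancellations in this development come from this identity.
\<close>

lemma koszul_sign_swap:
  assumes "u \<noteq> v" "u \<notin> \<rho>" "v \<notin> \<rho>"
  shows "koszul_sign v (insert u \<rho>) * koszul_sign u (insert v \<rho>) = - (koszul_sign u \<rho> * (koszul_sign v \<rho> :: 'a::comm_ring_1))"
proof -
  have "vindex u \<noteq> vindex v" using assms(1) inj_vindex by (metis injD)
  then show ?thesis using assms by (auto simp: koszul_sign_insert)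
qed

text \<open>
  Functions on the subsets of a finite set, regarded as the cochains (\<open>coboundary\<close>) or as the chains
  (\<open>face_sum\<close>) of the full simplex, the empty face included.  Restricted to one multidegree, the Koszul
  complex becomes a cochain complex of this kind.  Contraction and wedge product with a vertex are the
  contracting homotopies.
\<close>

definition coboundary :: "('v::finite set \<Rightarrow> 'k::comm_ring_1) \<Rightarrow> 'v set \<Rightarrow> 'k" where
  "coboundary c \<sigma> = (\<Sum>v\<in>\<sigma>. koszul_sign v (\<sigma> - {v}) * c (\<sigma> - {v}))"

definition contraction :: "'v::finite \<Rightarrow> ('v set \<Rightarrow> 'k::comm_ring_1) \<Rightarrow> 'v set \<Rightarrow> 'k" where
  "contraction v c \<sigma> = (if v \<in> \<sigma> then 0 else koszul_sign v \<sigma> * c (insert v \<sigma>))"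

definition face_sum :: "('v::finite set \<Rightarrow> 'k::comm_ring_1) \<Rightarrow> 'v set \<Rightarrow> 'k" where
  "face_sum h \<rho> = (\<Sum>v\<in>- \<rho>. koszul_sign v \<rho> * h (insert v \<rho>))"

definition wedge :: "'v::finite \<Rightarrow> ('v set \<Rightarrow> 'k::comm_ring_1) \<Rightarrow> 'v set \<Rightarrow> 'k" where
  "wedge v h \<sigma> = (if v \<in> \<sigma> then koszul_sign v (\<sigma> - {v}) * h (\<sigma> - {v}) else 0)"

text \<open>
  Contraction with any vertex is a contracting homotopy.  For \<open>v \<in> \<sigma>\<close> only the term that removes
  \<open>v\<close> survives in the coboundary; for \<open>v \<notin> \<sigma>\<close> all terms but \<open>c \<sigma>\<close> cancel by
  \<open>koszul_sign_swap\<close>.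
\<close>

lemma coboundary_contraction:
  fixes c :: "'v::finite set \<Rightarrow> 'k::comm_ring_1"
  shows "coboundary (contraction v c) \<sigma> + contraction v (coboundary c) \<sigma> = c \<sigma>"
proof (cases "v \<in> \<sigma>")
  case True
  have "coboundary (contraction v c) \<sigma> = (\<Sum>u\<in>\<sigma>. if u = v then c \<sigma> else 0)"
    unfolding coboundary_def
  proof (rule sum.cong[OF refl])
    fix u assume "u \<in> \<sigma>"
    then show "koszul_sign u (\<sigma> - {u}) * contraction v c (\<sigma> - {u}) = (if u = v then c \<sigma> else 0)"
      using True by (auto simp: contraction_def insert_absorb)
  qed
  also have "\<dots> = c \<sigma>" using True by simp
  finally show ?thesis using True by (simp add: contraction_def)
next
  case False
  have "contraction v (coboundary c) \<sigma> = koszul_sign v \<sigma> * (koszul_sign v \<sigma> * c \<sigma> +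
      (\<Sum>u\<in>\<sigma>. koszul_sign u (insert v \<sigma> - {u}) * c (insert v \<sigma> - {u})))"
    using False unfolding contraction_def coboundary_def by (simp add: insert_Diff_if)
  also have "\<dots> = c \<sigma> + (\<Sum>u\<in>\<sigma>. koszul_sign v \<sigma> * koszul_sign u (insert v \<sigma> - {u}) * c (insert v \<sigma> - {u}))"
    by (simp add: distrib_left sum_distrib_left mult.assoc)
  also have "(\<Sum>u\<in>\<sigma>. koszul_sign v \<sigma> * koszul_sign u (insert v \<sigma> - {u}) * c (insert v \<sigma> - {u})) =
      (\<Sum>u\<in>\<sigma>. - (koszul_sign u (\<sigma> - {u}) * contraction v c (\<sigma> - {u})))"
  proof (rule sum.cong[OF refl])
    fix u assume u: "u \<in> \<sigma>"
    have uv: "u \<noteq> v" using u False by auto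
    have "koszul_sign v (insert u (\<sigma> - {u})) * koszul_sign u (insert v (\<sigma> - {u})) =
        - (koszul_sign u (\<sigma> - {u}) * (koszul_sign v (\<sigma> - {u}) :: 'k))"
      using u uv False by (intro koszul_sign_swap) auto
    moreover have "insert u (\<sigma> - {u}) = \<sigma>" "insert v (\<sigma> - {u}) = insert v \<sigma> - {u}"
      using u uv by auto
    ultimately show "koszul_sign v \<sigma> * koszul_sign u (insert v \<sigma> - {u}) * c (insert v \<sigma> - {u}) =
        - (koszul_sign u (\<sigma> - {u}) * contraction v c (\<sigma> - {u}))"
      using False by (simp add: contraction_def mult.assoc)
  qed
  finally show ?thesis by (simp add: coboundary_def[of "contraction v c"] sum_negf)
qed

lemma coboundary_diff: "coboundary (\<lambda>\<sigma>. f \<sigma> - g \<sigma>) \<sigma> = coboundary f \<sigma> - coboundary g \<sigma>"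
  by (simp add: coboundary_def sum_subtractf right_diff_distrib)

text \<open>
  By the homotopy, contraction with \<open>v\<close> commutes with the square of the coboundary.  Hence the value of
  that square at \<open>insert v \<sigma>\<close> is, up to sign, its value at \<open>\<sigma>\<close> on another cochain, which gives
  an induction and avoids a double sum.
\<close>

lemma coboundary_coboundary:
  fixes c :: "'v::finite set \<Rightarrow> 'k::comm_ring_1"
  shows "coboundary (coboundary c) \<sigma> = 0"
proof -
  have "finite \<sigma>" by simp
  then show ?thesis
  proof (induction \<sigma> arbitrary: c rule: finite_induct)
    case empty
    then show ?case by (simp add: coboundary_def)
  next
    case (insert v \<sigma>)
    have fun_id: "contraction v (coboundary c) = (\<lambda>\<tau>. c \<tau> - coboundary (contraction v c) \<tau>)" for c :: "'v set \<Rightarrow> 'k"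
      using coboundary_contraction[of v c] by (metis add_diff_cancel_left')
    have "contraction v (coboundary (coboundary c)) \<sigma> = coboundary c \<sigma> - coboundary (contraction v (coboundary c)) \<sigma>"
      by (simp add: fun_id)
    also have "\<dots> = coboundary (coboundary (contraction v c)) \<sigma>"
      by (simp add: fun_id coboundary_diff)
    also have "\<dots> = 0" by (rule insert.IH)
    finally have "koszul_sign v \<sigma> * (koszul_sign v \<sigma> * coboundary (coboundary c) (insert v \<sigma>)) = 0"
      using insert.hyps by (simp add: contraction_def)
    then show ?case by simp
  qed
qed

text \<open>
  Chains and cochains are paired by \<open>\<Sum>\<sigma>. c \<sigma> * h \<sigma>\<close>; the next two lemmas identify the
  adjoints of the coboundary and of the contraction.
\<close>

lemma sum_coboundary_mult: "(\<Sum>\<sigma>\<in>UNIV. coboundary c \<sigma> * h \<sigma>) = (\<Sum>\<rho>\<in>UNIV. c \<rho> * face_sum h \<rho>)"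
proof -
  have "(\<Sum>\<sigma>\<in>UNIV. coboundary c \<sigma> * h \<sigma>) =
      (\<Sum>(\<sigma>, v)\<in>Sigma UNIV (\<lambda>\<sigma>. \<sigma>). koszul_sign v (\<sigma> - {v}) * c (\<sigma> - {v}) * h \<sigma>)"
    by (simp add: coboundary_def sum_distrib_right sum.Sigma)
  also have "\<dots> = (\<Sum>(\<rho>, v)\<in>Sigma UNIV (\<lambda>\<rho>. - \<rho>). c \<rho> * (koszul_sign v \<rho> * h (insert v \<rho>)))"
    by (rule sum.reindex_bij_witness[of _ "\<lambda>(\<rho>, v). (insert v \<rho>, v)" "\<lambda>(\<sigma>, v). (\<sigma> - {v}, v)"])
       (auto simp: insert_absorb)
  also have "\<dots> = (\<Sum>\<rho>\<in>UNIV. c \<rho> * face_sum h \<rho>)"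
    by (simp add: face_sum_def sum_distrib_left sum.Sigma)
  finally show ?thesis .
qed

lemma sum_contraction_mult: "(\<Sum>\<sigma>\<in>UNIV. contraction v c \<sigma> * h \<sigma>) = (\<Sum>\<rho>\<in>UNIV. c \<rho> * wedge v h \<rho>)"
proof -
  have "(\<Sum>\<sigma>\<in>UNIV. contraction v c \<sigma> * h \<sigma>) = (\<Sum>\<sigma>\<in>{\<sigma>. v \<notin> \<sigma>}. contraction v c \<sigma> * h \<sigma>)"
    by (rule sum.mono_neutral_right) (auto simp: contraction_def)
  also have "\<dots> = (\<Sum>\<rho>\<in>{\<rho>. v \<in> \<rho>}. c \<rho> * wedge v h \<rho>)"
    by (rule sum.reindex_bij_witness[of _ "\<lambda>\<rho>. \<rho> - {v}" "insert v"])
       (auto simp: contraction_def wedge_def insert_absorb)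
  also have "\<dots> = (\<Sum>\<rho>\<in>UNIV. c \<rho> * wedge v h \<rho>)"
    by (rule sum.mono_neutral_left) (auto simp: wedge_def)
  finally show ?thesis .
qed

text \<open>
  The adjoint form of \<open>coboundary_contraction\<close>.
\<close>

lemma face_sum_wedge:
  fixes h :: "'v::finite set \<Rightarrow> 'k::comm_ring_1"
  shows "face_sum (wedge v h) \<rho> + wedge v (face_sum h) \<rho> = h \<rho>"
proof -
  define c :: "'v set \<Rightarrow> 'k" where "c = (\<lambda>\<sigma>. if \<sigma> = \<rho> then 1 else 0)"
  have pick: "(\<Sum>\<sigma>\<in>UNIV. c \<sigma> * X \<sigma>) = X \<rho>" for X :: "'v set \<Rightarrow> 'k"
  proof -
    have "(\<Sum>\<sigma>\<in>UNIV. c \<sigma> * X \<sigma>) = (\<Sum>\<sigma>\<in>UNIV. if \<sigma> = \<rho> then X \<sigma> else 0)"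
      by (rule sum.cong) (auto simp: c_def)
    then show ?thesis by simp
  qed
  have "face_sum (wedge v h) \<rho> = (\<Sum>\<sigma>\<in>UNIV. contraction v (coboundary c) \<sigma> * h \<sigma>)"
    using pick[of "face_sum (wedge v h)"] sum_coboundary_mult[of c "wedge v h"] sum_contraction_mult[of v "coboundary c" h]
    by metis
  moreover have "wedge v (face_sum h) \<rho> = (\<Sum>\<sigma>\<in>UNIV. coboundary (contraction v c) \<sigma> * h \<sigma>)"
    using pick[of "wedge v (face_sum h)"] sum_contraction_mult[of v c "face_sum h"] sum_coboundary_mult[of "contraction v c" h]
    by metis
  ultimately have "face_sum (wedge v h) \<rho> + wedge v (face_sum h) \<rho> =
      (\<Sum>\<sigma>\<in>UNIV. contraction v (coboundary c) \<sigma> * h \<sigma>) + (\<Sum>\<sigma>\<in>UNIV. coboundary (contraction v c) \<sigma> * h \<sigma>)"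
    by simp
  also have "\<dots> = (\<Sum>\<sigma>\<in>UNIV. (coboundary (contraction v c) \<sigma> + contraction v (coboundary c) \<sigma>) * h \<sigma>)"
    by (simp add: sum.distrib distrib_right add.commute)
  also have "\<dots> = h \<rho>" using pick[of h] by (simp add: coboundary_contraction)
  finally show ?thesis .
qed

section \<open>A diagram chase in double complexes\<close>

text \<open>
  Think of a first-quadrant double complex with \<open>e\<close> lowering the first index and \<open>f\<close> the second,
  exact in both directions away from index \<open>0\<close>.  A zigzag that starts at \<open>y\<close> and runs along the
  antidiagonal ends in the corner \<open>(0, Suc (p + q))\<close>; if every element there is an
  \<open>e\<close>-boundary, the zigzag can be run back and \<open>y\<close> is a sum of boundaries.

  The lemma is used in both directions.  With \<open>e\<close> the Koszul differential it shows that Koszul homology of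
  an ideal forces generators in a free resolution; with the roles of the two differentials exchanged it
  shows that a minimal resolution stops.
\<close>

lemma chase:
  fixes D :: "nat \<Rightarrow> nat \<Rightarrow> 'a::ab_group_add set" and e f :: "nat \<Rightarrow> 'a \<Rightarrow> 'a"
  assumes D_diff: "\<And>p q x y. x \<in> D p q \<Longrightarrow> y \<in> D p q \<Longrightarrow> x - y \<in> D p q"
    and e_D: "\<And>p q x. x \<in> D (Suc p) q \<Longrightarrow> e p x \<in> D p q"
    and f_D: "\<And>p q x. x \<in> D p (Suc q) \<Longrightarrow> f q x \<in> D p q"
    and e_diff: "\<And>p x y. e p (x - y) = e p x - e p y"
    and f_diff: "\<And>q x y. f q (x - y) = f q x - f q y"
    and e_e: "\<And>p q x. x \<in> D (Suc (Suc p)) q \<Longrightarrow> e p (e (Suc p) x) = 0"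
    and f_f: "\<And>p q x. x \<in> D p (Suc (Suc q)) \<Longrightarrow> f q (f (Suc q) x) = 0"
    and comm: "\<And>p q x. x \<in> D (Suc p) (Suc q) \<Longrightarrow> e p (f q x) = f q (e p x)"
    and e_exact: "\<And>p q x. x \<in> D (Suc p) q \<Longrightarrow> e p x = 0 \<Longrightarrow> \<exists>u \<in> D (Suc (Suc p)) q. x = e (Suc p) u"
    and f_exact: "\<And>p q x. x \<in> D p (Suc q) \<Longrightarrow> f q x = 0 \<Longrightarrow> \<exists>w \<in> D p (Suc (Suc q)). x = f (Suc q) w"
    and corner: "\<And>z. z \<in> D 0 (Suc (p + q)) \<Longrightarrow> \<exists>w \<in> D (Suc 0) (Suc (p + q)). z = e 0 w"
    and yz: "y \<in> D (Suc p) q" "z \<in> D p (Suc q)" "e p y = f q z"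
  shows "\<exists>w \<in> D (Suc p) (Suc q). \<exists>u \<in> D (Suc (Suc p)) q. y = f q w + e (Suc p) u"
  using corner yz
proof (induction p arbitrary: q y z)
  case 0
  obtain w where w: "w \<in> D (Suc 0) (Suc q)" "z = e 0 w" using 0 by auto
  have "y - f q w \<in> D (Suc 0) q" using 0 w f_D D_diff by blast
  moreover have "e 0 (y - f q w) = 0" using 0 w by (simp add: e_diff comm)
  ultimately obtain u where "u \<in> D (Suc (Suc 0)) q" "y - f q w = e (Suc 0) u"
    using e_exact by blast
  then show ?case using w by (metis add.commute diff_add_cancel)
next
  case (Suc p)
  have "f q (e p z) = e p (f q z)" using Suc.prems comm by simp
  also have "\<dots> = 0" using Suc.prems e_e by metis
  finally obtain z' where z': "z' \<in> D p (Suc (Suc q))" "e p z = f (Suc q) z'"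
    using f_exact e_D Suc.prems(3) by blast
  obtain w' w where w: "w' \<in> D (Suc p) (Suc (Suc q))" "w \<in> D (Suc (Suc p)) (Suc q)"
      "z = f (Suc q) w' + e (Suc p) w"
    using Suc.IH[of "Suc q" z z'] Suc.prems z' by auto
  have "y - f q w \<in> D (Suc (Suc p)) q" using Suc.prems w f_D D_diff by blast
  moreover have "e (Suc p) (y - f q w) = 0"
  proof -
    have "e (Suc p) (y - f q w) = f q z - f q (e (Suc p) w)"
      using Suc.prems w by (simp add: e_diff comm)
    also have "\<dots> = f q (z - e (Suc p) w)" by (simp add: f_diff)
    also have "\<dots> = 0" using w f_f by simp
    finally show ?thesis .
  qed
  ultimately obtain u where "u \<in> D (Suc (Suc (Suc p))) q" "y - f q w = e (Suc (Suc p)) u"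
    using e_exact by blast
  then show ?case using w by (metis add.commute diff_add_cancel)
qed

section \<open>Monomials, multidegrees and the Koszul complex\<close>

abbreviation lookup :: "('a \<Rightarrow>\<^sub>0 'b::zero) \<Rightarrow> 'a \<Rightarrow> 'b" where
  "lookup \<equiv> Poly_Mapping.lookup"

abbreviation keys :: "('a \<Rightarrow>\<^sub>0 'b::zero) \<Rightarrow> 'a set" where
  "keys \<equiv> Poly_Mapping.keys"

text \<open>
  Divisibility of monomials is the pointwise order of exponents, whereas \<open>\<le>\<close> on exponent functions
  is a lexicographic total order.
\<close>

definition mdvd :: "('v \<Rightarrow>\<^sub>0 nat) \<Rightarrow> ('v \<Rightarrow>\<^sub>0 nat) \<Rightarrow> bool" where
  "mdvd a b \<longleftrightarrow> (\<forall>v. lookup a v \<le> lookup b v)"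

lemma mdvd_refl [simp]: "mdvd a a"
  by (simp add: mdvd_def)

lemma mdvd_trans: "mdvd a b \<Longrightarrow> mdvd b c \<Longrightarrow> mdvd a c"
  unfolding mdvd_def by (meson order_trans)

lemma mdvd_zero [simp]: "mdvd 0 a"
  by (simp add: mdvd_def)

lemma mdvd_add_left [simp]: "mdvd a (a + b)"
  by (simp add: mdvd_def lookup_add)

lemma mdvd_add_right [simp]: "mdvd a (b + a)"
  by (simp add: mdvd_def lookup_add)

lemma mdvd_single: "mdvd (Poly_Mapping.single v n) m \<longleftrightarrow> n \<le> lookup m v"
  by (auto simp: mdvd_def lookup_single when_def)

lemma mdvd_diff_add: "mdvd a b \<Longrightarrow> (b - a) + a = b"
  by (rule poly_mapping_eqI) (simp add: mdvd_def lookup_add lookup_minus)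

lemma mdvd_add_diff: "mdvd a b \<Longrightarrow> a + (b - a) = b"
  by (metis add.commute mdvd_diff_add)

definition sqfree :: "'v::finite set \<Rightarrow> ('v \<Rightarrow>\<^sub>0 nat)" where
  "sqfree S = (\<Sum>v\<in>S. Poly_Mapping.single v 1)"

lemma lookup_sqfree: "lookup (sqfree S) v = (if v \<in> S then 1 else 0)"
proof -
  have "lookup (sqfree S) v = (\<Sum>u\<in>S. if u = v then 1 else 0)"
    unfolding sqfree_def lookup_sum by (rule sum.cong) (auto simp: lookup_single when_def)
  then show ?thesis by simp
qed

lemma mdvd_sqfree: "mdvd (sqfree S) m \<longleftrightarrow> (\<forall>v\<in>S. 0 < lookup m v)"
  unfolding mdvd_def lookup_sqfree by (auto simp: Suc_le_eq)

lemma monom_degree_eq: "monom_degree m = (\<Sum>v\<in>UNIV. lookup m v)"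
  for m :: "'v::finite \<Rightarrow>\<^sub>0 nat"
  unfolding monom_degree_def by (rule sum.mono_neutral_left) (auto simp: in_keys_iff)

lemma monom_degree_add: "monom_degree (a + b) = monom_degree a + monom_degree b"
  for a b :: "'v::finite \<Rightarrow>\<^sub>0 nat"
  by (simp add: monom_degree_eq lookup_add sum.distrib)

lemma monom_degree_single [simp]: "monom_degree (Poly_Mapping.single v n) = n"
  for v :: "'v::finite"
  by (simp add: monom_degree_eq lookup_single when_def)

lemma monom_degree_sqfree: "monom_degree (sqfree S) = card S"
  by (simp add: monom_degree_eq lookup_sqfree sum.If_cases)

lemma monom_degree_zero [simp]: "monom_degree 0 = 0"
  by (simp add: monom_degree_def)

lemma lookup_monom_times:
  fixes p :: "('v, 'k::comm_ring_1) mpoly"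
  shows "lookup (Poly_Mapping.single t c * p) n = (if mdvd t n then c * lookup p (n - t) else 0)"
proof -
  have inner: "(\<Sum>q. lookup p q when n = t + q) = (if mdvd t n then lookup p (n - t) else 0)"
  proof (cases "mdvd t n")
    case True
    have "(n = t + q) = (q = n - t)" for q
      using True by (metis add_diff_cancel_left' mdvd_add_diff)
    then show ?thesis using True by simp
  next
    case False
    then have "n \<noteq> t + q" for q by (metis mdvd_add_left)
    then show ?thesis using False by simp
  qed
  have "lookup (Poly_Mapping.single t c * p) n =
      (\<Sum>l. (c when t = l) * (\<Sum>q. lookup p q when n = l + q))"
    by (simp add: lookup_mult lookup_single)
  also have "\<dots> = (\<Sum>l. c * (\<Sum>q. lookup p q when n = t + q) when l = t)"
    by (intro Sum_any.cong) (auto simp: when_def)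
  also have "\<dots> = c * (\<Sum>q. lookup p q when n = t + q)" by simp
  finally show ?thesis by (simp add: inner)
qed

lemma lookup_koszul_sign_times: "lookup (koszul_sign v \<sigma> * p) n = koszul_sign v \<sigma> * lookup p n"
  for p :: "('v::finite, 'k::comm_ring_1) mpoly"
proof (cases "even (card {u \<in> \<sigma>. vindex u < vindex v})")
  case True
  then show ?thesis by (simp add: koszul_sign_def)
next
  case False
  then show ?thesis by (simp add: koszul_sign_def)
qed

text \<open>
  A family \<open>z\<close> stands for the element of the Koszul complex in which \<open>z \<sigma>\<close> is the
  coefficient of the exterior monomial in the variables outside \<open>\<sigma>\<close>.  With complements as indices
  the differential becomes a coboundary, and the faces that matter later are the independent sets themselves
  and not their complements.  The exterior monomial contributes \<open>sqfree (- \<sigma>)\<close> to the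
  multidegree, so \<open>mcoeff z \<sigma> m\<close> is the coordinate of \<open>z\<close> in multidegree \<open>m\<close>.
\<close>

definition mcoeff :: "('v::finite set \<Rightarrow> ('v, 'k::field) mpoly) \<Rightarrow> 'v set \<Rightarrow> ('v \<Rightarrow>\<^sub>0 nat) \<Rightarrow> 'k" where
  "mcoeff z \<sigma> m = (if mdvd (sqfree (- \<sigma>)) m then lookup (z \<sigma>) (m - sqfree (- \<sigma>)) else 0)"

definition koszul :: "('v::finite set \<Rightarrow> ('v, 'k::field) mpoly) \<Rightarrow> 'v set \<Rightarrow> ('v, 'k) mpoly" where
  "koszul z \<sigma> = (\<Sum>v\<in>\<sigma>. koszul_sign v (\<sigma> - {v}) * (pvar v * z (\<sigma> - {v})))"

lemma lookup_eq_mcoeff: "lookup (z \<sigma>) n = mcoeff z \<sigma> (n + sqfree (- \<sigma>))"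
  by (simp add: mcoeff_def)

lemma mcoeff_eqI: "(\<And>m. mcoeff z \<sigma> m = mcoeff z' \<sigma> m) \<Longrightarrow> z \<sigma> = z' \<sigma>"
  by (rule poly_mapping_eqI) (simp add: lookup_eq_mcoeff)

lemma sqfree_Compl_Diff: "v \<in> \<sigma> \<Longrightarrow> sqfree (- (\<sigma> - {v})) = sqfree (- \<sigma>) + Poly_Mapping.single v 1"
  by (rule poly_mapping_eqI) (auto simp: lookup_add lookup_sqfree lookup_single when_def)

text \<open>
  The Koszul differential preserves the multidegree \<open>m\<close> and acts there as the simplicial coboundary.
  When \<open>\<sigma>\<close> is too small for the multidegree \<open>m\<close>, both sides vanish.
\<close>

lemma mcoeff_koszul: "mcoeff (koszul z) \<sigma> m = coboundary (\<lambda>\<tau>. mcoeff z \<tau> m) \<sigma>"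
proof (cases "mdvd (sqfree (- \<sigma>)) m")
  case False
  have "mcoeff z (\<sigma> - {v}) m = 0" if "v \<in> \<sigma>" for v
  proof -
    have "\<not> mdvd (sqfree (- (\<sigma> - {v}))) m"
      using False by (auto simp: mdvd_sqfree)
    then show ?thesis by (simp add: mcoeff_def)
  qed
  then show ?thesis using False by (simp add: coboundary_def mcoeff_def)
next
  case True
  have "lookup (pvar v * z (\<sigma> - {v})) (m - sqfree (- \<sigma>)) = mcoeff z (\<sigma> - {v}) m" if v: "v \<in> \<sigma>" for v
  proof -
    have "mdvd (Poly_Mapping.single v 1) (m - sqfree (- \<sigma>)) \<longleftrightarrow> mdvd (sqfree (- (\<sigma> - {v}))) m"
      using v True by (auto simp: mdvd_sqfree mdvd_single lookup_minus lookup_sqfree Suc_le_eq)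
    moreover have "m - sqfree (- \<sigma>) - Poly_Mapping.single v 1 = m - sqfree (- (\<sigma> - {v}))"
      unfolding sqfree_Compl_Diff[OF v] by (simp add: diff_diff_eq)
    ultimately show ?thesis by (simp add: pvar_def lookup_monom_times mcoeff_def)
  qed
  then show ?thesis using True
    by (simp add: mcoeff_def[of "koszul z"] koszul_def coboundary_def lookup_sum lookup_koszul_sign_times)
qed

lemma koszul_koszul: "koszul (koszul z) \<sigma> = 0"
proof -
  have "(\<lambda>\<tau>. mcoeff (koszul z) \<tau> m) = coboundary (\<lambda>\<tau>. mcoeff z \<tau> m)" for m by (simp add: mcoeff_koszul fun_eq_iff)
  then have "mcoeff (koszul (koszul z)) \<sigma> m = 0" for m
    by (simp add: mcoeff_koszul[of "koszul z"] coboundary_coboundary)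
  then have "koszul (koszul z) \<sigma> = (\<lambda>_. 0) \<sigma>"
    by (intro mcoeff_eqI) (simp add: mcoeff_def[of "\<lambda>_. 0"])
  then show ?thesis by simp
qed

text \<open>
  The Koszul complex of the polynomial ring resolves the residue field.  In every multidegree
  \<open>m \<noteq> 0\<close> contraction with a variable that occurs in \<open>m\<close> is a contracting homotopy; in
  multidegree \<open>0\<close> there is only the constant coefficient at \<open>UNIV\<close>, which is assumed to vanish.
  The second conclusion says that the preimage has the expected exterior degree and no new multidegrees.
\<close>

lemma koszul_acyclic:
  fixes z :: "'v::finite set \<Rightarrow> ('v, 'k::field) mpoly"
  assumes cyc: "\<And>\<sigma>. koszul z \<sigma> = 0" and aug: "lookup (z UNIV) 0 = 0"
  obtains y where "\<And>\<sigma>. koszul y \<sigma> = z \<sigma>"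
    and "\<And>\<sigma> m. mcoeff y \<sigma> m \<noteq> 0 \<Longrightarrow> \<exists>v. v \<notin> \<sigma> \<and> mcoeff z (insert v \<sigma>) m \<noteq> 0"
proof -
  define sel :: "('v \<Rightarrow>\<^sub>0 nat) \<Rightarrow> 'v" where "sel m = (SOME v. 0 < lookup m v)" for m
  have sel: "0 < lookup m (sel m)" if "m \<noteq> 0" for m
  proof -
    have "\<exists>v. 0 < lookup m v" using that by (metis gr0I lookup_zero poly_mapping_eqI)
    then show ?thesis unfolding sel_def by (rule someI_ex)
  qed
  \<comment> \<open>the coordinates of the preimage\<close>
  define b where "b \<sigma> m = (if m = 0 then 0 else contraction (sel m) (\<lambda>\<tau>. mcoeff z \<tau> m) \<sigma>)" for \<sigma> m
  have b_nz: "\<exists>v. v \<notin> \<sigma> \<and> mcoeff z (insert v \<sigma>) m \<noteq> 0" if "b \<sigma> m \<noteq> 0" for \<sigma> m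
    using that by (auto simp: b_def contraction_def split: if_splits)
  have fin: "finite {n. b \<sigma> (n + sqfree (- \<sigma>)) \<noteq> 0}" for \<sigma>
  proof (rule finite_subset)
    show "{n. b \<sigma> (n + sqfree (- \<sigma>)) \<noteq> 0} \<subseteq>
        (\<Union>v\<in>UNIV. (\<lambda>n. n + sqfree (- insert v \<sigma>) - sqfree (- \<sigma>)) ` keys (z (insert v \<sigma>)))"
    proof
      fix n assume "n \<in> {n. b \<sigma> (n + sqfree (- \<sigma>)) \<noteq> 0}"
      then obtain v where v: "mcoeff z (insert v \<sigma>) (n + sqfree (- \<sigma>)) \<noteq> 0" using b_nz by blast
      define k where "k = n + sqfree (- \<sigma>) - sqfree (- insert v \<sigma>)"
      have d: "mdvd (sqfree (- insert v \<sigma>)) (n + sqfree (- \<sigma>))" and k: "k \<in> keys (z (insert v \<sigma>))"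
        using v by (auto simp: mcoeff_def k_def in_keys_iff split: if_splits)
      have "n = k + sqfree (- insert v \<sigma>) - sqfree (- \<sigma>)"
        using mdvd_diff_add[OF d] by (simp add: k_def)
      then show "n \<in> (\<Union>v\<in>UNIV. (\<lambda>n. n + sqfree (- insert v \<sigma>) - sqfree (- \<sigma>)) ` keys (z (insert v \<sigma>)))"
        using k by blast
    qed
  qed simp
  define y where "y \<sigma> = Abs_poly_mapping (\<lambda>n. b \<sigma> (n + sqfree (- \<sigma>)))" for \<sigma>
  have y: "lookup (y \<sigma>) n = b \<sigma> (n + sqfree (- \<sigma>))" for \<sigma> n
    using fin[of \<sigma>] by (simp add: y_def)
  have mcoeff_y: "mcoeff y \<sigma> m = b \<sigma> m" for \<sigma> m
  proof (cases "mdvd (sqfree (- \<sigma>)) m")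
    case True
    then show ?thesis by (simp add: mcoeff_def y mdvd_diff_add)
  next
    case False
    have "b \<sigma> m = 0"
    proof (rule ccontr)
      assume nz: "b \<sigma> m \<noteq> 0"
      then have m: "m \<noteq> 0" and "mcoeff z (insert (sel m) \<sigma>) m \<noteq> 0"
        by (auto simp: b_def contraction_def split: if_splits)
      then have "mdvd (sqfree (- insert (sel m) \<sigma>)) m" by (auto simp: mcoeff_def split: if_splits)
      then have "mdvd (sqfree (- \<sigma>)) m" using sel[OF m] by (auto simp: mdvd_sqfree)
      then show False using False by simp
    qed
    then show ?thesis using False by (simp add: mcoeff_def)
  qed
  have zero: "mcoeff z \<sigma> 0 = 0" for \<sigma>
  proof (cases "\<sigma> = UNIV")
    case True
    then show ?thesis using aug by (simp add: mcoeff_def sqfree_def)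
  next
    case False
    then show ?thesis by (auto simp: mcoeff_def mdvd_sqfree)
  qed
  have "koszul y \<sigma> = z \<sigma>" for \<sigma>
  proof (rule mcoeff_eqI)
    fix m
    show "mcoeff (koszul y) \<sigma> m = mcoeff z \<sigma> m"
    proof (cases "m = 0")
      case True
      then show ?thesis by (simp add: mcoeff_koszul mcoeff_y zero b_def coboundary_def)
    next
      case False
      have "coboundary (\<lambda>\<tau>. mcoeff z \<tau> m) \<rho> = 0" for \<rho>
        using mcoeff_koszul[of z \<rho> m] cyc[of \<rho>] by (simp add: mcoeff_def[of "koszul z"] split: if_splits)
      then have "contraction (sel m) (coboundary (\<lambda>\<tau>. mcoeff z \<tau> m)) \<sigma> = 0" by (simp add: contraction_def)
      moreover have "(\<lambda>\<tau>. b \<tau> m) = contraction (sel m) (\<lambda>\<tau>. mcoeff z \<tau> m)"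
        using False by (simp add: b_def fun_eq_iff)
      ultimately show ?thesis using coboundary_contraction[of "sel m" "\<lambda>\<tau>. mcoeff z \<tau> m" \<sigma>]
        by (simp add: mcoeff_koszul mcoeff_y)
    qed
  qed
  moreover have "\<exists>v. v \<notin> \<sigma> \<and> mcoeff z (insert v \<sigma>) m \<noteq> 0" if "mcoeff y \<sigma> m \<noteq> 0" for \<sigma> m
    using that b_nz by (simp add: mcoeff_y)
  ultimately show ?thesis using that by blast
qed

section \<open>Koszul homology seen by a free resolution\<close>

lemma mcoeff_diff: "mcoeff (f - g) \<sigma> m = mcoeff f \<sigma> m - mcoeff g \<sigma> m"
  by (simp add: mcoeff_def lookup_minus)

lemma mcoeff_add: "mcoeff (f + g) \<sigma> m = mcoeff f \<sigma> m + mcoeff g \<sigma> m"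
  by (simp add: mcoeff_def lookup_add)

lemma koszul_diff: "koszul (f - g) \<sigma> = koszul f \<sigma> - koszul g \<sigma>"
  by (simp add: koszul_def sum_subtractf right_diff_distrib)

lemma koszul_sum_times: "koszul (\<lambda>\<tau>. \<Sum>k\<in>K. a k * z k \<tau>) \<sigma> = (\<Sum>k\<in>K. a k * koszul (z k) \<sigma>)"
proof -
  have "koszul (\<lambda>\<tau>. \<Sum>k\<in>K. a k * z k \<tau>) \<sigma> =
      (\<Sum>v\<in>\<sigma>. \<Sum>k\<in>K. a k * (koszul_sign v (\<sigma> - {v}) * (pvar v * z k (\<sigma> - {v}))))"
    by (simp add: koszul_def sum_distrib_left mult.left_commute)
  also have "\<dots> = (\<Sum>k\<in>K. \<Sum>v\<in>\<sigma>. a k * (koszul_sign v (\<sigma> - {v}) * (pvar v * z k (\<sigma> - {v}))))"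
    by (rule sum.swap)
  finally show ?thesis by (simp add: koszul_def sum_distrib_left)
qed

lemma mcoeff_koszul_nonzero:
  assumes "mcoeff (koszul z) \<sigma> m \<noteq> 0"
  obtains v where "v \<in> \<sigma>" "mcoeff z (\<sigma> - {v}) m \<noteq> 0"
proof -
  have "\<exists>v\<in>\<sigma>. koszul_sign v (\<sigma> - {v}) * mcoeff z (\<sigma> - {v}) m \<noteq> 0"
    using assms unfolding mcoeff_koszul coboundary_def by (rule contrapos_np) (auto intro: sum.neutral)
  then show ?thesis using that by auto
qed

lemma lookup_mult_nonzero:
  assumes "lookup (a * b) n \<noteq> 0"
  obtains s t where "n = s + t" "lookup a s \<noteq> 0" "lookup b t \<noteq> 0"
  using assms keys_mult[of a b] by (auto simp: in_keys_iff)

lemma mcoeff_sum_times_nonzero: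
  assumes "mcoeff (\<lambda>\<tau>. \<Sum>k\<in>K. a k * z k \<tau>) \<sigma> m \<noteq> 0"
  obtains k n m' where "k \<in> K" "m = n + m'" "n \<in> keys (a k)" "mcoeff (z k) \<sigma> m' \<noteq> 0"
proof -
  have d: "mdvd (sqfree (- \<sigma>)) m" and "(\<Sum>k\<in>K. lookup (a k * z k \<sigma>) (m - sqfree (- \<sigma>))) \<noteq> 0"
    using assms by (auto simp: mcoeff_def lookup_sum split: if_splits)
  then obtain k where k: "k \<in> K" "lookup (a k * z k \<sigma>) (m - sqfree (- \<sigma>)) \<noteq> 0"
    by (meson sum.neutral)
  from k(2) obtain s t where st: "m - sqfree (- \<sigma>) = s + t" "lookup (a k) s \<noteq> 0" "lookup (z k \<sigma>) t \<noteq> 0"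
    by (rule lookup_mult_nonzero)
  have "m = s + (t + sqfree (- \<sigma>))" using mdvd_diff_add[OF d] st(1) by (simp add: add.assoc)
  then show ?thesis using that k(1) st by (simp add: lookup_eq_mcoeff in_keys_iff)
qed

lemma lookup_times_zero:
  fixes a b :: "('v::finite, 'k::field) mpoly"
  assumes "lookup a 0 = 0"
  shows "lookup (a * b) 0 = 0"
proof (rule ccontr)
  assume "lookup (a * b) 0 \<noteq> 0"
  then obtain s t where st: "0 = s + t" "lookup a s \<noteq> 0" by (rule lookup_mult_nonzero)
  have "lookup s v = 0" for v using arg_cong[OF st(1), of "\<lambda>m. lookup m v"] by (simp add: lookup_add)
  then have "s = 0" by (intro poly_mapping_eqI) simp
  then show False using st(2) assms by simp
qed

definition degree_part :: "int set \<Rightarrow> ('v::finite, 'k::field) mpoly \<Rightarrow> ('v, 'k) mpoly" where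
  "degree_part T p = Abs_poly_mapping (\<lambda>n. if int (monom_degree n) \<in> T then lookup p n else 0)"

lemma lookup_degree_part:
  "lookup (degree_part T p) n = (if int (monom_degree n) \<in> T then lookup p n else 0)"
proof -
  have "finite {n. (if int (monom_degree n) \<in> T then lookup p n else 0) \<noteq> 0}"
    by (rule finite_subset[of _ "keys p"]) (auto simp: in_keys_iff)
  then show ?thesis by (simp add: degree_part_def)
qed

lemma degree_part_id:
  assumes "\<And>n. lookup p n \<noteq> 0 \<Longrightarrow> int (monom_degree n) \<in> T"
  shows "degree_part T p = p"
  by (rule poly_mapping_eqI) (use assms in \<open>auto simp: lookup_degree_part\<close>)

lemma degree_part_sum: "degree_part T (\<Sum>k\<in>K. f k) = (\<Sum>k\<in>K. degree_part T (f k))"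
  by (rule poly_mapping_eqI) (simp add: lookup_degree_part lookup_sum)

text \<open>
  Multiplication by a homogeneous polynomial shifts degrees.  This is what makes it possible to replace
  the preimages that exactness provides by homogeneous ones.
\<close>

lemma degree_part_times:
  assumes hom: "\<And>n. n \<in> keys a \<Longrightarrow> int (monom_degree n) = e"
    and T': "\<And>d. d \<in> T' \<longleftrightarrow> d + e \<in> T"
  shows "degree_part T (a * p) = a * degree_part T' p"
proof -
  have split: "a * p = a * degree_part T' p + a * degree_part (- T') p"
    unfolding distrib_left[symmetric]
    by (rule arg_cong[of _ _ "(*) a"]) (rule poly_mapping_eqI, simp add: lookup_add lookup_degree_part)
  have key: "int (monom_degree n) \<in> T \<longleftrightarrow> b"
    if nz: "lookup (a * degree_part S p) n \<noteq> 0" and S: "\<And>d. d \<in> S \<longleftrightarrow> (d \<in> T' \<longleftrightarrow> b)" for S n b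
  proof -
    obtain s t where st: "n = s + t" "lookup a s \<noteq> 0" "lookup (degree_part S p) t \<noteq> 0"
      using nz by (rule lookup_mult_nonzero)
    then have "int (monom_degree t) \<in> S" "int (monom_degree s) = e"
      using hom by (auto simp: lookup_degree_part in_keys_iff split: if_splits)
    then show ?thesis using S T' st(1) by (auto simp: monom_degree_add add.commute)
  qed
  show ?thesis
  proof (rule poly_mapping_eqI)
    fix n
    have 1: "int (monom_degree n) \<in> T" if "lookup (a * degree_part T' p) n \<noteq> 0"
      using key[OF that, of True] by simp
    have 2: "int (monom_degree n) \<notin> T" if "lookup (a * degree_part (- T') p) n \<noteq> 0"
      using key[OF that, of False] by simp
    have "lookup (a * p) n = lookup (a * degree_part T' p) n + lookup (a * degree_part (- T') p) n"
      by (subst split) (simp add: lookup_add)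
    then show "lookup (degree_part T (a * p)) n = lookup (a * degree_part T' p) n"
      using 1 2 by (auto simp: lookup_degree_part)
  qed
qed

text \<open>
  An exact sequence of graded free modules, continuing a free resolution of an ideal by the polynomial
  ring itself: index \<open>0\<close> is the ring and index \<open>Suc i\<close> is the \<open>i\<close>-th module of the
  resolution.  Exactness is required at all positive indices only; the cokernel at index \<open>0\<close> is the
  quotient by the ideal.  Matrices and columns are functions of the indices, with arbitrary values outside
  the ranks.
\<close>

locale free_exact_sequence =
  fixes r :: "nat \<Rightarrow> nat" and A :: "nat \<Rightarrow> nat \<Rightarrow> nat \<Rightarrow> ('v::finite, 'k::field) mpoly"
    and sh :: "nat \<Rightarrow> nat \<Rightarrow> int"
  assumes exact: "\<And>q y. (\<And>l. l < r q \<Longrightarrow> (\<Sum>k<r (Suc q). A q l k * y k) = 0) \<Longrightarrow>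
      \<exists>w. \<forall>k<r (Suc q). y k = (\<Sum>j<r (Suc (Suc q)). A (Suc q) k j * w j)"
    and complex: "\<And>q l w. l < r q \<Longrightarrow>
      (\<Sum>k<r (Suc q). A q l k * (\<Sum>j<r (Suc (Suc q)). A (Suc q) k j * w j)) = 0"
    and homogeneous: "\<And>q l k n. l < r q \<Longrightarrow> k < r (Suc q) \<Longrightarrow> n \<in> keys (A q l k) \<Longrightarrow>
      int (monom_degree n) = sh (Suc q) k - sh q l"
begin

text \<open>
  The term at \<open>(p, q)\<close> of the tensor product of the Koszul complex with the sequence: exterior degree
  \<open>p\<close>, coefficients in the module of index \<open>q\<close>, and total degree in \<open>T\<close>.  The
  choices \<open>T = {j}\<close> and \<open>T = UNIV\<close> give the degree \<open>j\<close> strand and the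
  ungraded complex.  The two differentials are \<open>kmap\<close> and \<open>dmap\<close>.
\<close>

definition Fam :: "int set \<Rightarrow> nat \<Rightarrow> nat \<Rightarrow> (nat \<Rightarrow> 'v set \<Rightarrow> ('v, 'k) mpoly) set" where
  "Fam T p q = {z. \<forall>k \<sigma> m. mcoeff (z k) \<sigma> m \<noteq> 0 \<longrightarrow>
     k < r q \<and> card \<sigma> + p = card (UNIV :: 'v set) \<and> int (monom_degree m) + sh q k \<in> T}"

definition dmap :: "nat \<Rightarrow> (nat \<Rightarrow> 'v set \<Rightarrow> ('v, 'k) mpoly) \<Rightarrow> nat \<Rightarrow> 'v set \<Rightarrow> ('v, 'k) mpoly" where
  "dmap q z l \<sigma> = (if l < r q then \<Sum>k<r (Suc q). A q l k * z k \<sigma> else 0)"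

definition kmap :: "(nat \<Rightarrow> 'v set \<Rightarrow> ('v, 'k) mpoly) \<Rightarrow> nat \<Rightarrow> 'v set \<Rightarrow> ('v, 'k) mpoly" where
  "kmap z k = koszul (z k)"

lemma FamI:
  assumes "\<And>k \<sigma> m. mcoeff (z k) \<sigma> m \<noteq> 0 \<Longrightarrow>
     k < r q \<and> card \<sigma> + p = card (UNIV :: 'v set) \<and> int (monom_degree m) + sh q k \<in> T"
  shows "z \<in> Fam T p q"
  using assms by (auto simp: Fam_def)

lemma FamD:
  assumes "z \<in> Fam T p q" "mcoeff (z k) \<sigma> m \<noteq> 0"
  shows "k < r q" "card \<sigma> + p = card (UNIV :: 'v set)" "int (monom_degree m) + sh q k \<in> T"
  using assms by (auto simp: Fam_def)

lemma Fam_diff: "x \<in> Fam T p q \<Longrightarrow> y \<in> Fam T p q \<Longrightarrow> x - y \<in> Fam T p q"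
  unfolding Fam_def mem_Collect_eq
proof (intro allI impI)
  fix k \<sigma> m
  assume *: "\<forall>k \<sigma> m. mcoeff (x k) \<sigma> m \<noteq> 0 \<longrightarrow>
      k < r q \<and> card \<sigma> + p = card (UNIV :: 'v set) \<and> int (monom_degree m) + sh q k \<in> T"
    "\<forall>k \<sigma> m. mcoeff (y k) \<sigma> m \<noteq> 0 \<longrightarrow>
      k < r q \<and> card \<sigma> + p = card (UNIV :: 'v set) \<and> int (monom_degree m) + sh q k \<in> T"
    and "mcoeff ((x - y) k) \<sigma> m \<noteq> 0"
  then have "mcoeff (x k) \<sigma> m \<noteq> 0 \<or> mcoeff (y k) \<sigma> m \<noteq> 0" by (auto simp: mcoeff_diff)
  then show "k < r q \<and> card \<sigma> + p = card (UNIV :: 'v set) \<and> int (monom_degree m) + sh q k \<in> T"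
    using * by blast
qed

lemma kmap_Fam:
  assumes "x \<in> Fam T (Suc p) q"
  shows "kmap x \<in> Fam T p q"
proof (rule FamI)
  fix k \<sigma> m assume "mcoeff (kmap x k) \<sigma> m \<noteq> 0"
  then obtain v where v: "v \<in> \<sigma>" "mcoeff (x k) (\<sigma> - {v}) m \<noteq> 0"
    unfolding kmap_def by (rule mcoeff_koszul_nonzero)
  have "Suc (card (\<sigma> - {v})) = card \<sigma>" using v(1) by (intro card_Suc_Diff1) auto
  then show "k < r q \<and> card \<sigma> + p = card (UNIV :: 'v set) \<and> int (monom_degree m) + sh q k \<in> T"
    using FamD[OF assms v(2)] by simp
qed

lemma kmap_Fam_0:
  assumes "x \<in> Fam T 0 q"
  shows "kmap x = 0"
proof -
  have "mcoeff (koszul (x k)) \<sigma> m = 0" for k \<sigma> m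
  proof (rule ccontr)
    assume "mcoeff (koszul (x k)) \<sigma> m \<noteq> 0"
    then obtain v where v: "v \<in> \<sigma>" "mcoeff (x k) (\<sigma> - {v}) m \<noteq> 0"
      by (rule mcoeff_koszul_nonzero)
    have "card (\<sigma> - {v}) < card (UNIV :: 'v set)"
      using v(1) by (intro psubset_card_mono) auto
    then show False using FamD(2)[OF assms v(2)] by simp
  qed
  then have "koszul (x k) \<sigma> = (\<lambda>_. 0) \<sigma>" for k \<sigma>
    by (intro mcoeff_eqI) (simp add: mcoeff_def[of "\<lambda>_. 0"])
  then show ?thesis by (simp add: kmap_def fun_eq_iff)
qed

lemma dmap_Fam:
  assumes "x \<in> Fam T p (Suc q)"
  shows "dmap q x \<in> Fam T p q"
proof (rule FamI)
  fix l \<sigma> m assume nz: "mcoeff (dmap q x l) \<sigma> m \<noteq> 0"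
  have l: "l < r q"
  proof (rule ccontr)
    assume "\<not> l < r q"
    then show False using nz by (simp add: mcoeff_def dmap_def split: if_splits)
  qed
  then have "dmap q x l = (\<lambda>\<sigma>. \<Sum>k<r (Suc q). A q l k * x k \<sigma>)" by (simp add: dmap_def fun_eq_iff)
  then have "mcoeff (\<lambda>\<sigma>. \<Sum>k<r (Suc q). A q l k * x k \<sigma>) \<sigma> m \<noteq> 0" using nz by simp
  then obtain k n m' where k: "k \<in> {..<r (Suc q)}" "m = n + m'" "n \<in> keys (A q l k)" "mcoeff (x k) \<sigma> m' \<noteq> 0"
    by (rule mcoeff_sum_times_nonzero)
  then show "l < r q \<and> card \<sigma> + p = card (UNIV :: 'v set) \<and> int (monom_degree m) + sh q l \<in> T"
    using l homogeneous[of l q k n] FamD[OF assms k(4)] by (simp add: monom_degree_add algebra_simps)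
qed

lemma kmap_diff: "kmap (x - y) = kmap x - kmap y"
  by (simp add: fun_eq_iff kmap_def koszul_diff)

lemma dmap_diff: "dmap q (x - y) = dmap q x - dmap q y"
  by (simp add: fun_eq_iff dmap_def sum_subtractf right_diff_distrib)

lemma kmap_kmap: "kmap (kmap x) = 0"
  by (simp add: fun_eq_iff kmap_def koszul_koszul)

lemma dmap_dmap: "dmap q (dmap (Suc q) x) = 0"
  by (auto simp: fun_eq_iff dmap_def complex)

lemma kmap_dmap: "kmap (dmap q x) = dmap q (kmap x)"
proof (intro ext)
  fix l \<sigma>
  show "kmap (dmap q x) l \<sigma> = dmap q (kmap x) l \<sigma>"
  proof (cases "l < r q")
    case True
    then have "dmap q x l = (\<lambda>\<sigma>. \<Sum>k<r (Suc q). A q l k * x k \<sigma>)" by (simp add: dmap_def fun_eq_iff)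
    then show ?thesis using True by (simp add: kmap_def koszul_sum_times dmap_def)
  next
    case False
    then have "dmap q x l = (\<lambda>\<sigma>. 0)" by (simp add: dmap_def fun_eq_iff)
    then show ?thesis using False by (simp add: kmap_def koszul_def dmap_def)
  qed
qed

text \<open>
  Koszul acyclicity for every coordinate of the free module separately.  In exterior degree \<open>0\<close> the
  condition on the constant coefficients says that \<open>x\<close> has coefficients in the irrelevant ideal.
\<close>

lemma kmap_exact:
  assumes x: "x \<in> Fam T p q" "kmap x = 0" "\<And>k. lookup (x k UNIV) 0 = 0"
  shows "\<exists>u \<in> Fam T (Suc p) q. x = kmap u"
proof -
  have "\<exists>y. (\<forall>\<sigma>. koszul y \<sigma> = x k \<sigma>) \<and>
      (\<forall>\<sigma> m. mcoeff y \<sigma> m \<noteq> 0 \<longrightarrow> (\<exists>v. v \<notin> \<sigma> \<and> mcoeff (x k) (insert v \<sigma>) m \<noteq> 0))" for k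
  proof -
    have cyc: "koszul (x k) \<sigma> = 0" for \<sigma>
      using fun_cong[OF fun_cong[OF x(2)], of k \<sigma>] by (simp add: kmap_def)
    obtain y where "\<And>\<sigma>. koszul y \<sigma> = x k \<sigma>"
      and "\<And>\<sigma> m. mcoeff y \<sigma> m \<noteq> 0 \<Longrightarrow> \<exists>v. v \<notin> \<sigma> \<and> mcoeff (x k) (insert v \<sigma>) m \<noteq> 0"
      using koszul_acyclic[OF cyc x(3)] by blast
    then show ?thesis by blast
  qed
  then obtain u where u: "\<And>k \<sigma>. koszul (u k) \<sigma> = x k \<sigma>"
      "\<And>k \<sigma> m. mcoeff (u k) \<sigma> m \<noteq> 0 \<Longrightarrow> \<exists>v. v \<notin> \<sigma> \<and> mcoeff (x k) (insert v \<sigma>) m \<noteq> 0"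
    by metis
  have "u \<in> Fam T (Suc p) q"
  proof (rule FamI)
    fix k \<sigma> m assume "mcoeff (u k) \<sigma> m \<noteq> 0"
    then obtain v where v: "v \<notin> \<sigma>" "mcoeff (x k) (insert v \<sigma>) m \<noteq> 0" using u(2) by blast
    then show "k < r q \<and> card \<sigma> + Suc p = card (UNIV :: 'v set) \<and> int (monom_degree m) + sh q k \<in> T"
      using FamD[OF x(1) v(2)] by simp
  qed
  moreover have "x = kmap u" by (simp add: fun_eq_iff kmap_def u(1))
  ultimately show ?thesis by blast
qed

lemma lookup_UNIV_Fam: "x \<in> Fam T p q \<Longrightarrow> lookup (x k UNIV) 0 \<noteq> 0 \<Longrightarrow> p = 0 \<and> k < r q \<and> sh q k \<in> T"
  using FamD[of x T p q k UNIV 0] by (simp add: lookup_eq_mcoeff sqfree_def)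

lemma kmap_exact_Suc:
  assumes x: "x \<in> Fam T (Suc p) q" "kmap x = 0"
  shows "\<exists>u \<in> Fam T (Suc (Suc p)) q. x = kmap u"
  using kmap_exact[OF x] lookup_UNIV_Fam[OF x(1)] by blast

text \<open>
  A homogeneous element of the image has a homogeneous preimage: discard from an arbitrary preimage
  everything that has the wrong degree.
\<close>

lemma dmap_lift:
  assumes x: "x \<in> Fam T p q"
    and im: "\<And>\<sigma>. \<exists>w. \<forall>k<r q. x k \<sigma> = (\<Sum>j<r (Suc q). A q k j * w j)"
  shows "\<exists>w \<in> Fam T p (Suc q). x = dmap q w"
proof -
  obtain w where w: "\<And>\<sigma> k. k < r q \<Longrightarrow> x k \<sigma> = (\<Sum>j<r (Suc q). A q k j * w \<sigma> j)"
    using im by metis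
  define S where "S j \<sigma> = {d. d + int (card (- \<sigma>)) + sh (Suc q) j \<in> T}" for j and \<sigma> :: "'v set"
  define w' where "w' j \<sigma> = (if j < r (Suc q) \<and> card \<sigma> + p = card (UNIV :: 'v set)
      then degree_part (S j \<sigma>) (w \<sigma> j) else 0)" for j \<sigma>
  have "w' \<in> Fam T p (Suc q)"
  proof (rule FamI)
    fix j \<sigma> m assume nz: "mcoeff (w' j) \<sigma> m \<noteq> 0"
    then have d: "mdvd (sqfree (- \<sigma>)) m" and nz': "lookup (w' j \<sigma>) (m - sqfree (- \<sigma>)) \<noteq> 0"
      by (auto simp: mcoeff_def split: if_splits)
    then have j: "j < r (Suc q) \<and> card \<sigma> + p = card (UNIV :: 'v set)"
      and S: "int (monom_degree (m - sqfree (- \<sigma>))) \<in> S j \<sigma>"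
      by (auto simp: w'_def lookup_degree_part split: if_splits)
    have "monom_degree m = monom_degree (m - sqfree (- \<sigma>)) + card (- \<sigma>)"
      by (metis d mdvd_diff_add monom_degree_add monom_degree_sqfree)
    then show "j < r (Suc q) \<and> card \<sigma> + p = card (UNIV :: 'v set) \<and> int (monom_degree m) + sh (Suc q) j \<in> T"
      using j S by (simp add: S_def)
  qed
  moreover have "x k \<sigma> = dmap q w' k \<sigma>" for k \<sigma>
  proof (cases "k < r q \<and> card \<sigma> + p = card (UNIV :: 'v set)")
    case False
    have "mcoeff (x k) \<sigma> m = 0" for m using False FamD[OF x] by blast
    then have "x k \<sigma> = (\<lambda>_. 0) \<sigma>" by (intro mcoeff_eqI) (simp add: mcoeff_def[of "\<lambda>_. 0"])
    then show ?thesis using False by (auto simp: dmap_def w'_def)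
  next
    case True
    define U where "U = {d. d + int (card (- \<sigma>)) + sh q k \<in> T}"
    have "x k \<sigma> = degree_part U (x k \<sigma>)"
    proof (rule degree_part_id[symmetric])
      fix n assume "lookup (x k \<sigma>) n \<noteq> 0"
      then have "mcoeff (x k) \<sigma> (n + sqfree (- \<sigma>)) \<noteq> 0" by (simp add: lookup_eq_mcoeff)
      then show "int (monom_degree n) \<in> U"
        using FamD(3)[OF x] by (fastforce simp: U_def monom_degree_add monom_degree_sqfree)
    qed
    also have "\<dots> = (\<Sum>j<r (Suc q). degree_part U (A q k j * w \<sigma> j))"
      using True by (simp add: w degree_part_sum)
    also have "\<dots> = (\<Sum>j<r (Suc q). A q k j * w' j \<sigma>)"
    proof (rule sum.cong[OF refl])
      fix j assume j: "j \<in> {..<r (Suc q)}"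
      have "degree_part U (A q k j * w \<sigma> j) = A q k j * degree_part (S j \<sigma>) (w \<sigma> j)"
      proof (rule degree_part_times)
        show "int (monom_degree n) = sh (Suc q) j - sh q k" if "n \<in> keys (A q k j)" for n
          using homogeneous that True j by simp
        show "d \<in> S j \<sigma> \<longleftrightarrow> d + (sh (Suc q) j - sh q k) \<in> U" for d
          by (simp add: S_def U_def algebra_simps)
      qed
      then show "degree_part U (A q k j * w \<sigma> j) = A q k j * w' j \<sigma>"
        using True j by (simp add: w'_def)
    qed
    finally show ?thesis using True by (simp add: dmap_def)
  qed
  ultimately show ?thesis by (intro bexI[of _ w']) (auto simp: fun_eq_iff)
qed

lemma dmap_exact:
  assumes x: "x \<in> Fam T p (Suc q)" "dmap q x = 0"
  shows "\<exists>w \<in> Fam T p (Suc (Suc q)). x = dmap (Suc q) w"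
proof (rule dmap_lift[OF x(1)])
  fix \<sigma>
  show "\<exists>w. \<forall>k<r (Suc q). x k \<sigma> = (\<Sum>j<r (Suc (Suc q)). A (Suc q) k j * w j)"
  proof (rule exact)
    fix l assume "l < r q"
    then show "(\<Sum>k<r (Suc q). A q l k * x k \<sigma>) = 0"
      using fun_cong[OF fun_cong[OF x(2)], of l \<sigma>] by (simp add: dmap_def)
  qed
qed

text \<open>
  A basis element \<open>y\<close> of a late module is mapped into the irrelevant ideal by minimality, so it
  starts a zigzag in the double complex.  The zigzag would end in an exterior degree larger than the number of
  variables, where everything is \<open>0\<close>; running it back writes \<open>y\<close> as a sum of two
  boundaries, both with coefficients in the irrelevant ideal.  This is Hilbert's bound on the length of minimal
  resolutions.
\<close>

lemma minimal_rank_zero: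
  assumes min: "\<And>q l k. l < r (Suc q) \<Longrightarrow> k < r (Suc (Suc q)) \<Longrightarrow> lookup (A (Suc q) l k) 0 = 0"
    and q: "card (UNIV :: 'v set) \<le> q"
  shows "r (Suc q) = 0"
proof (rule ccontr)
  assume "r (Suc q) \<noteq> 0"
  then have k0: "0 < r (Suc q)" by simp
  define y :: "nat \<Rightarrow> 'v set \<Rightarrow> ('v, 'k) mpoly" where "y k \<sigma> = (if k = 0 \<and> \<sigma> = UNIV then 1 else 0)" for k \<sigma>
  have y: "y \<in> Fam UNIV 0 (Suc q)"
    by (rule FamI) (use k0 in \<open>auto simp: mcoeff_def y_def split: if_splits\<close>)
  have dy: "dmap q y \<in> Fam UNIV 0 q" using y by (rule dmap_Fam)
  have "q \<noteq> 0" using q by (metis finite_UNIV_card_ge_0 finite le_zero_eq less_numeral_extra(3))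
  have "lookup (dmap q y l UNIV) 0 = 0" for l
  proof -
    have "lookup (A q l k * y k UNIV) 0 = 0" if "l < r q" "k < r (Suc q)" for k
    proof (rule lookup_times_zero)
      show "lookup (A q l k) 0 = 0" using min[of l "q - 1" k] that \<open>q \<noteq> 0\<close> by simp
    qed
    then show ?thesis by (simp add: dmap_def lookup_sum)
  qed
  then obtain z where z: "z \<in> Fam UNIV (Suc 0) q" "dmap q y = kmap z"
    using kmap_exact[OF dy kmap_Fam_0[OF dy]] by blast
  \<comment> \<open>the chase with the roles of the two differentials exchanged\<close>
  have "\<exists>w \<in> Fam UNIV (Suc 0) (Suc q). \<exists>u \<in> Fam UNIV 0 (Suc (Suc q)). y = kmap w + dmap (Suc q) u"
  proof (rule chase[where D = "\<lambda>a b. Fam UNIV b a" and e = dmap and f = "\<lambda>_. kmap" and z = z])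
    fix z assume z: "z \<in> Fam UNIV (Suc (q + 0)) 0"
    have "mcoeff (z k) \<sigma> m = 0" for k \<sigma> m
      using FamD(2)[OF z, of k \<sigma> m] q by fastforce
    then have "z k \<sigma> = (\<lambda>_. 0) \<sigma>" for k \<sigma> by (intro mcoeff_eqI) (simp add: mcoeff_def[of "\<lambda>_. 0"])
    then have "z = dmap 0 0" by (simp add: fun_eq_iff dmap_def)
    moreover have "0 \<in> Fam UNIV (Suc (q + 0)) (Suc 0)" by (rule FamI) (simp add: mcoeff_def split: if_splits)
    ultimately show "\<exists>w \<in> Fam UNIV (Suc (q + 0)) (Suc 0). z = dmap 0 w" by blast
  qed (use y z in \<open>auto intro: Fam_diff dmap_Fam kmap_Fam dmap_exact kmap_exact_Suc
      simp: dmap_diff kmap_diff kmap_kmap dmap_dmap kmap_dmap\<close>)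
  then obtain w u where wu: "y = kmap w + dmap (Suc q) u" by blast
  have "lookup (y 0 UNIV) 0 = lookup (kmap w 0 UNIV) 0 + lookup (dmap (Suc q) u 0 UNIV) 0"
    by (subst wu) (simp add: lookup_add)
  also have "lookup (kmap w 0 UNIV) 0 = 0"
  proof -
    have "lookup (pvar v * b) 0 = 0" for v :: 'v and b :: "('v, 'k) mpoly"
    proof (rule lookup_times_zero)
      have "Poly_Mapping.single v (1::nat) \<noteq> 0" by (metis lookup_single_eq lookup_zero zero_neq_one)
      then show "lookup (pvar v :: ('v, 'k) mpoly) 0 = 0" by (simp add: pvar_def lookup_single_not_eq)
    qed
    then show ?thesis by (simp add: kmap_def koszul_def lookup_sum lookup_koszul_sign_times)
  qed
  also have "lookup (dmap (Suc q) u 0 UNIV) 0 = 0"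
  proof -
    have "lookup (A (Suc q) 0 j * u j UNIV) 0 = 0" if "j < r (Suc (Suc q))" for j
      using min k0 that by (intro lookup_times_zero) auto
    then show ?thesis by (simp add: dmap_def lookup_sum)
  qed
  finally show False by (simp add: y_def)
qed

text \<open>
  The detection of Betti numbers.  The Koszul coboundary of the single element
  \<open>y = x\<^sup>m / \<Prod>\<^bsub>v \<notin> \<sigma>0\<^esub> x\<^sub>v\<close> at \<open>\<sigma>0\<close> has coefficients in the ideal by
  \<open>inM\<close>, although \<open>y\<close> has not; so \<open>y\<close> represents a Koszul homology class of the
  quotient by the ideal.  If no generator of the right index had degree \<open>monom_degree m\<close>, the corner
  of the double complex would consist of boundaries, and the chase would write \<open>y\<close> as an element with
  coefficients in the ideal plus a Koszul boundary.  Pairing with \<open>h\<close> in multidegree \<open>m\<close>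
  excludes this: \<open>h\<close> annihilates the first summand by \<open>notM\<close>, the second because it is a
  cycle, but takes the value \<open>h \<sigma>0\<close> on \<open>y\<close>.
\<close>

theorem generator_of_degree:
  assumes r0: "r 0 = 1" and sh0: "sh 0 0 = 0"
    and image: "\<And>g. (\<exists>w. g = (\<Sum>j<r 1. A 0 0 j * w j)) \<longleftrightarrow> keys g \<subseteq> M"
    and s0: "mdvd (sqfree (- \<sigma>0)) m" "card \<sigma>0 + Suc p = card (UNIV :: 'v set)"
    and inM: "\<And>v. v \<notin> \<sigma>0 \<Longrightarrow> m - sqfree (- insert v \<sigma>0) \<in> M"
    and notM: "\<And>\<sigma>. h \<sigma> \<noteq> 0 \<Longrightarrow> mdvd (sqfree (- \<sigma>)) m \<Longrightarrow> m - sqfree (- \<sigma>) \<notin> M"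
    and cycle: "\<And>\<rho>. mdvd (sqfree (- \<rho>)) m \<Longrightarrow> face_sum h \<rho> = 0"
    and h0: "h \<sigma>0 \<noteq> (0 :: 'k)"
  shows "\<exists>k<r (Suc p). sh (Suc p) k = int (monom_degree m)"
proof (rule ccontr)
  assume none: "\<not> ?thesis"
  define T where "T = {int (monom_degree m)}"
  define y :: "nat \<Rightarrow> 'v set \<Rightarrow> ('v, 'k) mpoly" where
    "y k \<sigma> = (if k = 0 \<and> \<sigma> = \<sigma>0 then Poly_Mapping.single (m - sqfree (- \<sigma>0)) 1 else 0)" for k \<sigma>
  have mcoeff_y: "mcoeff (y k) \<sigma> n = (if k = 0 \<and> \<sigma> = \<sigma>0 \<and> n = m then 1 else 0)" for k \<sigma> n
  proof (cases "k = 0 \<and> \<sigma> = \<sigma>0 \<and> mdvd (sqfree (- \<sigma>)) n")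
    case False
    then show ?thesis using s0(1) by (auto simp: mcoeff_def y_def)
  next
    case True
    have "(m - sqfree (- \<sigma>0) = n - sqfree (- \<sigma>0)) = (n = m)"
      using True s0(1) by (metis mdvd_diff_add)
    then show ?thesis using True s0(1) by (simp add: mcoeff_def y_def lookup_single when_def)
  qed
  have y: "y \<in> Fam T (Suc 0 + p) 0"
    by (rule FamI) (use r0 sh0 s0 in \<open>auto simp: mcoeff_y T_def split: if_splits\<close>)
  have ky: "kmap y \<in> Fam T p 0" using y kmap_Fam by simp
  have "\<exists>z \<in> Fam T p (Suc 0). kmap y = dmap 0 z"
  proof (rule dmap_lift[OF ky])
    fix \<sigma>
    have "keys (koszul (y 0) \<sigma>) \<subseteq> M"
    proof
      fix n assume "n \<in> keys (koszul (y 0) \<sigma>)"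
      then have "mcoeff (koszul (y 0)) \<sigma> (n + sqfree (- \<sigma>)) \<noteq> 0" by (simp add: in_keys_iff lookup_eq_mcoeff)
      then obtain v where v: "v \<in> \<sigma>" "mcoeff (y 0) (\<sigma> - {v}) (n + sqfree (- \<sigma>)) \<noteq> 0"
        by (rule mcoeff_koszul_nonzero)
      then have "\<sigma> - {v} = \<sigma>0" "n + sqfree (- \<sigma>) = m" by (auto simp: mcoeff_y split: if_splits)
      then have "v \<notin> \<sigma>0" "n = m - sqfree (- insert v \<sigma>0)"
        using v(1) by (auto simp: insert_absorb)
      then show "n \<in> M" using inM by simp
    qed
    then show "\<exists>w. \<forall>k<r 0. kmap y k \<sigma> = (\<Sum>j<r (Suc 0). A 0 k j * w j)"
      using image[of "koszul (y 0) \<sigma>"] by (simp add: r0 kmap_def)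
  qed
  then obtain z where z: "z \<in> Fam T p (Suc 0)" "kmap y = dmap 0 z" by blast
  have "\<exists>w \<in> Fam T (Suc p) (Suc 0). \<exists>u \<in> Fam T (Suc (Suc p)) 0. y = dmap 0 w + kmap u"
  proof (rule chase[where D = "Fam T" and e = "\<lambda>_. kmap" and f = dmap and z = z])
    fix x assume x: "x \<in> Fam T 0 (Suc (p + 0))"
    have "lookup (x k UNIV) 0 = 0" for k
      using lookup_UNIV_Fam[OF x, of k] none by (auto simp: T_def)
    then show "\<exists>w \<in> Fam T (Suc 0) (Suc (p + 0)). x = kmap w"
      using kmap_exact[OF x kmap_Fam_0[OF x]] by blast
  qed (use y z in \<open>auto intro: Fam_diff dmap_Fam kmap_Fam dmap_exact kmap_exact_Suc
      simp: dmap_diff kmap_diff kmap_kmap dmap_dmap kmap_dmap\<close>)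
  then obtain w u where wu: "y = dmap 0 w + kmap u" by blast
  have "(\<Sum>\<sigma>\<in>UNIV. mcoeff (y 0) \<sigma> m * h \<sigma>) =
      (\<Sum>\<sigma>\<in>UNIV. mcoeff (dmap 0 w 0) \<sigma> m * h \<sigma>) + (\<Sum>\<sigma>\<in>UNIV. coboundary (\<lambda>\<tau>. mcoeff (u 0) \<tau> m) \<sigma> * h \<sigma>)"
    by (subst wu) (simp add: mcoeff_add distrib_right sum.distrib kmap_def mcoeff_koszul)
  also have "(\<Sum>\<sigma>\<in>UNIV. mcoeff (dmap 0 w 0) \<sigma> m * h \<sigma>) = 0"
  proof (intro sum.neutral ballI)
    fix \<sigma>
    have "keys (dmap 0 w 0 \<sigma>) \<subseteq> M"
      using image[of "dmap 0 w 0 \<sigma>"] by (auto simp: dmap_def r0)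
    then show "mcoeff (dmap 0 w 0) \<sigma> m * h \<sigma> = 0"
      using notM[of \<sigma>] by (auto simp: mcoeff_def in_keys_iff)
  qed
  also have "(\<Sum>\<sigma>\<in>UNIV. coboundary (\<lambda>\<tau>. mcoeff (u 0) \<tau> m) \<sigma> * h \<sigma>) = 0"
    unfolding sum_coboundary_mult by (intro sum.neutral ballI) (auto simp: mcoeff_def cycle)
  also have "(\<Sum>\<sigma>\<in>UNIV. mcoeff (y 0) \<sigma> m * h \<sigma>) = (\<Sum>\<sigma>\<in>UNIV. if \<sigma> = \<sigma>0 then h \<sigma> else 0)"
    by (rule sum.cong) (auto simp: mcoeff_y)
  finally show False using h0 by simp
qed

end

section \<open>Resolutions as exact sequences of matrices\<close>

text \<open>
  A resolution in the sense of \<open>free_complex\<close>, continued by the ring as the module of index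
  \<open>0\<close>.
\<close>

fun res_rank :: "'p free_complex \<Rightarrow> nat \<Rightarrow> nat" where
  "res_rank F 0 = 1"
| "res_rank F (Suc i) = rk F i"

fun res_entry :: "'p free_complex \<Rightarrow> nat \<Rightarrow> nat \<Rightarrow> nat \<Rightarrow> 'p" where
  "res_entry F 0 l k = aug F $ k"
| "res_entry F (Suc i) l k = bd F i $$ (l, k)"

fun res_shift :: "'p free_complex \<Rightarrow> nat \<Rightarrow> nat \<Rightarrow> int" where
  "res_shift F 0 k = 0"
| "res_shift F (Suc i) k = shift F i k"

lemma mult_mat_vec_entry:
  assumes "A \<in> carrier_mat n m" "i < n" "c \<in> carrier_vec m"
  shows "(A *\<^sub>v c) $ i = (\<Sum>j<m. A $$ (i, j) * c $ j)"
  using assms by (auto simp: scalar_prod_def lessThan_atLeast0)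

lemma scalar_prod_sum:
  "c \<in> carrier_vec m \<Longrightarrow> a \<bullet> c = (\<Sum>j<m. a $ j * c $ j)"
  by (simp add: scalar_prod_def lessThan_atLeast0)

lemma resolution_exact_sequence:
  fixes J :: "('v::finite, 'k::field) mpoly set"
  assumes res: "graded_free_resolution J F"
  shows "free_exact_sequence (res_rank F) (res_entry F) (res_shift F)"
    and "(\<exists>w. g = (\<Sum>j<res_rank F 1. res_entry F 0 0 j * w j)) \<longleftrightarrow> g \<in> J"
proof -
  have aug: "aug F \<in> carrier_vec (rk F 0)"
    "\<And>k. k < rk F 0 \<Longrightarrow> aug F $ k \<in> homogeneous_component (shift F 0 k)"
    and bd: "\<And>i. bd F i \<in> carrier_mat (rk F i) (rk F (Suc i))"
    "\<And>i l k. l < rk F i \<Longrightarrow> k < rk F (Suc i) \<Longrightarrow>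
      bd F i $$ (l, k) \<in> homogeneous_component (shift F (Suc i) k - shift F i l)"
    and im: "{aug F \<bullet> c | c. c \<in> carrier_vec (rk F 0)} = J"
    and ex0: "{c \<in> carrier_vec (rk F 0). aug F \<bullet> c = 0} =
       {bd F 0 *\<^sub>v c | c. c \<in> carrier_vec (rk F 1)}"
    and ex: "\<And>i. mat_kernel (bd F i) =
       {bd F (Suc i) *\<^sub>v c | c. c \<in> carrier_vec (rk F (Suc (Suc i)))}"
    using res unfolding graded_free_resolution_def by auto
  show "(\<exists>w. g = (\<Sum>j<res_rank F 1. res_entry F 0 0 j * w j)) \<longleftrightarrow> g \<in> J"
  proof
    assume "\<exists>w. g = (\<Sum>j<res_rank F 1. res_entry F 0 0 j * w j)"
    then obtain w where w: "g = (\<Sum>j<rk F 0. aug F $ j * w j)" by auto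
    have "g = aug F \<bullet> vec (rk F 0) w" unfolding w by (simp add: scalar_prod_sum[of _ "rk F 0"])
    then show "g \<in> J" using im by auto
  next
    assume "g \<in> J"
    then obtain c where "c \<in> carrier_vec (rk F 0)" "g = aug F \<bullet> c" using im by blast
    then show "\<exists>w. g = (\<Sum>j<res_rank F 1. res_entry F 0 0 j * w j)"
      by (intro exI[of _ "\<lambda>j. c $ j"]) (simp add: scalar_prod_sum)
  qed
  have ker0: "(\<Sum>k<rk F 0. aug F $ k * y k) = 0 \<longleftrightarrow> vec (rk F 0) y \<in> {c \<in> carrier_vec (rk F 0). aug F \<bullet> c = 0}" for y
    by (simp add: scalar_prod_sum[of _ "rk F 0"])
  have ker: "(\<forall>l<rk F i. (\<Sum>k<rk F (Suc i). bd F i $$ (l, k) * y k) = 0) \<longleftrightarrow>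
      vec (rk F (Suc i)) y \<in> mat_kernel (bd F i)" for i y
  proof -
    have e: "(bd F i *\<^sub>v vec (rk F (Suc i)) y) $ l = (\<Sum>k<rk F (Suc i). bd F i $$ (l, k) * y k)"
      if "l < rk F i" for l
      using mult_mat_vec_entry[OF bd(1) that, of "vec (rk F (Suc i)) y"] by simp
    have "bd F i *\<^sub>v vec (rk F (Suc i)) y = 0\<^sub>v (rk F i) \<longleftrightarrow>
        (\<forall>l<rk F i. (bd F i *\<^sub>v vec (rk F (Suc i)) y) $ l = 0)"
      using bd(1)[of i] by (auto simp del: index_mult_mat_vec)
    then show ?thesis using bd(1)[of i] e by (auto simp: mat_kernel_def simp del: index_mult_mat_vec)
  qed
  have img: "vec (rk F i) y = bd F i *\<^sub>v c \<longleftrightarrow> (\<forall>l<rk F i. y l = (\<Sum>k<rk F (Suc i). bd F i $$ (l, k) * c $ k))"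
    if "c \<in> carrier_vec (rk F (Suc i))" for i y c
  proof -
    have "vec (rk F i) y = bd F i *\<^sub>v c \<longleftrightarrow> (\<forall>l<rk F i. y l = (bd F i *\<^sub>v c) $ l)"
    proof
      assume "vec (rk F i) y = bd F i *\<^sub>v c"
      then show "\<forall>l<rk F i. y l = (bd F i *\<^sub>v c) $ l" by (metis index_vec)
    next
      assume "\<forall>l<rk F i. y l = (bd F i *\<^sub>v c) $ l"
      then show "vec (rk F i) y = bd F i *\<^sub>v c"
        using bd(1)[of i] by (intro eq_vecI) (simp_all del: index_mult_mat_vec)
    qed
    then show ?thesis using mult_mat_vec_entry[OF bd(1)] that by auto
  qed
  show "free_exact_sequence (res_rank F) (res_entry F) (res_shift F)"
  proof
    fix q and y :: "nat \<Rightarrow> ('v, 'k) mpoly"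
    assume y: "\<And>l. l < res_rank F q \<Longrightarrow> (\<Sum>k<res_rank F (Suc q). res_entry F q l k * y k) = 0"
    have "vec (rk F q) y \<in> {bd F q *\<^sub>v c | c. c \<in> carrier_vec (rk F (Suc q))}"
    proof (cases q)
      case 0
      then show ?thesis using y ker0[of y] ex0 by simp
    next
      case (Suc i)
      then show ?thesis using y ker[of i y] ex[of i] by simp
    qed
    then obtain c where c: "c \<in> carrier_vec (rk F (Suc q))" "vec (rk F q) y = bd F q *\<^sub>v c" by blast
    then show "\<exists>w. \<forall>k<res_rank F (Suc q). y k = (\<Sum>j<res_rank F (Suc (Suc q)). res_entry F (Suc q) k j * w j)"
      using img[OF c(1), of y] by (intro exI[of _ "\<lambda>j. c $ j"]) simp
  next
    fix q l and w :: "nat \<Rightarrow> ('v, 'k) mpoly"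
    assume l: "l < res_rank F q"
    define y where "y k = (\<Sum>j<rk F (Suc q). bd F q $$ (k, j) * w j)" for k
    have "vec (rk F q) y = bd F q *\<^sub>v vec (rk F (Suc q)) w"
      by (subst img) (simp_all add: y_def)
    then have y: "vec (rk F q) y \<in> {bd F q *\<^sub>v c | c. c \<in> carrier_vec (rk F (Suc q))}"
      by (metis (mono_tags, lifting) mem_Collect_eq vec_carrier)
    have "(\<Sum>k<res_rank F (Suc q). res_entry F q l k * y k) = 0"
    proof (cases q)
      case 0
      then show ?thesis using y ker0[of y] ex0 l by simp
    next
      case (Suc i)
      then show ?thesis using y ker[of i y] ex[of i] l by simp
    qed
    then show "(\<Sum>k<res_rank F (Suc q). res_entry F q l k *
        (\<Sum>j<res_rank F (Suc (Suc q)). res_entry F (Suc q) k j * w j)) = 0"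
      by (simp add: y_def)
  next
    fix q l k n
    assume "l < res_rank F q" "k < res_rank F (Suc q)" "n \<in> keys (res_entry F q l k)"
    then show "int (monom_degree n) = res_shift F (Suc q) k - res_shift F q l"
      using aug(2) bd(2) by (cases q) (fastforce simp: homogeneous_component_def)+
  qed
qed

lemma exact_sequence_resolution:
  fixes J :: "('v::finite, 'k::field) mpoly set"
  assumes "free_exact_sequence r A sh" and r0: "r 0 = 1" and sh0: "sh 0 0 = 0"
    and image: "\<And>g. (\<exists>w. g = (\<Sum>j<r 1. A 0 0 j * w j)) \<longleftrightarrow> g \<in> J"
  shows "graded_free_resolution J \<lparr>rk = \<lambda>i. r (Suc i), shift = \<lambda>i. sh (Suc i),
    aug = vec (r 1) (A 0 0), bd = \<lambda>i. mat (r (Suc i)) (r (Suc (Suc i))) (\<lambda>(l, k). A (Suc i) l k)\<rparr>"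
    (is "graded_free_resolution J ?F")
proof -
  interpret free_exact_sequence r A sh by fact
  have carr: "bd ?F i \<in> carrier_mat (r (Suc i)) (r (Suc (Suc i)))" for i by simp
  have img: "bd ?F i *\<^sub>v c = vec (r (Suc i)) (\<lambda>l. \<Sum>k<r (Suc (Suc i)). A (Suc i) l k * c $ k)"
    if "c \<in> carrier_vec (r (Suc (Suc i)))" for i c
  proof (rule eq_vecI)
    fix l assume l: "l < dim_vec (vec (r (Suc i)) (\<lambda>l. \<Sum>k<r (Suc (Suc i)). A (Suc i) l k * c $ k))"
    show "(bd ?F i *\<^sub>v c) $ l = vec (r (Suc i)) (\<lambda>l. \<Sum>k<r (Suc (Suc i)). A (Suc i) l k * c $ k) $ l"
      using l by (subst mult_mat_vec_entry[OF carr _ that]) auto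
  qed simp
  have im_eq: "c \<in> {bd ?F i *\<^sub>v c | c. c \<in> carrier_vec (r (Suc (Suc i)))} \<longleftrightarrow>
      (\<exists>w. \<forall>l<r (Suc i). c $ l = (\<Sum>k<r (Suc (Suc i)). A (Suc i) l k * w k))" (is "?L \<longleftrightarrow> ?R")
    if c: "c \<in> carrier_vec (r (Suc i))" for c i
  proof
    assume ?L
    then obtain d where "d \<in> carrier_vec (r (Suc (Suc i)))" "c = bd ?F i *\<^sub>v d" by blast
    then show ?R using img by (intro exI[of _ "\<lambda>k. d $ k"]) simp
  next
    assume ?R
    then obtain w where w: "\<forall>l<r (Suc i). c $ l = (\<Sum>k<r (Suc (Suc i)). A (Suc i) l k * w k)" by blast
    have "c = bd ?F i *\<^sub>v vec (r (Suc (Suc i))) w"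
      by (subst img) (use c w in auto)
    then show ?L by (metis (mono_tags, lifting) mem_Collect_eq vec_carrier)
  qed
  have im_carr: "{bd ?F i *\<^sub>v c | c. c \<in> carrier_vec (r (Suc (Suc i)))} \<subseteq> carrier_vec (r (Suc i))" for i
    by (auto intro!: carrier_vecI)
  have ker_eq: "c \<in> {bd ?F q *\<^sub>v c | c. c \<in> carrier_vec (r (Suc (Suc q)))} \<longleftrightarrow>
      (\<forall>l<r q. (\<Sum>k<r (Suc q). A q l k * c $ k) = 0)"
    if c: "c \<in> carrier_vec (r (Suc q))" for c q
  proof -
    have "(\<exists>w. \<forall>l<r (Suc q). c $ l = (\<Sum>k<r (Suc (Suc q)). A (Suc q) l k * w k)) \<longleftrightarrow>
      (\<forall>l<r q. (\<Sum>k<r (Suc q). A q l k * c $ k) = 0)"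
      using exact[of q "\<lambda>k. c $ k"] complex[of _ q] by auto
    then show ?thesis using im_eq[OF c] by simp
  qed
  have k0: "{c \<in> carrier_vec (rk ?F 0). aug ?F \<bullet> c = 0} = {bd ?F 0 *\<^sub>v c | c. c \<in> carrier_vec (rk ?F 1)}"
  proof (rule Set.set_eqI)
    fix c
    show "c \<in> {c \<in> carrier_vec (rk ?F 0). aug ?F \<bullet> c = 0} \<longleftrightarrow>
        c \<in> {bd ?F 0 *\<^sub>v c | c. c \<in> carrier_vec (rk ?F 1)}"
    proof (cases "c \<in> carrier_vec (r (Suc 0))")
      case True
      then show ?thesis using ker_eq[OF True] r0 by (simp add: scalar_prod_sum)
    next
      case False
      then show ?thesis using im_carr[of 0] by auto
    qed
  qed
  have kS: "mat_kernel (bd ?F i) = {bd ?F (Suc i) *\<^sub>v c | c. c \<in> carrier_vec (rk ?F (Suc (Suc i)))}" for i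
  proof (rule Set.set_eqI)
    fix c
    show "c \<in> mat_kernel (bd ?F i) \<longleftrightarrow> c \<in> {bd ?F (Suc i) *\<^sub>v c | c. c \<in> carrier_vec (rk ?F (Suc (Suc i)))}"
    proof (cases "c \<in> carrier_vec (r (Suc (Suc i)))")
      case True
      have "c \<in> mat_kernel (bd ?F i) \<longleftrightarrow> bd ?F i *\<^sub>v c = 0\<^sub>v (r (Suc i))"
        using True by (simp add: mat_kernel_def)
      also have "\<dots> \<longleftrightarrow> (\<forall>l<r (Suc i). (\<Sum>k<r (Suc (Suc i)). A (Suc i) l k * c $ k) = 0)"
        unfolding img[OF True] by (auto simp: vec_eq_iff)
      finally show ?thesis using ker_eq[OF True] by simp
    next
      case False
      then show ?thesis using im_carr[of "Suc i"] by (auto simp: mat_kernel_def)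
    qed
  qed
  have im: "{aug ?F \<bullet> c | c. c \<in> carrier_vec (rk ?F 0)} = J"
  proof (rule Set.set_eqI)
    fix g
    have "(\<exists>c. g = aug ?F \<bullet> c \<and> c \<in> carrier_vec (rk ?F 0)) \<longleftrightarrow> (\<exists>w. g = (\<Sum>j<r 1. A 0 0 j * w j))"
    proof
      assume "\<exists>c. g = aug ?F \<bullet> c \<and> c \<in> carrier_vec (rk ?F 0)"
      then obtain c where "g = aug ?F \<bullet> c" "c \<in> carrier_vec (rk ?F 0)" by blast
      then show "\<exists>w. g = (\<Sum>j<r 1. A 0 0 j * w j)"
        by (intro exI[of _ "\<lambda>k. c $ k"]) (simp add: scalar_prod_sum)
    next
      assume "\<exists>w. g = (\<Sum>j<r 1. A 0 0 j * w j)"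
      then obtain w where "g = (\<Sum>j<r 1. A 0 0 j * w j)" by blast
      then have "g = aug ?F \<bullet> vec (r 1) w" by (simp add: scalar_prod_sum[of _ "r (Suc 0)"])
      then show "\<exists>c. g = aug ?F \<bullet> c \<and> c \<in> carrier_vec (rk ?F 0)" by (intro exI[of _ "vec (r 1) w"]) simp
    qed
    then show "g \<in> {aug ?F \<bullet> c | c. c \<in> carrier_vec (rk ?F 0)} \<longleftrightarrow> g \<in> J"
      using image[of g] by auto
  qed
  have "aug ?F \<in> carrier_vec (rk ?F 0)" by simp
  moreover have "\<forall>k<rk ?F 0. aug ?F $ k \<in> homogeneous_component (shift ?F 0 k)"
    using homogeneous[of 0 0] r0 sh0 by (auto simp: homogeneous_component_def)
  moreover have "\<forall>i. \<forall>l<rk ?F i. \<forall>k<rk ?F (Suc i).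
      bd ?F i $$ (l, k) \<in> homogeneous_component (shift ?F (Suc i) k - shift ?F i l)"
    using homogeneous by (auto simp: homogeneous_component_def)
  ultimately show ?thesis
    unfolding graded_free_resolution_def using k0 kS im by simp
qed

section \<open>Existence of minimal resolutions of monomial ideals\<close>

lemma sum_fun_apply: "(\<Sum>i\<in>I. f i) x = (\<Sum>i\<in>I. f i x)"
  for f :: "'i \<Rightarrow> 'x \<Rightarrow> 'y::comm_monoid_add"
  by (induction I rule: infinite_finite_induct) auto

definition fscale :: "'k::field \<Rightarrow> (nat \<Rightarrow> 'k) \<Rightarrow> nat \<Rightarrow> 'k" where
  "fscale a c = (\<lambda>k. a * c k)"

text \<open>
  Vectors of all lengths live in one space, that of the functions on the naturals.
\<close>

interpretation fvs: vector_space "fscale :: 'k::field \<Rightarrow> (nat \<Rightarrow> 'k) \<Rightarrow> nat \<Rightarrow> 'k"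
  by unfold_locales (simp_all add: fscale_def fun_eq_iff algebra_simps)

lemma span_image_finite:
  assumes "x \<in> fvs.span (f ` S)" and fin: "finite S"
  obtains d where "\<And>j. d j \<noteq> 0 \<Longrightarrow> j \<in> S" "x = (\<Sum>j\<in>S. fscale (d j) (f j))"
proof -
  define W where "W = {\<Sum>j\<in>S. fscale (d j) (f j) | d. \<forall>j. d j \<noteq> 0 \<longrightarrow> j \<in> S}"
  have "fvs.subspace W"
  proof (rule fvs.subspaceI)
    show "0 \<in> W" unfolding W_def by (rule CollectI, rule exI[of _ "\<lambda>_. 0"]) simp
  next
    fix x y assume "x \<in> W" "y \<in> W"
    then obtain d e where "x = (\<Sum>j\<in>S. fscale (d j) (f j))" "\<forall>j. d j \<noteq> 0 \<longrightarrow> j \<in> S"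
      "y = (\<Sum>j\<in>S. fscale (e j) (f j))" "\<forall>j. e j \<noteq> 0 \<longrightarrow> j \<in> S" unfolding W_def by blast
    then show "x + y \<in> W" unfolding W_def
      by (intro CollectI exI[of _ "\<lambda>j. d j + e j"]) (auto simp: fvs.scale_left_distrib sum.distrib, metis add.left_neutral)
  next
    fix a x assume "x \<in> W"
    then obtain d where "x = (\<Sum>j\<in>S. fscale (d j) (f j))" "\<forall>j. d j \<noteq> 0 \<longrightarrow> j \<in> S" unfolding W_def by blast
    then show "fscale a x \<in> W" unfolding W_def
      by (intro CollectI exI[of _ "\<lambda>j. a * d j"]) (auto simp: fvs.scale_sum_right)
  qed
  moreover have "f ` S \<subseteq> W"
  proof
    fix x assume "x \<in> f ` S"
    then obtain i where i: "i \<in> S" "x = f i" by blast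
    have "(\<Sum>j\<in>S. fscale (if j = i then 1 else 0) (f j)) = (\<Sum>j\<in>S. if j = i then f i else 0)"
      by (rule sum.cong) (auto simp: fscale_def fun_eq_iff)
    then have "f i = (\<Sum>j\<in>S. fscale (if j = i then 1 else 0) (f j))" using i fin by simp
    then show "x \<in> W" unfolding W_def
      using i by (intro CollectI exI[of _ "\<lambda>j. if j = i then 1 else 0"]) auto
  qed
  ultimately have "x \<in> W" using assms(1) fvs.span_minimal by blast
  then show ?thesis using that unfolding W_def by blast
qed

lemma subspace_finite_span:
  assumes V: "fvs.subspace V" and fin: "\<And>c k. c \<in> V \<Longrightarrow> N \<le> k \<Longrightarrow> c k = 0"
  obtains X where "finite X" "X \<subseteq> V" "V \<subseteq> fvs.span X"
proof -
  define E where "E i = (\<lambda>k::nat. if k = i then 1 else (0::'a))" for i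
  obtain B where B: "B \<subseteq> V" "fvs.independent B" "V \<subseteq> fvs.span B"
    using fvs.maximal_independent_subset[of V] by blast
  have "V \<subseteq> fvs.span (E ` {..<N})"
  proof
    fix c assume c: "c \<in> V"
    have "c = (\<Sum>i<N. fscale (c i) (E i))"
    proof
      fix k
      have "(\<Sum>i<N. fscale (c i) (E i)) k = (\<Sum>i<N. if i = k then c k else 0)"
        unfolding sum_fun_apply by (rule sum.cong) (auto simp: fscale_def E_def)
      then show "c k = (\<Sum>i<N. fscale (c i) (E i)) k" using fin[OF c, of k] by simp
    qed
    also have "\<dots> \<in> fvs.span (E ` {..<N})"
      by (intro fvs.span_sum fvs.span_scale fvs.span_base) auto
    finally show "c \<in> fvs.span (E ` {..<N})" .
  qed
  then have "finite B"
    using fvs.independent_span_bound[of "E ` {..<N}" B] B by blast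
  then show ?thesis using that B by blast
qed

definition monom_min :: "('v \<Rightarrow>\<^sub>0 nat) \<Rightarrow> ('v \<Rightarrow>\<^sub>0 nat) \<Rightarrow> 'v \<Rightarrow>\<^sub>0 nat" where
  "monom_min m M = m - (m - M)"

lemma lookup_monom_min: "lookup (monom_min m M) v = min (lookup m v) (lookup M v)"
  by (simp add: monom_min_def lookup_minus)

lemma monom_min_mdvd: "mdvd (monom_min m M) m" "mdvd (monom_min m M) M"
  by (simp_all add: mdvd_def lookup_monom_min)

lemma mdvd_monom_min: "mdvd b m \<Longrightarrow> mdvd b M \<Longrightarrow> mdvd b (monom_min m M)"
  by (simp add: mdvd_def lookup_monom_min)

lemma finite_mdvd: "finite {m. mdvd m M}"
  for M :: "'v::finite \<Rightarrow>\<^sub>0 nat"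
proof -
  have "finite (PiE (UNIV :: 'v set) (\<lambda>v. {..lookup M v}))" by (rule finite_PiE) auto
  moreover have "lookup ` {m. mdvd m M} \<subseteq> PiE UNIV (\<lambda>v. {..lookup M v})"
    by (auto simp: mdvd_def)
  ultimately have "finite (lookup ` {m. mdvd m M})" by (rule rev_finite_subset)
  then show ?thesis by (rule finite_imageD) (rule inj_onI, rule poly_mapping_eqI, simp)
qed

text \<open>
  A multigraded map between free modules has entries that are scalars times monomials, and in each
  multidegree it is given by these scalars alone.  So a multigraded module inside a free module is a family
  \<open>V\<close> of vector spaces, one for each multidegree, increasing along divisibility, and a generator is a
  vector \<open>C j\<close> together with its multidegree \<open>b j\<close>.
\<close>

definition combination :: "nat \<Rightarrow> (nat \<Rightarrow> 'v \<Rightarrow>\<^sub>0 nat) \<Rightarrow> (nat \<Rightarrow> nat \<Rightarrow> 'k::field) \<Rightarrow> ('v \<Rightarrow>\<^sub>0 nat) \<Rightarrow>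
    (nat \<Rightarrow> 'k) \<Rightarrow> (nat \<Rightarrow> 'k) \<Rightarrow> bool" where
  "combination r b C m d c \<longleftrightarrow> (\<forall>j. d j \<noteq> 0 \<longrightarrow> j < r \<and> mdvd (b j) m) \<and>
     (\<forall>k. c k = (\<Sum>j<r. d j * C j k))"

text \<open>
  The last clause says that a relation in multidegree \<open>m\<close> does not involve the generators of that
  very multidegree.  This is minimality in the form in which it puts the entries of the next matrix into the
  irrelevant ideal.
\<close>

definition minimal_generators :: "(('v \<Rightarrow>\<^sub>0 nat) \<Rightarrow> (nat \<Rightarrow> 'k::field) set) \<Rightarrow>
    nat \<times> (nat \<Rightarrow> 'v \<Rightarrow>\<^sub>0 nat) \<times> (nat \<Rightarrow> nat \<Rightarrow> 'k) \<Rightarrow> bool" where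
  "minimal_generators V = (\<lambda>(r, b, C).
     (\<forall>j<r. C j \<in> V (b j)) \<and>
     (\<forall>m. \<forall>c \<in> V m. \<exists>d. combination r b C m d c) \<and>
     (\<forall>m d. combination r b C m d (\<lambda>_. 0) \<longrightarrow> (\<forall>j<r. b j = m \<longrightarrow> d j = 0)))"

text \<open>
  The family is determined by its values at the finitely many divisors of \<open>M\<close>, each of them finite
  dimensional, so bases of these generate.  A generating set of least
  cardinality is minimal, since a relation that involves a generator of its own multidegree would make this
  generator superfluous.
\<close>

lemma minimal_generators_exist:
  fixes V :: "('v::finite \<Rightarrow>\<^sub>0 nat) \<Rightarrow> (nat \<Rightarrow> 'k::field) set"
  assumes sub: "\<And>m. fvs.subspace (V m)"
    and mono: "\<And>m m'. mdvd m m' \<Longrightarrow> V m \<subseteq> V m'"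
    and fin: "\<And>m c k. c \<in> V m \<Longrightarrow> N \<le> k \<Longrightarrow> c k = 0"
    and bounded: "\<And>m. V m \<subseteq> V (monom_min m M)"
  shows "\<exists>g. minimal_generators V g"
proof -
  define Y where "Y X m = {c. \<exists>m'. (m', c) \<in> X \<and> mdvd m' m}" for X :: "(('v \<Rightarrow>\<^sub>0 nat) \<times> (nat \<Rightarrow> 'k)) set" and m
  define gens where "gens X \<longleftrightarrow> finite X \<and> (\<forall>(m, c) \<in> X. c \<in> V m) \<and> (\<forall>m. V m \<subseteq> fvs.span (Y X m))" for X
  have "\<exists>X. finite X \<and> X \<subseteq> V m \<and> V m \<subseteq> fvs.span X" for m
    using subspace_finite_span[of "V m" N] sub fin by metis
  then obtain Z where Z: "\<And>m. finite (Z m)" "\<And>m. Z m \<subseteq> V m" "\<And>m. V m \<subseteq> fvs.span (Z m)" by metis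
  have "gens (Sigma {m. mdvd m M} Z)"
    unfolding gens_def
  proof (intro conjI allI)
    show "finite (Sigma {m. mdvd m M} Z)" using finite_mdvd Z(1) by blast
    show "\<forall>(m, c) \<in> Sigma {m. mdvd m M} Z. c \<in> V m" using Z(2) by blast
    fix m
    have "Z (monom_min m M) \<subseteq> Y (Sigma {m. mdvd m M} Z) m"
      using monom_min_mdvd unfolding Y_def by blast
    then show "V m \<subseteq> fvs.span (Y (Sigma {m. mdvd m M} Z) m)"
      using bounded[of m] Z(3)[of "monom_min m M"] fvs.span_mono by blast
  qed
  then obtain X where X: "gens X" and least: "\<And>X'. gens X' \<Longrightarrow> card X \<le> card X'"
    by (metis ex_has_least_nat)
  have finX: "finite X" and XV: "\<And>m c. (m, c) \<in> X \<Longrightarrow> c \<in> V m" and span: "\<And>m. V m \<subseteq> fvs.span (Y X m)"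
    using X unfolding gens_def by auto
  obtain g where g: "bij_betw g {..<card X} X"
    using ex_bij_betw_nat_finite[OF finX] by (auto simp: lessThan_atLeast0)
  define r b C where "r = card X" and "b j = fst (g j)" and "C j = snd (g j)" for j
  have gX: "(b j, C j) \<in> X" if "j < r" for j
    using bij_betwE[OF g] that by (simp add: b_def C_def r_def)
  have Yeq: "Y X m = C ` {j. j < r \<and> mdvd (b j) m}" for m
  proof
    show "C ` {j. j < r \<and> mdvd (b j) m} \<subseteq> Y X m" using gX unfolding Y_def by blast
    show "Y X m \<subseteq> C ` {j. j < r \<and> mdvd (b j) m}"
    proof
      fix c assume "c \<in> Y X m"
      then obtain m' where m': "(m', c) \<in> X" "mdvd m' m" unfolding Y_def by blast
      then obtain j where "j < r" "g j = (m', c)"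
        using g by (metis bij_betw_iff_bijections lessThan_iff r_def)
      then show "c \<in> C ` {j. j < r \<and> mdvd (b j) m}" using m' by (force simp: b_def C_def)
    qed
  qed
  have comb: "\<exists>d. combination r b C m d c" if c: "c \<in> V m" for m c
  proof -
    obtain d where d: "\<And>j. d j \<noteq> 0 \<Longrightarrow> j \<in> {j. j < r \<and> mdvd (b j) m}"
        "c = (\<Sum>j\<in>{j. j < r \<and> mdvd (b j) m}. fscale (d j) (C j))"
      using span_image_finite[of c C "{j. j < r \<and> mdvd (b j) m}"] span[of m] c Yeq[of m] by auto
    have "c k = (\<Sum>j<r. d j * C j k)" for k
    proof -
      have "c k = (\<Sum>j\<in>{j. j < r \<and> mdvd (b j) m}. d j * C j k)"
        by (simp add: d(2) sum_fun_apply fscale_def)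
      also have "\<dots> = (\<Sum>j<r. d j * C j k)"
        by (rule sum.mono_neutral_left) (use d(1) in auto)
      finally show ?thesis .
    qed
    then show ?thesis using d(1) unfolding combination_def by blast
  qed
  have min: "d i = 0" if rel: "combination r b C m d (\<lambda>_. 0)" and i: "i < r" "b i = m" for m d i
  proof (rule ccontr)
    assume di: "d i \<noteq> 0"
    define X' where "X' = X - {g i}"
    have other: "C j \<in> Y X' m" if j: "j < r" "j \<noteq> i" "d j \<noteq> 0" for j
    proof -
      have "g j \<noteq> g i" using g j i unfolding r_def by (metis bij_betw_iff_bijections lessThan_iff)
      then have "(b j, C j) \<in> X'" using gX[OF j(1)] by (simp add: X'_def b_def C_def)
      then show ?thesis using rel j unfolding Y_def combination_def by blast
    qed
    have "C i = fscale (- inverse (d i)) (\<Sum>j\<in>{..<r} - {i}. fscale (d j) (C j))"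
    proof
      fix k
      have "0 = d i * C i k + (\<Sum>j\<in>{..<r} - {i}. d j * C j k)"
        using rel i unfolding combination_def by (metis (no_types, lifting) finite_lessThan lessThan_iff sum.remove)
      then have "C i k = - inverse (d i) * (\<Sum>j\<in>{..<r} - {i}. d j * C j k)"
        using di by (simp add: field_simps eq_neg_iff_add_eq_0)
      then show "C i k = fscale (- inverse (d i)) (\<Sum>j\<in>{..<r} - {i}. fscale (d j) (C j)) k"
        by (simp add: fscale_def sum_fun_apply)
    qed
    also have "\<dots> \<in> fvs.span (Y X' m)"
    proof (rule fvs.span_scale, rule fvs.span_sum)
      fix j assume "j \<in> {..<r} - {i}"
      then show "fscale (d j) (C j) \<in> fvs.span (Y X' m)"
        using other[of j] by (cases "d j = 0") (auto intro: fvs.span_scale fvs.span_base fvs.span_zero)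
    qed
    finally have Ci: "C i \<in> fvs.span (Y X' m)" .
    have "gens X'"
      unfolding gens_def
    proof (intro conjI allI)
      show "finite X'" using finX by (simp add: X'_def)
      show "\<forall>(m, c) \<in> X'. c \<in> V m" using XV by (auto simp: X'_def)
      fix m'
      have "Y X m' \<subseteq> fvs.span (Y X' m')"
      proof
        fix c assume "c \<in> Y X m'"
        then obtain n where n: "(n, c) \<in> X" "mdvd n m'" unfolding Y_def by blast
        show "c \<in> fvs.span (Y X' m')"
        proof (cases "(n, c) = g i")
          case False
          then have "c \<in> Y X' m'" using n unfolding Y_def X'_def by blast
          then show ?thesis by (rule fvs.span_base)
        next
          case True
          then have "c = C i" "n = m" using i by (auto simp: C_def b_def dest: sym)
          moreover have "Y X' m \<subseteq> Y X' m'"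
            using n(2) \<open>n = m\<close> mdvd_trans unfolding Y_def by blast
          ultimately show ?thesis using Ci fvs.span_mono by blast
        qed
      qed
      then show "V m' \<subseteq> fvs.span (Y X' m')"
        using span[of m'] fvs.span_minimal[OF _ fvs.subspace_span] by blast
    qed
    then have "card X \<le> card X'" by (rule least)
    moreover have "card X' < card X"
      using finX gX[OF i(1)] unfolding X'_def b_def C_def by (intro psubset_card_mono) auto
    ultimately show False by simp
  qed
  have "minimal_generators V (r, b, C)"
    unfolding minimal_generators_def using gX XV comb min by auto
  then show ?thesis by blast
qed

text \<open>
  The syzygies of a list of generators, multidegree by multidegree.
\<close>

definition kernel_space :: "nat \<times> (nat \<Rightarrow> 'v \<Rightarrow>\<^sub>0 nat) \<times> (nat \<Rightarrow> nat \<Rightarrow> 'k::field) \<Rightarrow>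
    ('v \<Rightarrow>\<^sub>0 nat) \<Rightarrow> (nat \<Rightarrow> 'k) set" where
  "kernel_space = (\<lambda>(r, b, C) m. {d. combination r b C m d (\<lambda>_. 0)})"

text \<open>
  A syzygy in multidegree \<open>m\<close> only depends on which generators have a multidegree dividing
  \<open>m\<close>.  So it occurs already in the greatest common divisor of \<open>m\<close> and the product of all
  these multidegrees.
\<close>

lemma kernel_space_generators:
  fixes g :: "nat \<times> (nat \<Rightarrow> 'v::finite \<Rightarrow>\<^sub>0 nat) \<times> (nat \<Rightarrow> nat \<Rightarrow> 'k::field)"
  shows "\<exists>g'. minimal_generators (kernel_space g) g'"
proof -
  obtain r b C where g: "g = (r, b, C)" by (cases g)
  show ?thesis
  proof (rule minimal_generators_exist)
    fix m
    show "fvs.subspace (kernel_space g m)"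
    proof (rule fvs.subspaceI)
      show "0 \<in> kernel_space g m" by (simp add: kernel_space_def g combination_def)
    next
      fix x y assume "x \<in> kernel_space g m" "y \<in> kernel_space g m"
      then show "x + y \<in> kernel_space g m"
        by (auto simp: kernel_space_def g combination_def distrib_right sum.distrib)
          (metis add.right_neutral)+
    next
      fix a x assume x: "x \<in> kernel_space g m"
      have "(\<Sum>j<r. a * x j * C j k) = a * (\<Sum>j<r. x j * C j k)" for k
        by (simp add: sum_distrib_left mult.assoc)
      then show "fscale a x \<in> kernel_space g m"
        using x by (auto simp: kernel_space_def g combination_def fscale_def)
    qed
  next
    fix m m' :: "'v \<Rightarrow>\<^sub>0 nat" assume "mdvd m m'"
    then show "kernel_space g m \<subseteq> kernel_space g m'"
      using mdvd_trans by (auto simp: kernel_space_def g combination_def)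
  next
    fix m c k assume "c \<in> kernel_space g m" "r \<le> k"
    then show "c k = 0" by (auto simp: kernel_space_def g combination_def)
  next
    fix m
    \<comment> \<open>exponents are written additively\<close>
    have "mdvd (b j) (\<Sum>j<r. b j)" if "j < r" for j
      using that by (auto simp: mdvd_def lookup_sum intro!: member_le_sum)
    then show "kernel_space g m \<subseteq> kernel_space g (monom_min m (\<Sum>j<r. b j))"
      by (auto simp: kernel_space_def g combination_def intro!: mdvd_monom_min)
  qed
qed

text \<open>
  An exact sequence of multigraded free modules in terms of scalars: \<open>B q k\<close> is the multidegree of
  the \<open>k\<close>-th basis element of the module of index \<open>q\<close>, and \<open>C q j l\<close> is the
  scalar in the entry of the map from index \<open>Suc q\<close> to index \<open>q\<close>.
\<close>

locale multigraded_sequence =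
  fixes R :: "nat \<Rightarrow> nat" and B :: "nat \<Rightarrow> nat \<Rightarrow> 'v::finite \<Rightarrow>\<^sub>0 nat"
    and C :: "nat \<Rightarrow> nat \<Rightarrow> nat \<Rightarrow> 'k::field"
  assumes supp: "\<And>q j l. j < R (Suc q) \<Longrightarrow> C q j l \<noteq> 0 \<Longrightarrow> l < R q \<and> mdvd (B q l) (B (Suc q) j)"
    and cplx: "\<And>q j l. j < R (Suc (Suc q)) \<Longrightarrow> (\<Sum>k<R (Suc q). C (Suc q) j k * C q k l) = 0"
    and exact: "\<And>q m d. combination (R (Suc q)) (B (Suc q)) (C q) m d (\<lambda>_. 0) \<Longrightarrow>
      \<exists>e. combination (R (Suc (Suc q))) (B (Suc (Suc q))) (C (Suc q)) m e d"
begin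

definition entry :: "nat \<Rightarrow> nat \<Rightarrow> nat \<Rightarrow> ('v, 'k) mpoly" where
  "entry q l k = Poly_Mapping.single (B (Suc q) k - B q l) (C q k l)"

text \<open>
  The coordinates of a column of polynomials in multidegree \<open>m\<close>.
\<close>

definition coords :: "nat \<Rightarrow> (nat \<Rightarrow> ('v, 'k) mpoly) \<Rightarrow> ('v \<Rightarrow>\<^sub>0 nat) \<Rightarrow> nat \<Rightarrow> 'k" where
  "coords q y m k = (if k < R q \<and> mdvd (B q k) m then lookup (y k) (m - B q k) else 0)"

lemma coords_supp: "coords q y m k \<noteq> 0 \<Longrightarrow> k < R q \<and> mdvd (B q k) m"
  by (simp add: coords_def split: if_splits)

lemma lookup_entry_sum:
  assumes l: "l < R q" "mdvd (B q l) m"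
  shows "lookup (\<Sum>k<R (Suc q). entry q l k * y k) (m - B q l) = (\<Sum>k<R (Suc q). coords (Suc q) y m k * C q k l)"
proof -
  have "lookup (entry q l k * y k) (m - B q l) = coords (Suc q) y m k * C q k l" if k: "k < R (Suc q)" for k
  proof (cases "C q k l = 0")
    case True
    then show ?thesis by (simp add: entry_def)
  next
    case False
    then have d: "mdvd (B q l) (B (Suc q) k)" using supp k by blast
    have 1: "mdvd (B (Suc q) k - B q l) (m - B q l) \<longleftrightarrow> mdvd (B (Suc q) k) m"
      using d l(2) unfolding mdvd_def lookup_minus
      by (metis diff_le_mono le_diff_iff)
    have 2: "m - B q l - (B (Suc q) k - B q l) = m - B (Suc q) k"
      using d l(2) by (intro poly_mapping_eqI) (simp add: lookup_minus mdvd_def)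
    show ?thesis using k 1 2 by (simp add: entry_def lookup_monom_times coords_def mult.commute[of "C q k l"])
  qed
  then show ?thesis by (simp add: lookup_sum)
qed

lemma coords_entry_sum:
  "coords q (\<lambda>l. \<Sum>k<R (Suc q). entry q l k * y k) m l = (\<Sum>k<R (Suc q). coords (Suc q) y m k * C q k l)"
proof (cases "l < R q \<and> mdvd (B q l) m")
  case True
  then show ?thesis using lookup_entry_sum[of l q m y] by (simp add: coords_def[of q])
next
  case False
  have "coords (Suc q) y m k * C q k l = 0" if "k < R (Suc q)" for k
    using supp[OF that, of l] coords_supp[of "Suc q" y m k] mdvd_trans False by auto
  then have "(\<Sum>k<R (Suc q). coords (Suc q) y m k * C q k l) = 0" by (intro sum.neutral) simp
  then show ?thesis using False by (auto simp: coords_def[of q])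
qed

text \<open>
  Preimages may be found multidegree by multidegree.  They are chosen to be \<open>0\<close> wherever \<open>y\<close> has
  no component, so that only finitely many terms occur.
\<close>

lemma entry_lift:
  assumes comb: "\<And>m. \<exists>e. combination (R (Suc q)) (B (Suc q)) (C q) m e (coords q y m)"
  shows "\<exists>w. \<forall>k<R q. y k = (\<Sum>j<R (Suc q). entry q k j * w j)"
proof -
  obtain e0 where e0: "\<And>m. combination (R (Suc q)) (B (Suc q)) (C q) m (e0 m) (coords q y m)"
    using comb by metis
  define e where "e m = (if coords q y m = (\<lambda>_. 0) then (\<lambda>_. 0) else e0 m)" for m
  have e: "combination (R (Suc q)) (B (Suc q)) (C q) m (e m) (coords q y m)" for m
    using e0[of m] by (auto simp: e_def combination_def)
  have fin: "finite {m. coords q y m \<noteq> (\<lambda>_. 0)}"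
  proof (rule finite_subset)
    show "{m. coords q y m \<noteq> (\<lambda>_. 0)} \<subseteq> (\<Union>k<R q. (\<lambda>n. n + B q k) ` keys (y k))"
    proof
      fix m assume "m \<in> {m. coords q y m \<noteq> (\<lambda>_. 0)}"
      then obtain k where "coords q y m k \<noteq> 0" by (auto simp: fun_eq_iff)
      then have "k < R q" "mdvd (B q k) m" "m - B q k \<in> keys (y k)"
        by (auto simp: coords_def in_keys_iff split: if_splits)
      then show "m \<in> (\<Union>k<R q. (\<lambda>n. n + B q k) ` keys (y k))"
        using mdvd_diff_add[symmetric] by (intro UN_I[of k] image_eqI[of _ _ "m - B q k"]) simp_all
    qed
  qed simp
  define w where "w j = Abs_poly_mapping (\<lambda>n. e (n + B (Suc q) j) j)" for j
  have w: "lookup (w j) n = e (n + B (Suc q) j) j" for j n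
  proof -
    have "finite {n. e (n + B (Suc q) j) j \<noteq> 0}"
    proof (rule finite_subset)
      show "{n. e (n + B (Suc q) j) j \<noteq> 0} \<subseteq> (\<lambda>n. n + B (Suc q) j) -` {m. coords q y m \<noteq> (\<lambda>_. 0)}"
        by (auto simp: e_def)
      show "finite ((\<lambda>n. n + B (Suc q) j) -` {m. coords q y m \<noteq> (\<lambda>_. 0)})"
        using fin by (rule finite_vimageI) (simp add: inj_on_def)
    qed
    then show ?thesis by (simp add: w_def)
  qed
  have coords_w: "coords (Suc q) w m j = e m j" for m j
    using e[of m] by (auto simp: coords_def w mdvd_diff_add combination_def)
  have "y k = (\<Sum>j<R (Suc q). entry q k j * w j)" if k: "k < R q" for k
  proof (rule poly_mapping_eqI)
    fix n
    define m where "m = n + B q k"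
    have m: "mdvd (B q k) m" "m - B q k = n" by (simp_all add: m_def)
    have "lookup (\<Sum>j<R (Suc q). entry q k j * w j) n = (\<Sum>j<R (Suc q). e m j * C q j k)"
      using lookup_entry_sum[OF k m(1), of w] by (simp add: m(2) coords_w)
    also have "\<dots> = coords q y m k" using e[of m] by (simp add: combination_def)
    also have "\<dots> = lookup (y k) n" using k m by (simp add: coords_def)
    finally show "lookup (y k) n = lookup (\<Sum>j<R (Suc q). entry q k j * w j) n" by simp
  qed
  then show ?thesis by blast
qed

lemma free_exact_sequence: "free_exact_sequence R entry (\<lambda>q k. int (monom_degree (B q k)))"
proof
  fix q and y :: "nat \<Rightarrow> ('v, 'k) mpoly"
  assume y: "\<And>l. l < R q \<Longrightarrow> (\<Sum>k<R (Suc q). entry q l k * y k) = 0"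
  show "\<exists>w. \<forall>k<R (Suc q). y k = (\<Sum>j<R (Suc (Suc q)). entry (Suc q) k j * w j)"
  proof (rule entry_lift)
    fix m
    have "(\<Sum>k<R (Suc q). coords (Suc q) y m k * C q k l) = 0" for l
      using y[of l] by (simp add: coords_entry_sum[symmetric]) (simp add: coords_def)
    then have "combination (R (Suc q)) (B (Suc q)) (C q) m (coords (Suc q) y m) (\<lambda>_. 0)"
      using coords_supp by (simp add: combination_def)
    then show "\<exists>e. combination (R (Suc (Suc q))) (B (Suc (Suc q))) (C (Suc q)) m e (coords (Suc q) y m)"
      by (rule exact)
  qed
next
  fix q l and w :: "nat \<Rightarrow> ('v, 'k) mpoly"
  assume l: "l < R q"
  let ?y = "\<lambda>k. \<Sum>j<R (Suc (Suc q)). entry (Suc q) k j * w j"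
  show "(\<Sum>k<R (Suc q). entry q l k * ?y k) = 0"
  proof (rule poly_mapping_eqI)
    fix n
    define m where "m = n + B q l"
    have m: "mdvd (B q l) m" "m - B q l = n" by (simp_all add: m_def)
    have "lookup (\<Sum>k<R (Suc q). entry q l k * ?y k) n = (\<Sum>k<R (Suc q). coords (Suc q) ?y m k * C q k l)"
      using lookup_entry_sum[OF l m(1), of ?y] by (simp only: m(2))
    also have "\<dots> = (\<Sum>k<R (Suc q). \<Sum>j<R (Suc (Suc q)). coords (Suc (Suc q)) w m j * (C (Suc q) j k * C q k l))"
      by (simp add: coords_entry_sum sum_distrib_right mult.assoc)
    also have "\<dots> = (\<Sum>j<R (Suc (Suc q)). coords (Suc (Suc q)) w m j * (\<Sum>k<R (Suc q). C (Suc q) j k * C q k l))"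
      by (subst sum.swap) (simp add: sum_distrib_left)
    also have "\<dots> = 0" by (simp add: cplx)
    finally show "lookup (\<Sum>k<R (Suc q). entry q l k * ?y k) n = lookup 0 n" by simp
  qed
next
  fix q l k n
  assume k: "k < R (Suc q)" and n: "n \<in> keys (entry q l k)"
  then have "C q k l \<noteq> 0" "n = B (Suc q) k - B q l" by (auto simp: entry_def split: if_splits)
  then have "B (Suc q) k = n + B q l" using supp[OF k] mdvd_diff_add by metis
  then show "int (monom_degree n) = int (monom_degree (B (Suc q) k)) - int (monom_degree (B q l))"
    by (simp add: monom_degree_add)
qed

end

lemma irrelevant_ideal_monomial:
  fixes n :: "'v \<Rightarrow>\<^sub>0 nat"
  assumes "n \<noteq> 0"
  shows "Poly_Mapping.single n c \<in> (irrelevant_ideal :: ('v, 'k::field) mpoly set)"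
proof -
  obtain v where v: "0 < lookup n v"
    using assms by (metis gr0I lookup_zero poly_mapping_eqI)
  have "n = (n - Poly_Mapping.single v 1) + Poly_Mapping.single v 1"
    using v by (intro mdvd_diff_add[symmetric]) (simp add: mdvd_single Suc_le_eq)
  then have "Poly_Mapping.single n c = Poly_Mapping.single (n - Poly_Mapping.single v 1) c * (pvar v :: ('v, 'k) mpoly)"
    unfolding pvar_def mult_single by simp
  also have "\<dots> \<in> irrelevant_ideal"
    unfolding irrelevant_ideal_def ideal_gen_def
    by (intro module.span_scale[OF module_times] module.span_base[OF module_times]) auto
  finally show ?thesis .
qed

lemma irrelevant_ideal_constant_coeff:
  fixes p :: "('v::finite, 'k::field) mpoly"
  assumes "p \<in> irrelevant_ideal"
  shows "lookup p 0 = 0"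
proof -
  have "p \<in> module.span (*) (range (pvar :: 'v \<Rightarrow> ('v, 'k) mpoly))"
    using assms unfolding irrelevant_ideal_def ideal_gen_def .
  then show ?thesis
  proof (induction rule: module.span_induct_alt[OF module_times, consumes 1])
    case 1
    then show ?case by simp
  next
    case (2 c x y)
    then obtain v where v: "x = pvar v" by blast
    have "Poly_Mapping.single v (1::nat) \<noteq> 0" by (metis lookup_single_eq lookup_zero zero_neq_one)
    then have "lookup (x * c) 0 = 0"
      unfolding v by (intro lookup_times_zero) (simp add: pvar_def lookup_single_not_eq)
    then show ?case using 2 by (simp add: lookup_add mult.commute)
  qed
qed

text \<open>
  The ideal generated by the monomials in \<open>X\<close>, described by the monomials that its elements may
  contain.
\<close>

definition monomial_ideal :: "('v \<Rightarrow>\<^sub>0 nat) set \<Rightarrow> ('v, 'k::field) mpoly set" where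
  "monomial_ideal X = {p. \<forall>n\<in>keys p. \<exists>g\<in>X. mdvd g n}"

text \<open>
  Iterate: the first family is the ideal itself inside the ring, and each further one consists of the
  syzygies of the generators chosen before.
\<close>

theorem minimal_resolution_exists:
  fixes X :: "('v::finite \<Rightarrow>\<^sub>0 nat) set"
  assumes finX: "finite X"
  shows "\<exists>F. minimal_graded_free_resolution (monomial_ideal X :: ('v, 'k::field) mpoly set) F"
proof -
  define V0 :: "('v \<Rightarrow>\<^sub>0 nat) \<Rightarrow> (nat \<Rightarrow> 'k) set" where
    "V0 m = {c. \<forall>k. c k \<noteq> 0 \<longrightarrow> k = 0 \<and> (\<exists>g\<in>X. mdvd g m)}" for m
  have "\<exists>g. minimal_generators V0 g"
  proof (rule minimal_generators_exist)
    fix m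
    show "fvs.subspace (V0 m)"
      by (rule fvs.subspaceI) (auto simp: V0_def fscale_def, (metis add.right_neutral)+)
  next
    fix m m' :: "'v \<Rightarrow>\<^sub>0 nat" assume "mdvd m m'"
    then show "V0 m \<subseteq> V0 m'" unfolding V0_def using mdvd_trans by blast
  next
    fix m c and k :: nat assume "c \<in> V0 m" "1 \<le> k"
    then show "c k = 0" by (auto simp: V0_def)
  next
    fix m
    have "mdvd g (\<Sum>g\<in>X. g)" if "g \<in> X" for g
      using that finX by (auto simp: mdvd_def lookup_sum intro!: member_le_sum)
    then show "V0 m \<subseteq> V0 (monom_min m (\<Sum>g\<in>X. g))"
      unfolding V0_def using mdvd_monom_min by blast
  qed
  then obtain g0 where g0: "minimal_generators V0 g0" by blast
  obtain nx where nx: "\<And>g :: nat \<times> (nat \<Rightarrow> 'v \<Rightarrow>\<^sub>0 nat) \<times> (nat \<Rightarrow> nat \<Rightarrow> 'k).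
      minimal_generators (kernel_space g) (nx g)"
    using kernel_space_generators by metis
  define st where "st q = (nx ^^ q) g0" for q
  define R where "R q = (case q of 0 \<Rightarrow> 1 | Suc i \<Rightarrow> fst (st i))" for q
  define B where "B q = (case q of 0 \<Rightarrow> (\<lambda>_. 0) | Suc i \<Rightarrow> fst (snd (st i)))" for q
  define C where "C q = snd (snd (st q))" for q
  have st: "st q = (R (Suc q), B (Suc q), C q)" for q
    by (simp add: R_def B_def C_def)
  have R0: "R 0 = 1" and B0: "B 0 k = 0" for k by (simp_all add: R_def B_def)
  have gen0: "minimal_generators V0 (R (Suc 0), B (Suc 0), C 0)"
    using g0 unfolding st[symmetric] by (simp add: st_def)
  have genS: "minimal_generators (kernel_space (R (Suc q), B (Suc q), C q))
      (R (Suc (Suc q)), B (Suc (Suc q)), C (Suc q))" for q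
    using nx[of "st q"] unfolding st[symmetric] by (simp add: st_def)
  have rel: "combination (R (Suc q)) (B (Suc q)) (C q) (B (Suc (Suc q)) j) (C (Suc q) j) (\<lambda>_. 0)"
    if "j < R (Suc (Suc q))" for q j
    using genS[of q] that by (auto simp: minimal_generators_def kernel_space_def)
  have in0: "C 0 j \<in> V0 (B (Suc 0) j)" if "j < R (Suc 0)" for j
    using gen0 that by (simp add: minimal_generators_def)
  interpret multigraded_sequence R B C
  proof
    fix q j l assume j: "j < R (Suc q)" "C q j l \<noteq> 0"
    show "l < R q \<and> mdvd (B q l) (B (Suc q) j)"
    proof (cases q)
      case 0
      then show ?thesis using in0[of j] j by (auto simp: V0_def R0 B0)
    next
      case (Suc i)
      then show ?thesis using rel[of j i] j by (auto simp: combination_def)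
    qed
  next
    fix q j l assume "j < R (Suc (Suc q))"
    then show "(\<Sum>k<R (Suc q). C (Suc q) j k * C q k l) = 0"
      using rel[of j q] by (simp add: combination_def)
  next
    fix q m d assume "combination (R (Suc q)) (B (Suc q)) (C q) m d (\<lambda>_. 0)"
    then show "\<exists>e. combination (R (Suc (Suc q))) (B (Suc (Suc q))) (C (Suc q)) m e d"
      using genS[of q] by (auto simp: minimal_generators_def kernel_space_def)
  qed
  have image: "(\<exists>w. p = (\<Sum>j<R 1. entry 0 0 j * w j)) \<longleftrightarrow> p \<in> monomial_ideal X" for p
  proof
    assume "\<exists>w. p = (\<Sum>j<R 1. entry 0 0 j * w j)"
    then obtain w where w: "p = (\<Sum>j<R (Suc 0). entry 0 0 j * w j)" by auto
    show "p \<in> monomial_ideal X"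
      unfolding monomial_ideal_def
    proof (intro CollectI ballI)
      fix n assume "n \<in> keys p"
      then have "(\<Sum>j<R (Suc 0). coords (Suc 0) w n j * C 0 j 0) \<noteq> 0"
        using lookup_entry_sum[of 0 0 n w] by (simp add: R0 B0 w in_keys_iff)
      then obtain j where j: "j < R (Suc 0)" "coords (Suc 0) w n j \<noteq> 0" "C 0 j 0 \<noteq> 0"
        by (metis (no_types, lifting) lessThan_iff mult_eq_0_iff sum.neutral)
      then obtain g where "g \<in> X" "mdvd g (B (Suc 0) j)" using in0[of j] by (auto simp: V0_def)
      then show "\<exists>g\<in>X. mdvd g n" using coords_supp[OF j(2)] mdvd_trans by blast
    qed
  next
    assume p: "p \<in> monomial_ideal X"
    have "\<exists>w. \<forall>k<R 0. (\<lambda>_. p) k = (\<Sum>j<R (Suc 0). entry 0 k j * w j)"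
    proof (rule entry_lift)
      fix m
      have "coords 0 (\<lambda>_. p) m \<in> V0 m"
        using p by (auto simp: V0_def coords_def R0 B0 monomial_ideal_def in_keys_iff)
      then show "\<exists>e. combination (R (Suc 0)) (B (Suc 0)) (C 0) m e (coords 0 (\<lambda>_. p) m)"
        using gen0 by (simp add: minimal_generators_def)
    qed
    then show "\<exists>w. p = (\<Sum>j<R 1. entry 0 0 j * w j)" by (simp add: R0)
  qed
  have irr: "entry (Suc q) l k \<in> irrelevant_ideal" if "l < R (Suc q)" "k < R (Suc (Suc q))" for q l k
  proof (cases "C (Suc q) k l = 0")
    case True
    then show ?thesis
      by (simp add: entry_def irrelevant_ideal_def ideal_gen_def module.span_zero[OF module_times])
  next
    case False
    have "B (Suc q) l \<noteq> B (Suc (Suc q)) k"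
    proof
      assume eq: "B (Suc q) l = B (Suc (Suc q)) k"
      have minimal: "\<And>m d. combination (R (Suc q)) (B (Suc q)) (C q) m d (\<lambda>_. 0) \<Longrightarrow>
          (\<forall>j<R (Suc q). B (Suc q) j = m \<longrightarrow> d j = 0)"
        using gen0 genS by (cases q) (auto simp: minimal_generators_def)
      show False using minimal[OF rel[OF that(2)]] that(1) eq False by simp
    qed
    moreover have "mdvd (B (Suc q) l) (B (Suc (Suc q)) k)" using supp[OF that(2) False] by simp
    ultimately have "B (Suc (Suc q)) k - B (Suc q) l \<noteq> 0" by (metis add.left_neutral mdvd_diff_add)
    then show ?thesis unfolding entry_def by (rule irrelevant_ideal_monomial)
  qed
  have "graded_free_resolution (monomial_ideal X) \<lparr>rk = \<lambda>i. R (Suc i),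
      shift = \<lambda>i k. int (monom_degree (B (Suc i) k)), aug = vec (R 1) (entry 0 0),
      bd = \<lambda>i. mat (R (Suc i)) (R (Suc (Suc i))) (\<lambda>(l, k). entry (Suc i) l k)\<rparr>"
    by (rule exact_sequence_resolution[OF free_exact_sequence]) (use image in \<open>simp_all add: R0 B0\<close>)
  then have "minimal_graded_free_resolution (monomial_ideal X) \<lparr>rk = \<lambda>i. R (Suc i),
      shift = \<lambda>i k. int (monom_degree (B (Suc i) k)), aug = vec (R 1) (entry 0 0),
      bd = \<lambda>i. mat (R (Suc i)) (R (Suc (Suc i))) (\<lambda>(l, k). entry (Suc i) l k)\<rparr>"
    by (simp add: minimal_graded_free_resolution_def irr)
  then show ?thesis by blast
qed

section \<open>Powers of edge ideals\<close>

text \<open>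
  For the chosen minimal resolution the maximum that defines the regularity ranges over a finite set by
  \<open>minimal_rank_zero\<close>, and \<open>generator_of_degree\<close> puts \<open>monom_degree m - p\<close> into it.
\<close>

theorem regularity_lower_bound:
  fixes X :: "('v::finite \<Rightarrow>\<^sub>0 nat) set" and h :: "'v set \<Rightarrow> 'k::field"
  assumes finX: "finite X"
    and s0: "mdvd (sqfree (- \<sigma>0)) m" "card \<sigma>0 + Suc p = card (UNIV :: 'v set)"
    and inM: "\<And>v. v \<notin> \<sigma>0 \<Longrightarrow> \<exists>g\<in>X. mdvd g (m - sqfree (- insert v \<sigma>0))"
    and notM: "\<And>\<sigma> g. h \<sigma> \<noteq> 0 \<Longrightarrow> g \<in> X \<Longrightarrow> \<not> mdvd g (m - sqfree (- \<sigma>))"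
    and cycle: "\<And>\<rho>. mdvd (sqfree (- \<rho>)) m \<Longrightarrow> face_sum h \<rho> = 0"
    and h0: "h \<sigma>0 \<noteq> 0"
  shows "int (monom_degree m) - int p \<le> regularity (monomial_ideal X :: ('v, 'k) mpoly set)"
proof -
  let ?J = "monomial_ideal X :: ('v, 'k) mpoly set"
  define F where "F = (SOME F. minimal_graded_free_resolution ?J F)"
  have F: "minimal_graded_free_resolution ?J F"
    unfolding F_def using minimal_resolution_exists[OF finX] by (rule someI_ex)
  then have res: "graded_free_resolution ?J F"
    and irr: "\<And>i l k. l < rk F i \<Longrightarrow> k < rk F (Suc i) \<Longrightarrow> bd F i $$ (l, k) \<in> irrelevant_ideal"
    by (auto simp: minimal_graded_free_resolution_def)
  interpret free_exact_sequence "res_rank F" "res_entry F" "res_shift F"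
    using res by (rule resolution_exact_sequence)
  have betti: "graded_betti ?J i j \<noteq> 0 \<longleftrightarrow> (\<exists>k<rk F i. shift F i k = j)" for i j
    unfolding graded_betti_def Let_def F_def[symmetric] by (auto simp: card_eq_0_iff)
  have rank_zero: "rk F i = 0" if "card (UNIV :: 'v set) \<le> i" for i
    using minimal_rank_zero[of i] irr irrelevant_ideal_constant_coeff that by auto
  let ?D = "{j - int i | i j. graded_betti ?J i j \<noteq> 0}"
  have "?D \<subseteq> (\<Union>i<card (UNIV :: 'v set). (\<lambda>k. shift F i k - int i) ` {..<rk F i})"
  proof
    fix x assume "x \<in> ?D"
    then obtain i j where "x = j - int i" "graded_betti ?J i j \<noteq> 0" by blast
    then obtain k where ik: "x = shift F i k - int i" "k < rk F i" using betti[of i j] by blast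
    then have "i < card (UNIV :: 'v set)" using rank_zero[of i] by (metis less_nat_zero_code not_le)
    then show "x \<in> (\<Union>i<card (UNIV :: 'v set). (\<lambda>k. shift F i k - int i) ` {..<rk F i})"
      using ik by blast
  qed
  then have fin: "finite ?D" by (rule finite_subset) auto
  have "\<exists>k<res_rank F (Suc p). res_shift F (Suc p) k = int (monom_degree m)"
  proof (rule generator_of_degree[where M = "{n. \<exists>g\<in>X. mdvd g n}", OF _ _ _ s0])
    show "(\<exists>w. g = (\<Sum>j<res_rank F 1. res_entry F 0 0 j * w j)) \<longleftrightarrow> keys g \<subseteq> {n. \<exists>g\<in>X. mdvd g n}" for g
      unfolding resolution_exact_sequence(2)[OF res] by (auto simp: monomial_ideal_def)
    show "h \<sigma>0 \<noteq> 0" by (rule h0)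
  qed (use inM notM cycle in auto)
  then have "graded_betti ?J p (int (monom_degree m)) \<noteq> 0" unfolding betti by simp
  then have "int (monom_degree m) - int p \<in> ?D" by blast
  then show ?thesis unfolding regularity_def by (rule Max_ge[OF fin])
qed

lemma monomial_ideal_subspace:
  "module.subspace (*) (monomial_ideal X :: ('v::finite, 'k::field) mpoly set)"
proof (rule module.subspaceI[OF module_times])
  show "0 \<in> (monomial_ideal X :: ('v, 'k) mpoly set)" by (simp add: monomial_ideal_def)
next
  fix p q :: "('v, 'k) mpoly" assume "p \<in> monomial_ideal X" "q \<in> monomial_ideal X"
  then show "p + q \<in> monomial_ideal X"
    using keys_add[of p q] by (auto simp: monomial_ideal_def)
next
  fix c p :: "('v, 'k) mpoly" assume p: "p \<in> monomial_ideal X"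
  show "c * p \<in> monomial_ideal X"
    unfolding monomial_ideal_def
  proof (intro CollectI ballI)
    fix n assume "n \<in> keys (c * p)"
    then obtain s t where st: "n = s + t" "t \<in> keys p" using keys_mult[of c p] by auto
    then obtain g where "g \<in> X" "mdvd g t" using p by (auto simp: monomial_ideal_def)
    moreover have "mdvd t n" using st by simp
    ultimately show "\<exists>g\<in>X. mdvd g n" using mdvd_trans by blast
  qed
qed

lemma poly_mapping_sum_single: "p = (\<Sum>n\<in>keys p. Poly_Mapping.single n (lookup p n))"
proof (rule poly_mapping_eqI)
  fix k
  have "lookup (\<Sum>n\<in>keys p. Poly_Mapping.single n (lookup p n)) k =
      (\<Sum>n\<in>keys p. if n = k then lookup p k else 0)"
    unfolding lookup_sum by (rule sum.cong) (auto simp: lookup_single when_def)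
  then show "lookup p k = lookup (\<Sum>n\<in>keys p. Poly_Mapping.single n (lookup p n)) k"
    by (auto simp: in_keys_iff)
qed

lemma monomial_mem_monomial_ideal: "g \<in> X \<Longrightarrow> Poly_Mapping.single g c \<in> monomial_ideal X"
  by (auto simp: monomial_ideal_def intro!: bexI[of _ g])

lemma monomial_ideal_eq_gen:
  fixes X :: "('v::finite \<Rightarrow>\<^sub>0 nat) set"
  shows "(monomial_ideal X :: ('v, 'k::field) mpoly set) = ideal_gen ((\<lambda>g. Poly_Mapping.single g 1) ` X)"
    (is "_ = ideal_gen ?S")
proof
  show "monomial_ideal X \<subseteq> ideal_gen ?S"
  proof
    fix p :: "('v, 'k) mpoly" assume p: "p \<in> monomial_ideal X"
    have "(\<Sum>n\<in>keys p. Poly_Mapping.single n (lookup p n)) \<in> module.span (*) ?S"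
    proof (rule module.span_sum[OF module_times])
      fix n assume "n \<in> keys p"
      then obtain g where g: "g \<in> X" "mdvd g n" using p by (auto simp: monomial_ideal_def)
      have "Poly_Mapping.single n (lookup p n) = Poly_Mapping.single (n - g) (lookup p n) * Poly_Mapping.single g 1"
        using mdvd_diff_add[OF g(2)] by (simp add: mult_single)
      also have "\<dots> \<in> module.span (*) ?S"
        by (intro module.span_scale[OF module_times] module.span_base[OF module_times]) (use g in auto)
      finally show "Poly_Mapping.single n (lookup p n) \<in> module.span (*) ?S" .
    qed
    then show "p \<in> ideal_gen ?S" unfolding ideal_gen_def using poly_mapping_sum_single[of p] by simp
  qed
  have "?S \<subseteq> (monomial_ideal X :: ('v, 'k) mpoly set)"
    using monomial_mem_monomial_ideal by blast
  then show "ideal_gen ?S \<subseteq> monomial_ideal X"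
    unfolding ideal_gen_def by (rule module.span_minimal[OF module_times _ monomial_ideal_subspace])
qed

lemma ideal_times_monomial_ideal:
  fixes X Y :: "('v::finite \<Rightarrow>\<^sub>0 nat) set"
  shows "ideal_times (monomial_ideal X) (monomial_ideal Y :: ('v, 'k::field) mpoly set) =
    monomial_ideal {x + y | x y. x \<in> X \<and> y \<in> Y}"
    (is "_ = monomial_ideal ?Z")
proof
  have "{a * b | a b. a \<in> monomial_ideal X \<and> b \<in> monomial_ideal Y} \<subseteq> (monomial_ideal ?Z :: ('v, 'k) mpoly set)"
  proof
    fix p :: "('v, 'k) mpoly" assume "p \<in> {a * b | a b. a \<in> monomial_ideal X \<and> b \<in> monomial_ideal Y}"
    then obtain a b where p: "p = a * b" "a \<in> monomial_ideal X" "b \<in> monomial_ideal Y" by blast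
    show "p \<in> monomial_ideal ?Z"
      unfolding monomial_ideal_def
    proof (intro CollectI ballI)
      fix n assume "n \<in> keys p"
      then obtain s t where st: "n = s + t" "s \<in> keys a" "t \<in> keys b" using keys_mult[of a b] p by auto
      then obtain x y where "x \<in> X" "mdvd x s" "y \<in> Y" "mdvd y t"
        using p unfolding monomial_ideal_def by blast
      then show "\<exists>g\<in>?Z. mdvd g n"
        using st(1) by (intro bexI[of _ "x + y"]) (auto simp: mdvd_def lookup_add add_mono)
    qed
  qed
  then show "ideal_times (monomial_ideal X) (monomial_ideal Y) \<subseteq> (monomial_ideal ?Z :: ('v, 'k) mpoly set)"
    unfolding ideal_times_def ideal_gen_def by (rule module.span_minimal[OF module_times _ monomial_ideal_subspace])
  have "(\<lambda>g. Poly_Mapping.single g 1) ` ?Z \<subseteq>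
      {a * b | a b. a \<in> (monomial_ideal X :: ('v, 'k) mpoly set) \<and> b \<in> monomial_ideal Y}"
  proof
    fix p :: "('v, 'k) mpoly" assume "p \<in> (\<lambda>g. Poly_Mapping.single g 1) ` ?Z"
    then obtain x y where xy: "p = Poly_Mapping.single (x + y) 1" "x \<in> X" "y \<in> Y" by blast
    have "p = Poly_Mapping.single x 1 * Poly_Mapping.single y 1" using xy(1) by (simp add: mult_single)
    moreover have "Poly_Mapping.single x 1 \<in> (monomial_ideal X :: ('v, 'k) mpoly set)"
      "Poly_Mapping.single y 1 \<in> (monomial_ideal Y :: ('v, 'k) mpoly set)"
      using xy by (simp_all add: monomial_mem_monomial_ideal)
    ultimately show "p \<in> {a * b | a b. a \<in> (monomial_ideal X :: ('v, 'k) mpoly set) \<and> b \<in> monomial_ideal Y}"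
      by blast
  qed
  then show "(monomial_ideal ?Z :: ('v, 'k) mpoly set) \<subseteq> ideal_times (monomial_ideal X) (monomial_ideal Y)"
    unfolding monomial_ideal_eq_gen[of ?Z] ideal_times_def ideal_gen_def
    by (rule module.span_mono[OF module_times])
qed

definition edge_monomials :: "'v::finite ugraph \<Rightarrow> ('v \<Rightarrow>\<^sub>0 nat) set" where
  "edge_monomials G = {Poly_Mapping.single u 1 + Poly_Mapping.single v 1 | u v. {u, v} \<in> edges G}"

fun edge_products :: "'v::finite ugraph \<Rightarrow> nat \<Rightarrow> ('v \<Rightarrow>\<^sub>0 nat) set" where
  "edge_products G 0 = {0}"
| "edge_products G (Suc s) = {g + h | g h. g \<in> edge_monomials G \<and> h \<in> edge_products G s}"

lemma finite_edge_products: "finite (edge_products G s)"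
proof (induction s)
  case (Suc s)
  have "edge_monomials G \<subseteq> (\<lambda>(u, v). Poly_Mapping.single u 1 + Poly_Mapping.single v 1) ` UNIV"
    unfolding edge_monomials_def by auto
  then have "finite (edge_monomials G)" by (rule finite_subset) simp
  then have "finite ((\<lambda>(g, h). g + h) ` (edge_monomials G \<times> edge_products G s))" using Suc by simp
  moreover have "edge_products G (Suc s) = (\<lambda>(g, h). g + h) ` (edge_monomials G \<times> edge_products G s)" by auto
  ultimately show ?case by simp
qed simp

lemma edge_ideal_power:
  "ideal_power (edge_ideal G :: ('v::finite, 'k::field) mpoly set) s = monomial_ideal (edge_products G s)"
proof (induction s)
  case 0
  then show ?case by (auto simp: monomial_ideal_def)
next
  case (Suc s)
  have "{pvar u * pvar v | u v. {u, v} \<in> edges G} = (\<lambda>g. Poly_Mapping.single g (1::'k)) ` edge_monomials G"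
    by (auto simp: pvar_def mult_single edge_monomials_def image_iff)
  then have "(edge_ideal G :: ('v, 'k) mpoly set) = monomial_ideal (edge_monomials G)"
    unfolding edge_ideal_def monomial_ideal_eq_gen by simp
  then show ?case using Suc by (simp add: ideal_times_monomial_ideal)
qed

lemma edge_products_power:
  "{x, y} \<in> edges G \<Longrightarrow> Poly_Mapping.single x s + Poly_Mapping.single y s \<in> edge_products G s"
proof (induction s)
  case (Suc s)
  have "Poly_Mapping.single x (Suc s) + Poly_Mapping.single y (Suc s) =
      (Poly_Mapping.single x 1 + Poly_Mapping.single y 1) + (Poly_Mapping.single x s + Poly_Mapping.single y s)"
    by (rule poly_mapping_eqI) (simp add: lookup_add lookup_single when_def)
  then show ?case using Suc unfolding edge_products.simps edge_monomials_def by blast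
qed simp

text \<open>
  If \<open>{x, y}\<close> is the only edge inside the support of a product of \<open>s\<close> edges, then all
  \<open>s\<close> factors are equal to it.
\<close>

lemma edge_products_single_edge:
  assumes "g \<in> edge_products G s"
    and "\<And>e. e \<in> edges G \<Longrightarrow> (\<And>v. v \<in> e \<Longrightarrow> 0 < lookup g v) \<Longrightarrow> e = {x, y}"
  shows "s \<le> lookup g x \<and> s \<le> lookup g y"
  using assms
proof (induction s arbitrary: g)
  case (Suc s)
  then obtain u v k where g: "g = Poly_Mapping.single u 1 + Poly_Mapping.single v 1 + k"
      "{u, v} \<in> edges G" "k \<in> edge_products G s"
    by (auto simp: edge_monomials_def)
  have uv: "{u, v} = {x, y}" by (rule Suc.prems(2)[OF g(2)]) (auto simp: g(1) lookup_add lookup_single)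
  have "s \<le> lookup k x \<and> s \<le> lookup k y"
  proof (rule Suc.IH[OF g(3)])
    fix e assume "e \<in> edges G" "\<And>v. v \<in> e \<Longrightarrow> 0 < lookup k v"
    then show "e = {x, y}" by (intro Suc.prems(2)) (auto simp: g(1) lookup_add)
  qed
  moreover have "0 < lookup (Poly_Mapping.single u (1::nat) + Poly_Mapping.single v 1) z" if "z \<in> {x, y}" for z
    using that unfolding uv[symmetric] by (auto simp: lookup_add lookup_single)
  ultimately show ?case unfolding g(1) lookup_add[of _ k] by (fastforce simp: Suc_le_eq)
qed simp

text \<open>
  The monomial \<open>m\<close> is the product of the variables in \<open>W\<close> times \<open>(x * y)\<close> to the power
  \<open>s - 1\<close>.  For \<open>- W \<subseteq> \<sigma>\<close>, the quotient of \<open>m\<close> by the variables outside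
  \<open>\<sigma>\<close> lies in the \<open>s\<close>-th power of the edge ideal if and only if \<open>\<sigma> \<inter> W\<close>
  contains an edge.  An edge other than \<open>{x, y}\<close> can be multiplied by \<open>(x * y)\<close> to the
  power \<open>s - 1\<close>.  Conversely, if \<open>\<sigma> \<inter> W\<close> is independent, then \<open>{x, y}\<close> is the
  only possible edge in the support of the quotient, and the exponent of \<open>x\<close> or of \<open>y\<close> has
  dropped to \<open>s - 1\<close>.  So the answer does not depend on \<open>s\<close>, and a cycle of independent sets
  yields the bound.
\<close>

theorem edge_power_regularity:
  fixes G :: "'v::finite ugraph" and h :: "'v set \<Rightarrow> 'k::field"
  assumes G: "simple_graph G" and s: "1 \<le> s"
    and xy: "x \<noteq> y" "{x, y} \<in> edges G" "{x, y} \<subseteq> W"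
    and isolated: "\<And>e. e \<in> edges G \<Longrightarrow> e \<subseteq> W \<Longrightarrow> e \<inter> {x, y} \<noteq> {} \<Longrightarrow> e = {x, y}"
    and h: "\<And>\<sigma>. h \<sigma> \<noteq> 0 \<Longrightarrow> - W \<subseteq> \<sigma>" "\<And>\<sigma> e. h \<sigma> \<noteq> 0 \<Longrightarrow> e \<in> edges G \<Longrightarrow> \<not> e \<subseteq> \<sigma> \<inter> W"
    and cycle: "\<And>\<rho>. - W \<subseteq> \<rho> \<Longrightarrow> face_sum h \<rho> = 0"
    and h0: "h \<sigma>0 \<noteq> 0" "card \<sigma>0 = card (- W) + d"
    and facet: "\<And>v. v \<notin> \<sigma>0 \<Longrightarrow> \<exists>e\<in>edges G. e \<subseteq> insert v \<sigma>0 \<inter> W"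
  shows "2 * int s + int d - 1 \<le> regularity (ideal_power (edge_ideal G :: ('v, 'k) mpoly set) s)"
proof -
  define m where "m = sqfree W + Poly_Mapping.single x (s - 1) + Poly_Mapping.single y (s - 1)"
  have m: "lookup m v = (if v \<in> {x, y} then s else if v \<in> W then 1 else 0)" for v
    using xy s by (auto simp: m_def lookup_add lookup_sqfree lookup_single when_def)
  have deg: "monom_degree m = card W + 2 * (s - 1)"
    by (simp add: m_def monom_degree_add monom_degree_sqfree)
  have dvd_m: "mdvd (sqfree (- \<rho>)) m \<longleftrightarrow> - W \<subseteq> \<rho>" for \<rho>
    using xy s by (auto simp: mdvd_sqfree m split: if_splits)
  have "\<sigma>0 \<noteq> UNIV" using h(2)[OF h0(1) xy(2)] xy(3) by auto
  then have "card \<sigma>0 < card (UNIV :: 'v set)" by (intro psubset_card_mono) auto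
  then obtain p where p: "card \<sigma>0 + Suc p = card (UNIV :: 'v set)"
    by (metis add_Suc_right less_imp_Suc_add)
  have "card (UNIV :: 'v set) = card W + card (- W)"
    by (metis Compl_partition card_Un_disjoint finite Compl_disjoint)
  then have d: "int (monom_degree m) - int p = 2 * int s + int d - 1"
    using p h0(2) s by (simp add: deg)
  have "int (monom_degree m) - int p \<le> regularity (monomial_ideal (edge_products G s) :: ('v, 'k) mpoly set)"
  proof (rule regularity_lower_bound[OF finite_edge_products _ p, where h = h])
    show "mdvd (sqfree (- \<sigma>0)) m" using dvd_m h(1)[OF h0(1)] by simp
    show "h \<sigma>0 \<noteq> 0" by (rule h0(1))
    show "face_sum h \<rho> = 0" if "mdvd (sqfree (- \<rho>)) m" for \<rho> using that dvd_m cycle by simp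
  next
    fix v assume "v \<notin> \<sigma>0"
    then obtain e where e: "e \<in> edges G" "e \<subseteq> insert v \<sigma>0 \<inter> W" using facet by blast
    let ?n = "m - sqfree (- insert v \<sigma>0)"
    have n: "lookup ?n w = lookup m w - (if w \<in> insert v \<sigma>0 then 0 else 1)" for w
      by (simp add: lookup_minus lookup_sqfree)
    show "\<exists>g\<in>edge_products G s. mdvd g ?n"
    proof (cases "e = {x, y}")
      case True
      have "mdvd (Poly_Mapping.single x s + Poly_Mapping.single y s) ?n"
        unfolding mdvd_def
      proof
        fix w
        have mem: "x \<in> insert v \<sigma>0" "y \<in> insert v \<sigma>0" using e(2) True by auto
        consider "w = x" | "w = y" | "w \<notin> {x, y}" by blast
        then show "lookup (Poly_Mapping.single x s + Poly_Mapping.single y s) w \<le> lookup ?n w"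
          by cases (use mem xy(1) in \<open>auto simp: n m lookup_add lookup_single when_def\<close>)
      qed
      then show ?thesis using edge_products_power[OF xy(2)] by blast
    next
      case False
      then have disj: "e \<inter> {x, y} = {}" using isolated e by blast
      obtain a b where ab: "e = {a, b}" "a \<noteq> b"
        using G e(1) unfolding simple_graph_def by (metis card_2_iff)
      obtain s' where s': "s = Suc s'" using s by (cases s) auto
      let ?g = "(Poly_Mapping.single a 1 + Poly_Mapping.single b 1) +
          (Poly_Mapping.single x s' + Poly_Mapping.single y s')"
      have "?g \<in> edge_products G s"
        using edge_products_power[OF xy(2), of s'] e(1) ab unfolding s' edge_products.simps edge_monomials_def
        by blast
      moreover have "mdvd ?g ?n"
        unfolding mdvd_def
      proof
        fix w
        have ne: "a \<noteq> x" "a \<noteq> y" "b \<noteq> x" "b \<noteq> y" using disj ab by auto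
        consider "w = x" | "w = y" | "w \<in> {a, b}" | "w \<notin> {a, b, x, y}" by blast
        then show "lookup ?g w \<le> lookup ?n w"
        proof cases
          case 3
          then have "w \<in> insert v \<sigma>0" "w \<in> W" "w \<notin> {x, y}" using e(2) ab ne by auto
          then have "lookup ?n w = 1" unfolding n m by simp
          moreover have "lookup ?g w = 1"
            using 3 ab(2) ne by (auto simp: lookup_add lookup_single)
          ultimately show ?thesis by simp
        qed (use ne xy(1) in \<open>auto simp: n m s' lookup_add lookup_single when_def\<close>)
      qed
      ultimately show ?thesis by blast
    qed
  next
    fix \<sigma> g assume \<sigma>: "h \<sigma> \<noteq> 0" and g: "g \<in> edge_products G s"
    let ?n = "m - sqfree (- \<sigma>)"
    have n: "lookup ?n w = lookup m w - (if w \<in> \<sigma> then 0 else 1)" for w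
      by (simp add: lookup_minus lookup_sqfree)
    show "\<not> mdvd g ?n"
    proof
      assume dvd: "mdvd g ?n"
      have "s \<le> lookup g x \<and> s \<le> lookup g y"
      proof (rule edge_products_single_edge[OF g])
        fix e assume e: "e \<in> edges G" and pos: "\<And>v. v \<in> e \<Longrightarrow> 0 < lookup g v"
        have v: "v \<in> {x, y} \<or> v \<in> \<sigma> \<inter> W" if "v \<in> e" for v
        proof (rule ccontr)
          assume "\<not> (v \<in> {x, y} \<or> v \<in> \<sigma> \<inter> W)"
          then have "lookup ?n v = 0" by (auto simp: n m)
          moreover have "lookup g v \<le> lookup ?n v" using dvd unfolding mdvd_def by blast
          ultimately show False using pos[OF that] by linarith
        qed
        then have "e \<subseteq> W" using xy(3) by blast
        moreover have "e \<inter> {x, y} \<noteq> {}" using v h(2)[OF \<sigma> e] by blast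
        ultimately show "e = {x, y}" using isolated e by blast
      qed
      moreover have "lookup g x \<le> lookup ?n x" "lookup g y \<le> lookup ?n y"
        using dvd unfolding mdvd_def by blast+
      ultimately have "s \<le> lookup ?n x" "s \<le> lookup ?n y" by linarith+
      then have "x \<in> \<sigma>" "y \<in> \<sigma>" using s unfolding n m by (auto split: if_splits)
      then show False using h(2)[OF \<sigma> xy(2)] xy(3) by blast
    qed
  qed
  then show ?thesis unfolding edge_ideal_power d .
qed

section \<open>Cycles of independent sets\<close>

lemma wedge_nonzero: "wedge v h \<sigma> \<noteq> 0 \<Longrightarrow> v \<in> \<sigma> \<and> h (\<sigma> - {v}) \<noteq> 0"
  by (auto simp: wedge_def split: if_splits)

lemma face_sum_diff: "face_sum (\<lambda>\<sigma>. f \<sigma> - g \<sigma>) \<rho> = face_sum f \<rho> - face_sum g \<rho>"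
  by (simp add: face_sum_def sum_subtractf right_diff_distrib)

lemma face_sum_add: "face_sum (\<lambda>\<sigma>. f \<sigma> + g \<sigma>) \<rho> = face_sum f \<rho> + face_sum g \<rho>"
  by (simp add: face_sum_def sum.distrib distrib_left)

lemma face_sum_wedge_cycle:
  fixes h :: "'v::finite set \<Rightarrow> 'k::comm_ring_1"
  assumes cyc: "\<And>\<rho>. - W \<subseteq> \<rho> \<Longrightarrow> face_sum h \<rho> = 0" and v: "v \<in> W" and \<rho>: "- W \<subseteq> \<rho>"
  shows "face_sum (wedge v h) \<rho> = h \<rho>"
proof -
  have "wedge v (face_sum h) \<rho> = 0"
  proof (cases "v \<in> \<rho>")
    case True
    then have "face_sum h (\<rho> - {v}) = 0" using v \<rho> by (intro cyc) auto
    then show ?thesis by (simp add: wedge_def)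
  qed (simp add: wedge_def)
  then show ?thesis using face_sum_wedge[of v h \<rho>] by simp
qed

lemma face_sum_wedge_wedge_cycle:
  fixes h :: "'v::finite set \<Rightarrow> 'k::comm_ring_1"
  assumes cyc: "\<And>\<rho>. - W \<subseteq> \<rho> \<Longrightarrow> face_sum h \<rho> = 0" and W: "a \<in> W" "b \<in> W" and \<rho>: "- W \<subseteq> \<rho>"
  shows "face_sum (wedge a (wedge b h)) \<rho> = wedge b h \<rho> - wedge a h \<rho>"
proof -
  have "face_sum (wedge b h) (\<rho> - {a}) = h (\<rho> - {a})" if "a \<in> \<rho>"
    by (rule face_sum_wedge_cycle[OF cyc W(2)]) (use W(1) \<rho> in auto)
  then have "wedge a (face_sum (wedge b h)) \<rho> = wedge a h \<rho>" by (simp add: wedge_def)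
  then show ?thesis using face_sum_wedge[of a "wedge b h" \<rho>] by (simp add: algebra_simps)
qed

text \<open>
  A cycle in the independence complex of the subgraph on \<open>U \<subseteq> W\<close> together with a face \<open>\<sigma>0\<close>
  of its support that is a maximal independent set and has \<open>d\<close> vertices.  All faces are enlarged by the vertices
  outside \<open>W\<close>, because these variables do not occur in the multidegree in question; accordingly only
  the faces that contain \<open>- W\<close> count in the cycle condition.
\<close>

definition independent_cycle :: "'v::finite ugraph \<Rightarrow> 'v set \<Rightarrow> 'v set \<Rightarrow> nat \<Rightarrow> ('v set \<Rightarrow> 'k::field) \<Rightarrow> 'v set \<Rightarrow> bool" where
  "independent_cycle G W U d h \<sigma>0 \<longleftrightarrow>
     (\<forall>\<sigma>. h \<sigma> \<noteq> 0 \<longrightarrow> - W \<subseteq> \<sigma> \<and> \<sigma> \<subseteq> - W \<union> U \<and> (\<forall>e\<in>edges G. \<not> e \<subseteq> \<sigma> \<inter> U)) \<and>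
     (\<forall>\<rho>. - W \<subseteq> \<rho> \<longrightarrow> face_sum h \<rho> = 0) \<and>
     h \<sigma>0 \<noteq> 0 \<and> card \<sigma>0 = card (- W) + d \<and>
     (\<forall>v\<in>U - \<sigma>0. \<exists>e\<in>edges G. e \<subseteq> insert v \<sigma>0 \<inter> U)"

lemma independent_cycleD:
  assumes "independent_cycle G W U d h \<sigma>0"
  shows "\<And>\<sigma>. h \<sigma> \<noteq> 0 \<Longrightarrow> - W \<subseteq> \<sigma>"
    and "\<And>\<sigma>. h \<sigma> \<noteq> 0 \<Longrightarrow> \<sigma> \<subseteq> - W \<union> U"
    and "\<And>\<sigma> e. h \<sigma> \<noteq> 0 \<Longrightarrow> e \<in> edges G \<Longrightarrow> \<not> e \<subseteq> \<sigma> \<inter> U"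
    and "\<And>\<rho>. - W \<subseteq> \<rho> \<Longrightarrow> face_sum h \<rho> = 0"
    and "h \<sigma>0 \<noteq> 0" and "card \<sigma>0 = card (- W) + d"
    and "\<And>v. v \<in> U - \<sigma>0 \<Longrightarrow> \<exists>e\<in>edges G. e \<subseteq> insert v \<sigma>0 \<inter> U"
  using assms unfolding independent_cycle_def by blast+

lemma independent_cycle_empty:
  assumes "simple_graph G"
  shows "independent_cycle G W {} 0 (\<lambda>\<sigma>. if \<sigma> = - W then 1 else 0) (- W)"
proof -
  have "\<not> e \<subseteq> {}" if "e \<in> edges G" for e
    using assms that by (auto simp: simple_graph_def)
  moreover have "face_sum (\<lambda>\<sigma>. if \<sigma> = - W then 1 else (0 :: 'b)) \<rho> = 0" if "- W \<subseteq> \<rho>" for \<rho>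
    unfolding face_sum_def using that by (intro sum.neutral) auto
  ultimately show ?thesis unfolding independent_cycle_def by auto
qed

text \<open>
  The independence complex of a disjoint union of graphs is the join of their independence complexes.  The
  hypotheses on \<open>h'\<close> say that it is a product of \<open>h\<close> with a cycle of independent subsets of the new
  component \<open>A\<close>.
\<close>

lemma independent_cycle_extend:
  fixes h h' :: "'v::finite set \<Rightarrow> 'k::field"
  assumes h: "independent_cycle G W U d h \<sigma>0"
    and A: "A \<subseteq> W" "A \<inter> U = {}"
    and separate: "\<And>e. e \<in> edges G \<Longrightarrow> e \<subseteq> U \<union> A \<Longrightarrow> e \<subseteq> U \<or> e \<subseteq> A"
    and h': "\<And>\<sigma>. h' \<sigma> \<noteq> 0 \<Longrightarrow> \<exists>\<tau>. \<tau> \<subseteq> A \<and> \<tau> \<subseteq> \<sigma> \<and> (\<forall>e\<in>edges G. \<not> e \<subseteq> \<tau>) \<and> h (\<sigma> - \<tau>) \<noteq> 0"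
    and cyc: "\<And>\<rho>. - W \<subseteq> \<rho> \<Longrightarrow> face_sum h' \<rho> = 0"
    and \<tau>0: "\<tau>0 \<subseteq> A" "card \<tau>0 = t" "h' (\<sigma>0 \<union> \<tau>0) \<noteq> 0"
      "\<And>v. v \<in> A - \<tau>0 \<Longrightarrow> \<exists>e\<in>edges G. e \<subseteq> insert v \<tau>0"
  shows "independent_cycle G W (U \<union> A) (d + t) h' (\<sigma>0 \<union> \<tau>0)"
proof -
  note hD = independent_cycleD(1-3)[OF h]
  note h0 = independent_cycleD(5,6)[OF h] and facet = independent_cycleD(7)[OF h]
  have support: "- W \<subseteq> \<sigma> \<and> \<sigma> \<subseteq> - W \<union> (U \<union> A) \<and> (\<forall>e\<in>edges G. \<not> e \<subseteq> \<sigma> \<inter> (U \<union> A))" if nz: "h' \<sigma> \<noteq> 0" for \<sigma>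
  proof -
    obtain \<tau> where \<tau>: "\<tau> \<subseteq> A" "\<tau> \<subseteq> \<sigma>" "\<forall>e\<in>edges G. \<not> e \<subseteq> \<tau>" "h (\<sigma> - \<tau>) \<noteq> 0"
      using h'[OF nz] by blast
    have "\<not> e \<subseteq> \<sigma> \<inter> (U \<union> A)" if e: "e \<in> edges G" for e
    proof
      assume sub: "e \<subseteq> \<sigma> \<inter> (U \<union> A)"
      then consider "e \<subseteq> U" | "e \<subseteq> A" using separate[OF e] by blast
      then show False
      proof cases
        case 1
        then have "e \<subseteq> (\<sigma> - \<tau>) \<inter> U" using sub \<tau>(1) A(2) by blast
        then show False using hD(3)[OF \<tau>(4) e] by blast
      next
        case 2
        then have "e \<subseteq> \<tau>" using sub hD(2)[OF \<tau>(4)] A by blast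
        then show False using \<tau>(3) e by blast
      qed
    qed
    moreover have "- W \<subseteq> \<sigma>" "\<sigma> \<subseteq> - W \<union> (U \<union> A)" using hD(1,2)[OF \<tau>(4)] \<tau>(1) by blast+
    ultimately show ?thesis by blast
  qed
  have size: "card (\<sigma>0 \<union> \<tau>0) = card (- W) + (d + t)"
  proof -
    have "\<sigma>0 \<inter> \<tau>0 = {}" using hD(2)[OF h0(1)] \<tau>0(1) A by blast
    then show ?thesis using h0(2) \<tau>0(2) by (simp add: card_Un_disjoint)
  qed
  have maximal: "\<exists>e\<in>edges G. e \<subseteq> insert v (\<sigma>0 \<union> \<tau>0) \<inter> (U \<union> A)" if v: "v \<in> (U \<union> A) - (\<sigma>0 \<union> \<tau>0)" for v
  proof (cases "v \<in> U")
    case True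
    then show ?thesis using facet[of v] v by blast
  next
    case False
    then obtain e where "e \<in> edges G" "e \<subseteq> insert v \<tau>0" using \<tau>0(4)[of v] v by blast
    then show ?thesis using \<tau>0(1) v False by (intro bexI[of _ e]) auto
  qed
  have "\<forall>\<sigma>. h' \<sigma> \<noteq> 0 \<longrightarrow> - W \<subseteq> \<sigma> \<and> \<sigma> \<subseteq> - W \<union> (U \<union> A) \<and> (\<forall>e\<in>edges G. \<not> e \<subseteq> \<sigma> \<inter> (U \<union> A))"
    using support by simp
  moreover have "\<forall>\<rho>. - W \<subseteq> \<rho> \<longrightarrow> face_sum h' \<rho> = 0" using cyc by simp
  moreover have "\<forall>v\<in>(U \<union> A) - (\<sigma>0 \<union> \<tau>0). \<exists>e\<in>edges G. e \<subseteq> insert v (\<sigma>0 \<union> \<tau>0) \<inter> (U \<union> A)"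
    using maximal by blast
  ultimately show ?thesis unfolding independent_cycle_def using \<tau>0(3) size by (intro conjI)
qed

definition K2_block :: "'v ugraph \<Rightarrow> 'v set \<Rightarrow> bool" where
  "K2_block G A \<longleftrightarrow> (\<exists>u v. u \<noteq> v \<and> A = {u, v} \<and> {u, v} \<in> edges G)"

definition C5_block :: "'v ugraph \<Rightarrow> 'v set \<Rightarrow> bool" where
  "C5_block G A \<longleftrightarrow> (\<exists>a b c d e. A = {a, b, c, d, e} \<and> distinct [a, b, c, d, e] \<and>
     {a, b} \<in> edges G \<and> {b, c} \<in> edges G \<and> {c, d} \<in> edges G \<and> {d, e} \<in> edges G \<and> {e, a} \<in> edges G \<and>
     {a, c} \<notin> edges G \<and> {c, e} \<notin> edges G \<and> {e, b} \<notin> edges G \<and> {b, d} \<notin> edges G \<and> {d, a} \<notin> edges G)"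

lemma edge_subset_pair:
  assumes "simple_graph G" "e \<in> edges G" "e \<subseteq> {a, b}"
  shows "e = {a, b}"
proof -
  obtain u v where "e = {u, v}" "u \<noteq> v"
    using assms(1,2) unfolding simple_graph_def by (metis card_2_iff)
  then show ?thesis using assms(3) by blast
qed

text \<open>
  The independence complex of an edge is a pair of points, with fundamental cycle \<open>u - v\<close>.
\<close>

lemma independent_cycle_K2:
  fixes h :: "'v::finite set \<Rightarrow> 'k::field"
  assumes G: "simple_graph G" and h: "independent_cycle G W U d h \<sigma>0"
    and A: "A \<subseteq> W" "A \<inter> U = {}" "K2_block G A"
    and separate: "\<And>e. e \<in> edges G \<Longrightarrow> e \<subseteq> U \<union> A \<Longrightarrow> e \<subseteq> U \<or> e \<subseteq> A"
  shows "\<exists>h' :: 'v set \<Rightarrow> 'k. \<exists>\<sigma>'. independent_cycle G W (U \<union> A) (d + card A div 2) h' \<sigma>'"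
proof -
  obtain u v where uv: "u \<noteq> v" "A = {u, v}" "{u, v} \<in> edges G" using A(3) unfolding K2_block_def by blast
  note cyc = independent_cycleD(4)[OF h] and h0 = independent_cycleD(5)[OF h]
  note s0 = independent_cycleD(2)[OF h h0]
  have W: "u \<in> W" "v \<in> W" using A uv by auto
  have n0: "u \<notin> \<sigma>0" "v \<notin> \<sigma>0" using s0 A uv by auto
  have "independent_cycle G W (U \<union> A) (d + 1) (\<lambda>\<sigma>. wedge u h \<sigma> - wedge v h \<sigma>) (\<sigma>0 \<union> {u})"
  proof (rule independent_cycle_extend[OF h A(1,2) separate])
    fix \<sigma> assume "wedge u h \<sigma> - wedge v h \<sigma> \<noteq> 0"
    then have "wedge u h \<sigma> \<noteq> 0 \<or> wedge v h \<sigma> \<noteq> 0" by auto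
    then obtain w where w: "w \<in> {u, v}" "wedge w h \<sigma> \<noteq> 0" by blast
    have "\<forall>e\<in>edges G. \<not> e \<subseteq> {w}"
      using edge_subset_pair[OF G, of _ u v] w(1) uv(1) by blast
    then show "\<exists>\<tau>. \<tau> \<subseteq> A \<and> \<tau> \<subseteq> \<sigma> \<and> (\<forall>e\<in>edges G. \<not> e \<subseteq> \<tau>) \<and> h (\<sigma> - \<tau>) \<noteq> 0"
      using wedge_nonzero[OF w(2)] w(1) uv(2) by (intro exI[of _ "{w}"]) auto
  next
    fix \<rho> assume "- W \<subseteq> \<rho>"
    then show "face_sum (\<lambda>\<sigma>. wedge u h \<sigma> - wedge v h \<sigma>) \<rho> = 0"
      unfolding face_sum_diff using face_sum_wedge_cycle[OF cyc W(1)] face_sum_wedge_cycle[OF cyc W(2)] by simp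
  next
    have "koszul_sign u \<sigma>0 * h \<sigma>0 \<noteq> 0" using koszul_sign_cases[of u \<sigma>0, where 'a = 'k] h0 by auto
    then show "wedge u h (\<sigma>0 \<union> {u}) - wedge v h (\<sigma>0 \<union> {u}) \<noteq> 0"
      using n0 uv(1) by (simp add: wedge_def)
  next
    show "\<exists>e\<in>edges G. e \<subseteq> insert w {u}" if "w \<in> A - {u}" for w
      using that uv by (intro bexI[of _ "{u, v}"]) auto
  qed (simp_all add: uv(2))
  moreover have "card A div 2 = 1" using uv by simp
  ultimately show ?thesis by auto
qed

text \<open>
  The independence complex of a pentagon is the pentagon of its diagonals, a circle; its fundamental cycle
  is the sum of the five diagonals, suitably oriented.
\<close>

lemma independent_cycle_C5:
  fixes h :: "'v::finite set \<Rightarrow> 'k::field"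
  assumes G: "simple_graph G" and h: "independent_cycle G W U d h \<sigma>0"
    and A: "A \<subseteq> W" "A \<inter> U = {}" "C5_block G A"
    and separate: "\<And>e. e \<in> edges G \<Longrightarrow> e \<subseteq> U \<union> A \<Longrightarrow> e \<subseteq> U \<or> e \<subseteq> A"
  shows "\<exists>h' :: 'v set \<Rightarrow> 'k. \<exists>\<sigma>'. independent_cycle G W (U \<union> A) (d + card A div 2) h' \<sigma>'"
proof -
  obtain a b c p q where abc: "A = {a, b, c, p, q}" "distinct [a, b, c, p, q]"
      "{a, b} \<in> edges G" "{b, c} \<in> edges G" "{c, p} \<in> edges G" "{p, q} \<in> edges G" "{q, a} \<in> edges G"
    and non: "{a, c} \<notin> edges G" "{c, q} \<notin> edges G" "{q, b} \<notin> edges G" "{b, p} \<notin> edges G" "{p, a} \<notin> edges G"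
    using A(3) unfolding C5_block_def by blast
  note cyc = independent_cycleD(4)[OF h] and h0 = independent_cycleD(5)[OF h]
  note s0 = independent_cycleD(2)[OF h h0]
  have W: "a \<in> W" "b \<in> W" "c \<in> W" "p \<in> W" "q \<in> W" using A abc by auto
  have n0: "a \<notin> \<sigma>0" "b \<notin> \<sigma>0" "c \<notin> \<sigma>0" "p \<notin> \<sigma>0" "q \<notin> \<sigma>0" using s0 A abc by auto
  define h' where "h' = (\<lambda>\<sigma>. wedge a (wedge c h) \<sigma> + (wedge c (wedge q h) \<sigma> + (wedge q (wedge b h) \<sigma> +
    (wedge b (wedge p h) \<sigma> + wedge p (wedge a h) \<sigma>))))"
  have "independent_cycle G W (U \<union> A) (d + 2) h' (\<sigma>0 \<union> {a, c})"
  proof (rule independent_cycle_extend[OF h A(1,2) separate])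
    fix \<sigma> assume "h' \<sigma> \<noteq> 0"
    then have "\<exists>x y. (x, y) \<in> {(a, c), (c, q), (q, b), (b, p), (p, a)} \<and> wedge x (wedge y h) \<sigma> \<noteq> 0"
      unfolding h'_def by (metis (no_types, lifting) add.right_neutral insertCI)
    then obtain x y where xy: "(x, y) \<in> {(a, c), (c, q), (q, b), (b, p), (p, a)}" "wedge x (wedge y h) \<sigma> \<noteq> 0"
      by blast
    have mem: "x \<in> \<sigma>" "y \<in> \<sigma>" "h (\<sigma> - {x} - {y}) \<noteq> 0"
      using wedge_nonzero[OF xy(2)] wedge_nonzero[of y h "\<sigma> - {x}"] by auto
    have "\<sigma> - {x} - {y} = \<sigma> - {x, y}" by blast
    moreover have "\<not> e \<subseteq> {x, y}" if "e \<in> edges G" for e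
      using edge_subset_pair[OF G that, of x y] xy(1) non that by auto
    moreover have "{x, y} \<subseteq> A" using xy(1) abc(1) by auto
    ultimately show "\<exists>\<tau>. \<tau> \<subseteq> A \<and> \<tau> \<subseteq> \<sigma> \<and> (\<forall>e\<in>edges G. \<not> e \<subseteq> \<tau>) \<and> h (\<sigma> - \<tau>) \<noteq> 0"
      using mem by (intro exI[of _ "{x, y}"]) auto
  next
    fix \<rho> assume \<rho>: "- W \<subseteq> \<rho>"
    show "face_sum h' \<rho> = 0"
      unfolding h'_def face_sum_add using W \<rho> by (simp add: face_sum_wedge_wedge_cycle[OF cyc])
  next
    have "h' (\<sigma>0 \<union> {a, c}) = koszul_sign a (insert c \<sigma>0) * (koszul_sign c \<sigma>0 * h \<sigma>0)"
    proof -
      have "insert a (insert c \<sigma>0) - {a} = insert c \<sigma>0" "insert c \<sigma>0 - {c} = \<sigma>0"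
        using n0 abc(2) by auto
      then show ?thesis using n0 abc(2) by (auto simp: h'_def wedge_def)
    qed
    then show "h' (\<sigma>0 \<union> {a, c}) \<noteq> 0"
      using koszul_sign_cases[of a "insert c \<sigma>0", where 'a = 'k] koszul_sign_cases[of c \<sigma>0, where 'a = 'k] h0 by auto
  next
    fix v assume "v \<in> A - {a, c}"
    then consider "v = b" | "v = p" | "v = q" using abc(1) by auto
    then show "\<exists>e\<in>edges G. e \<subseteq> insert v {a, c}"
    proof cases
      case 1
      then show ?thesis using abc(3) by (intro bexI[of _ "{a, b}"]) auto
    next
      case 2
      then show ?thesis using abc(5) by (intro bexI[of _ "{c, p}"]) auto
    next
      case 3
      then show ?thesis using abc(7) by (intro bexI[of _ "{q, a}"]) auto
    qed
  qed (use abc(1,2) in simp_all)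
  moreover have "card A div 2 = 2" using abc by simp
  ultimately show ?thesis by auto
qed

text \<open>
  Vertex sets of the components of an induced subgraph all of whose components are edges or pentagons.
\<close>

definition K2_C5_blocks :: "'v ugraph \<Rightarrow> 'v set set \<Rightarrow> bool" where
  "K2_C5_blocks G \<C> \<longleftrightarrow> (\<forall>A\<in>\<C>. K2_block G A \<or> C5_block G A) \<and> pairwise disjnt \<C> \<and>
     (\<forall>e\<in>edges G. e \<subseteq> \<Union>\<C> \<longrightarrow> (\<exists>A\<in>\<C>. e \<subseteq> A))"

lemma K2_C5_blocks_unique:
  "K2_C5_blocks G \<C> \<Longrightarrow> A \<in> \<C> \<Longrightarrow> B \<in> \<C> \<Longrightarrow> v \<in> A \<Longrightarrow> v \<in> B \<Longrightarrow> A = B"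
  unfolding K2_C5_blocks_def by (metis disjnt_iff pairwiseD)

lemma independent_cycle_blocks:
  fixes G :: "'v::finite ugraph"
  assumes G: "simple_graph G" and \<C>: "K2_C5_blocks G \<C>"
  shows "\<exists>h :: 'v set \<Rightarrow> 'k::field. \<exists>\<sigma>0.
    independent_cycle G (\<Union>\<C>) (\<Union>\<C>) (\<Sum>A\<in>\<C>. card A div 2) h \<sigma>0"
proof -
  have "\<exists>h :: 'v set \<Rightarrow> 'k. \<exists>\<sigma>0. independent_cycle G (\<Union>\<C>) (\<Union>\<B>) (\<Sum>A\<in>\<B>. card A div 2) h \<sigma>0"
    if "\<B> \<subseteq> \<C>" for \<B>
  proof -
    have "finite \<B>" by simp
    then show ?thesis using that
    proof (induction \<B> rule: finite_induct)
      case empty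
      then show ?case using independent_cycle_empty[OF G, of "\<Union>\<C>"] by auto
    next
      case (insert A \<B>)
      then obtain h :: "'v set \<Rightarrow> 'k" and \<sigma>0 where
        h: "independent_cycle G (\<Union>\<C>) (\<Union>\<B>) (\<Sum>A\<in>\<B>. card A div 2) h \<sigma>0" by auto
      have disj: "A \<inter> \<Union>\<B> = {}"
        using K2_C5_blocks_unique[OF \<C>, of A] insert.hyps insert.prems by blast
      have separate: "e \<subseteq> \<Union>\<B> \<or> e \<subseteq> A" if e: "e \<in> edges G" "e \<subseteq> \<Union>\<B> \<union> A" for e
      proof -
        have "e \<subseteq> \<Union>\<C>" using e(2) insert.prems by blast
        then obtain B where B: "B \<in> \<C>" "e \<subseteq> B" using \<C> e(1) unfolding K2_C5_blocks_def by blast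
        have "B = B'" if "B' \<in> \<C>" "v \<in> e" "v \<in> B'" for B' v
          using K2_C5_blocks_unique[OF \<C> B(1) that(1) _ that(3)] B(2) that(2) by blast
        moreover obtain v where "v \<in> e" using G e(1) unfolding simple_graph_def by fastforce
        ultimately have "B \<in> insert A \<B>" using e(2) insert.prems by blast
        then show ?thesis using B(2) by blast
      qed
      have "K2_block G A \<or> C5_block G A" using \<C> insert.prems unfolding K2_C5_blocks_def by blast
      then have "\<exists>h' :: 'v set \<Rightarrow> 'k. \<exists>\<sigma>'.
          independent_cycle G (\<Union>\<C>) (\<Union>\<B> \<union> A) ((\<Sum>A\<in>\<B>. card A div 2) + card A div 2) h' \<sigma>'"
        using independent_cycle_K2[OF G h _ disj _ separate]
          independent_cycle_C5[OF G h _ disj _ separate] insert.prems by blast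
      then show ?case using insert.hyps by (simp add: Un_commute add.commute)
    qed
  qed
  then show ?thesis by blast
qed

text \<open>
  The summand \<open>card A div 2\<close> is the matching number of the block \<open>A\<close>: it is \<open>1\<close> for an
  edge and \<open>2\<close> for a pentagon.
\<close>

theorem blocks_regularity:
  fixes G :: "'v::finite ugraph"
  assumes G: "simple_graph G" and s: "1 \<le> s"
    and \<C>: "K2_C5_blocks G \<C>" and K2: "E \<in> \<C>" "K2_block G E"
  shows "2 * int s + int (\<Sum>A\<in>\<C>. card A div 2) - 1
    \<le> regularity (ideal_power (edge_ideal G :: ('v, 'k::field) mpoly set) s)"
proof -
  obtain h :: "'v set \<Rightarrow> 'k" and \<sigma>0 where
    h: "independent_cycle G (\<Union>\<C>) (\<Union>\<C>) (\<Sum>A\<in>\<C>. card A div 2) h \<sigma>0"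
    using independent_cycle_blocks[OF G \<C>] by blast
  obtain x y where xy: "x \<noteq> y" "E = {x, y}" "{x, y} \<in> edges G" using K2(2) unfolding K2_block_def by blast
  show ?thesis
  proof (rule edge_power_regularity[OF G s xy(1,3), where W = "\<Union>\<C>" and h = h and ?\<sigma>0.0 = \<sigma>0])
    show "{x, y} \<subseteq> \<Union>\<C>" using K2(1) xy(2) by blast
    show "e = {x, y}" if e: "e \<in> edges G" "e \<subseteq> \<Union>\<C>" "e \<inter> {x, y} \<noteq> {}" for e
    proof -
      obtain B where B: "B \<in> \<C>" "e \<subseteq> B" using \<C> e unfolding K2_C5_blocks_def by blast
      then have "B = E" using K2_C5_blocks_unique[OF \<C> B(1) K2(1)] e(3) xy(2) by blast
      then show ?thesis using edge_subset_pair[OF G e(1)] B(2) xy(2) by blast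
    qed
    show "\<exists>e\<in>edges G. e \<subseteq> insert v \<sigma>0 \<inter> \<Union>\<C>" if "v \<notin> \<sigma>0" for v
      using independent_cycleD(1)[OF h independent_cycleD(5)[OF h]] independent_cycleD(7)[OF h, of v] that
      by blast
  qed (fact independent_cycleD[OF h])+
qed

section \<open>From induced subgraphs to blocks\<close>

lemma K2_blockI:
  assumes "graph_isomorphic C (complete_graph 2)"
    and "\<And>u v. u \<in> verts C \<Longrightarrow> v \<in> verts C \<Longrightarrow> {u, v} \<in> edges C \<longleftrightarrow> {u, v} \<in> edges G"
  shows "K2_block G (verts C)"
proof -
  obtain f where f: "bij_betw f (verts C) {..<2::nat}"
    and e: "\<And>u v. u \<in> verts C \<Longrightarrow> v \<in> verts C \<Longrightarrow>
      {u, v} \<in> edges C \<longleftrightarrow> {f u, f v} \<in> edges (complete_graph 2)"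
    using assms(1) unfolding graph_isomorphic_def by (auto simp: complete_graph_def)
  define g where "g = inv_into (verts C) f"
  have g: "bij_betw g {..<2} (verts C)" unfolding g_def using f by (rule bij_betw_inv_into)
  have fg: "f (g i) = i" if "i < 2" for i
    using f that by (simp add: g_def bij_betw_inv_into_right)
  have mem: "g i \<in> verts C" if "i < 2" for i using g that by (auto simp: bij_betw_def)
  have "verts C = g ` {..<2}" using g by (simp add: bij_betw_def)
  also have "{..<2::nat} = {0, 1}" by auto
  finally have "verts C = {g 0, g 1}" by simp
  moreover have "g 0 \<noteq> g 1" using fg[of 0] fg[of 1] by auto
  moreover have "{g 0, g 1} \<in> edges C"
    using e[of "g 0" "g 1"] mem fg by (simp add: complete_graph_def)
  ultimately show ?thesis unfolding K2_block_def using assms(2) mem by (metis insertI1 insertI2)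
qed

lemma cycle_graph_5_edges: "edges (cycle_graph 5) = {{0, 1}, {1, 2}, {2, 3}, {3, 4}, {4, 0}}"
proof -
  have "edges (cycle_graph 5) = (\<lambda>i. {i, (i + 1) mod 5}) ` {..<5}"
    by (auto simp: cycle_graph_def)
  also have "{..<5::nat} = {0, 1, 2, 3, 4}" by auto
  finally show ?thesis by (simp add: numeral_2_eq_2)
qed

lemma C5_blockI:
  assumes "graph_isomorphic C (cycle_graph 5)"
    and "\<And>u v. u \<in> verts C \<Longrightarrow> v \<in> verts C \<Longrightarrow> {u, v} \<in> edges C \<longleftrightarrow> {u, v} \<in> edges G"
  shows "C5_block G (verts C)"
proof -
  obtain f where f: "bij_betw f (verts C) {..<5::nat}"
    and e: "\<And>u v. u \<in> verts C \<Longrightarrow> v \<in> verts C \<Longrightarrow>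
      {u, v} \<in> edges C \<longleftrightarrow> {f u, f v} \<in> edges (cycle_graph 5)"
    using assms(1) unfolding graph_isomorphic_def by (auto simp: cycle_graph_def)
  define g where "g = inv_into (verts C) f"
  have g: "bij_betw g {..<5} (verts C)" unfolding g_def using f by (rule bij_betw_inv_into)
  have fg: "f (g i) = i" if "i < 5" for i
    using f that by (simp add: g_def bij_betw_inv_into_right)
  have mem: "g i \<in> verts C" if "i < 5" for i using g that by (auto simp: bij_betw_def)
  have edge: "{g i, g j} \<in> edges G \<longleftrightarrow> {i, j} \<in> {{0, 1}, {1, 2}, {2, 3}, {3, 4}, {4, 0::nat}}"
    if "i < 5" "j < 5" for i j
    using e[of "g i" "g j"] assms(2)[of "g i" "g j"] mem fg that
    by (simp add: cycle_graph_5_edges)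
  have inj: "g i = g j \<longleftrightarrow> i = j" if "i < 5" "j < 5" for i j using fg that by metis
  have "verts C = g ` {..<5}" using g by (simp add: bij_betw_def)
  also have "{..<5::nat} = {0, 1, 2, 3, 4}" by auto
  finally have "verts C = {g 0, g 1, g 2, g 3, g 4}" by simp
  then show ?thesis
    unfolding C5_block_def
    by (intro exI[of _ "g 0"] exI[of _ "g 1"] exI[of _ "g 2"] exI[of _ "g 3"] exI[of _ "g 4"])
       (simp add: edge inj doubleton_eq_iff)
qed

lemma blocks_of_components:
  fixes G :: "'v::finite ugraph"
  assumes G: "simple_graph G" and W: "K2_C5_graph (induced_subgraph G W)"
  shows "K2_C5_blocks G (verts ` connected_components (induced_subgraph G W))"
    and "\<Union> (verts ` connected_components (induced_subgraph G W)) = W"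
proof -
  define r where "r = {(x, y). {x, y} \<in> edges (induced_subgraph G W)}"
  define K where "K u = {v \<in> W. (u, v) \<in> r\<^sup>*}" for u
  have "sym r" by (auto simp: r_def sym_def insert_commute)
  then have sym: "(v, u) \<in> r\<^sup>*" if "(u, v) \<in> r\<^sup>*" for u v
    using that by (metis sym_rtrancl symD)
  have comps: "connected_components (induced_subgraph G W) =
      (\<lambda>u. induced_subgraph (induced_subgraph G W) (K u)) ` W"
    unfolding connected_components_def r_def K_def by (auto simp: induced_subgraph_def)
  have vcomps: "verts ` connected_components (induced_subgraph G W) = K ` W"
    unfolding comps image_image by (simp add: induced_subgraph_def)
  have KW: "K u \<subseteq> W" for u by (auto simp: K_def)
  have self: "u \<in> K u" if "u \<in> W" for u using that by (simp add: K_def)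
  have K_eq: "K u = K v" if "v \<in> K u" for u v
    using that sym unfolding K_def by (auto intro: rtrancl_trans)
  show "\<Union> (verts ` connected_components (induced_subgraph G W)) = W"
    unfolding vcomps using KW self by blast
  show "K2_C5_blocks G (verts ` connected_components (induced_subgraph G W))"
    unfolding K2_C5_blocks_def
  proof (intro conjI ballI impI)
    fix A assume "A \<in> verts ` connected_components (induced_subgraph G W)"
    then obtain C where C: "C \<in> connected_components (induced_subgraph G W)" "A = verts C" by blast
    then obtain u where u: "u \<in> W" "C = induced_subgraph (induced_subgraph G W) (K u)"
      unfolding comps by blast
    have "{a, b} \<in> edges C \<longleftrightarrow> {a, b} \<in> edges G" if "a \<in> verts C" "b \<in> verts C" for a b
      using that KW[of u] unfolding u(2) by (auto simp: induced_subgraph_def)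
    moreover have "graph_isomorphic C (complete_graph 2) \<or> graph_isomorphic C (cycle_graph 5)"
      using W C(1) unfolding K2_C5_graph_def by blast
    ultimately show "K2_block G A \<or> C5_block G A"
      unfolding C(2) using K2_blockI[of C G] C5_blockI[of C G] by blast
  next
    show "pairwise disjnt (verts ` connected_components (induced_subgraph G W))"
      unfolding vcomps pairwise_def disjnt_def using K_eq by blast
  next
    fix e assume e: "e \<in> edges G" "e \<subseteq> \<Union> (verts ` connected_components (induced_subgraph G W))"
    then have eW: "e \<subseteq> W" unfolding vcomps using KW by blast
    obtain a b where ab: "e = {a, b}"
      using G e(1) unfolding simple_graph_def by (metis card_2_iff)
    then have "(a, b) \<in> r" using e(1) eW by (simp add: r_def induced_subgraph_def)
    then have "e \<subseteq> K a" using ab eW by (auto simp: K_def)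
    moreover have "a \<in> W" using ab eW by simp
    ultimately show "\<exists>A\<in>verts ` connected_components (induced_subgraph G W). e \<subseteq> A"
      unfolding vcomps by blast
  qed
qed

lemma block_card: "K2_block G A \<Longrightarrow> card A = 2" "C5_block G A \<Longrightarrow> card A = 5"
  by (auto simp: K2_block_def C5_block_def)

lemma finite_matchings: "finite {card M | M. matching G M}"
  for G :: "'v::finite ugraph"
  by (rule finite_subset[of _ "card ` Pow (edges G)"]) (auto simp: matching_def)

lemma match_attained:
  fixes G :: "'v::finite ugraph"
  obtains M where "matching G M" "match G = card M"
proof -
  have "matching G {}" by (simp add: matching_def)
  then have "{card M | M. matching G M} \<noteq> {}" by blast
  then have "match G \<in> {card M | M. matching G M}"
    unfolding match_def by (rule Max_in[OF finite_matchings])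
  then show ?thesis using that by blast
qed

text \<open>
  Every edge lies in one block, and a block with \<open>n\<close> vertices contains at most \<open>n div 2\<close>
  disjoint edges.
\<close>

lemma match_le_blocks:
  fixes G :: "'v::finite ugraph"
  assumes G: "simple_graph G" and \<C>: "K2_C5_blocks G \<C>"
  shows "match (induced_subgraph G (\<Union>\<C>)) \<le> (\<Sum>A\<in>\<C>. card A div 2)"
proof -
  obtain M where M: "matching (induced_subgraph G (\<Union>\<C>)) M" "match (induced_subgraph G (\<Union>\<C>)) = card M"
    by (rule match_attained)
  have ME: "M \<subseteq> edges G" and MC: "\<And>e. e \<in> M \<Longrightarrow> e \<subseteq> \<Union>\<C>" and disj: "pairwise disjnt M"
    using M(1) by (auto simp: matching_def induced_subgraph_def)
  have "M \<subseteq> (\<Union>A\<in>\<C>. {e \<in> M. e \<subseteq> A})"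
  proof
    fix e assume e: "e \<in> M"
    then obtain A where "A \<in> \<C>" "e \<subseteq> A"
      using \<C> ME MC[OF e] unfolding K2_C5_blocks_def by blast
    then show "e \<in> (\<Union>A\<in>\<C>. {e \<in> M. e \<subseteq> A})" using e by blast
  qed
  then have "card M \<le> card (\<Union>A\<in>\<C>. {e \<in> M. e \<subseteq> A})" by (intro card_mono) auto
  also have "\<dots> \<le> (\<Sum>A\<in>\<C>. card {e \<in> M. e \<subseteq> A})" by (rule card_UN_le) simp
  also have "\<dots> \<le> (\<Sum>A\<in>\<C>. card A div 2)"
  proof (rule sum_mono)
    fix A assume "A \<in> \<C>"
    have "card (\<Union>{e \<in> M. e \<subseteq> A}) = (\<Sum>e\<in>{e \<in> M. e \<subseteq> A}. card e)"
      using disj by (intro card_Union_disjoint) (auto simp: pairwise_def disjnt_def)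
    also have "\<dots> = (\<Sum>e\<in>{e \<in> M. e \<subseteq> A}. 2)"
      using G ME by (intro sum.cong) (auto simp: simple_graph_def)
    finally have "card {e \<in> M. e \<subseteq> A} * 2 \<le> card A"
      using card_mono[of A "\<Union>{e \<in> M. e \<subseteq> A}"] by auto
    then show "card {e \<in> M. e \<subseteq> A} \<le> card A div 2" by linarith
  qed
  finally show ?thesis using M(2) by simp
qed

text \<open>
  Without an edge among the blocks \<open>blocks_regularity\<close> does not apply.  Shrinking a pentagon to one
  of its edges makes it applicable and lowers the matching number by one only.
\<close>

lemma C5_blocks_replace_edge:
  fixes G :: "'v::finite ugraph"
  assumes G: "simple_graph G" and \<C>: "K2_C5_blocks G \<C>" and A: "A \<in> \<C>" "C5_block G A"
  obtains E where "K2_C5_blocks G (insert E (\<C> - {A}))" "K2_block G E" "E \<notin> \<C> - {A}"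
proof -
  obtain a b where ab: "a \<noteq> b" "{a, b} \<in> edges G" "{a, b} \<subseteq> A"
    using A(2) unfolding C5_block_def by auto
  have sep: "A \<inter> B = {}" if "B \<in> \<C>" "B \<noteq> A" for B
    using K2_C5_blocks_unique[OF \<C> A(1) that(1)] that(2) by blast
  have K: "K2_block G {a, b}" using ab unfolding K2_block_def by blast
  have "K2_C5_blocks G (insert {a, b} (\<C> - {A}))"
    unfolding K2_C5_blocks_def
  proof (intro conjI ballI impI)
    show "K2_block G B \<or> C5_block G B" if "B \<in> insert {a, b} (\<C> - {A})" for B
      using that K \<C> unfolding K2_C5_blocks_def by blast
    have "pairwise disjnt (\<C> - {A})"
      using \<C> unfolding K2_C5_blocks_def by (meson Diff_subset pairwise_subset)
    then show "pairwise disjnt (insert {a, b} (\<C> - {A}))"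
      using sep ab(3) by (auto simp: pairwise_insert disjnt_def)
    fix e assume e: "e \<in> edges G" "e \<subseteq> \<Union> (insert {a, b} (\<C> - {A}))"
    then have "e \<subseteq> \<Union>\<C>" using ab(3) A(1) by blast
    then obtain B where B: "B \<in> \<C>" "e \<subseteq> B" using \<C> e(1) unfolding K2_C5_blocks_def by blast
    show "\<exists>B\<in>insert {a, b} (\<C> - {A}). e \<subseteq> B"
    proof (cases "B = A")
      case False
      then show ?thesis using B by blast
    next
      case True
      then have "e \<subseteq> {a, b}" using B(2) e(2) sep by blast
      then show ?thesis by blast
    qed
  qed
  moreover have "{a, b} \<notin> \<C> - {A}" using sep ab(3) by blast
  ultimately show ?thesis using that K by blast
qed

lemma induced_matching_blocks:
  assumes G: "simple_graph G" and M: "induced_matching G M"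
  shows "K2_C5_blocks G M"
  unfolding K2_C5_blocks_def
proof (intro conjI ballI impI)
  have ME: "M \<subseteq> edges G" and disj: "pairwise disjnt M"
    using M by (auto simp: induced_matching_def matching_def)
  have ind: "f \<in> M" if "e \<in> M" "e' \<in> M" "f \<in> edges G" "f \<subseteq> e \<union> e'" for e e' f
    using M that unfolding induced_matching_def by blast
  show "pairwise disjnt M" by (rule disj)
  show "K2_block G A \<or> C5_block G A" if "A \<in> M" for A
  proof -
    have "A \<in> edges G" using ME that by blast
    moreover from this obtain u v where "A = {u, v}" "u \<noteq> v"
      using G unfolding simple_graph_def by (metis card_2_iff)
    ultimately show ?thesis unfolding K2_block_def by blast
  qed
  show "\<exists>A\<in>M. e \<subseteq> A" if e: "e \<in> edges G" "e \<subseteq> \<Union>M" for e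
  proof -
    obtain u v where uv: "e = {u, v}"
      using G e(1) unfolding simple_graph_def by (metis card_2_iff)
    then obtain p q where "p \<in> M" "u \<in> p" "q \<in> M" "v \<in> q" using e(2) by auto
    then have "e \<in> M" using ind[of p q e] e(1) uv by auto
    then show ?thesis by blast
  qed
qed

text \<open>
  If some component is an edge, both bounds follow from \<open>blocks_regularity\<close>.  If all components are
  pentagons, replacing one of them by an edge costs \<open>1\<close>.  The matching number is at most the even
  number \<open>d\<close>, so if it is odd, it is at most \<open>d - 1\<close> and nothing is lost.
\<close>

theorem theorem4p1:
  fixes G :: "'v::finite ugraph"
  assumes "simple_graph G" and "verts G = UNIV" and "edges G \<noteq> {}"
  shows "(\<forall>s\<ge>1.
            max (2 * int s + int (ind_match G) - 1)
                (2 * int s + int (ind_match_K2_C5 G) - 2)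
              \<le> regularity (ideal_power (edge_ideal G :: ('v, 'k::field) mpoly set) s)) \<and>
         (odd (ind_match_K2_C5 G) \<longrightarrow>
           (\<forall>s\<ge>1.
              2 * int s + int (ind_match_K2_C5 G) - 1
                \<le> regularity (ideal_power (edge_ideal G :: ('v, 'k) mpoly set) s)))"
proof -
  let ?reg = "\<lambda>s. regularity (ideal_power (edge_ideal G :: ('v, 'k) mpoly set) s)"
  note G = assms(1)
  note bound = blocks_regularity[OF G, where 'k = 'k]
  have edge_block: "K2_block G e" if "e \<in> edges G" for e
  proof -
    obtain u v where "e = {u, v}" "u \<noteq> v"
      using G \<open>e \<in> edges G\<close> unfolding simple_graph_def by (metis card_2_iff)
    then show ?thesis using that unfolding K2_block_def by blast
  qed
  \<comment> \<open>a single edge; this settles the cases in which the maxima are attained by an empty set\<close>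
  have base: "2 * int s \<le> ?reg s" if s: "1 \<le> s" for s
  proof -
    obtain e where e: "e \<in> edges G" using assms(3) by blast
    have "K2_C5_blocks G {e}" using edge_block[OF e] by (simp add: K2_C5_blocks_def)
    then show ?thesis using bound[OF s, of "{e}" e] edge_block[OF e] block_card(1)[OF edge_block[OF e]] by simp
  qed
  have ind: "2 * int s + int (ind_match G) - 1 \<le> ?reg s" if s: "1 \<le> s" for s
  proof -
    have "induced_matching G {}" by (simp add: induced_matching_def matching_def)
    moreover have "finite {card M | M. induced_matching G M}"
      by (rule finite_subset[OF _ finite_matchings[of G]]) (auto simp: induced_matching_def)
    ultimately have "ind_match G \<in> {card M | M. induced_matching G M}"
      unfolding ind_match_def by (intro Max_in) auto
    then obtain M where M: "induced_matching G M" "ind_match G = card M" by blast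
    show ?thesis
    proof (cases "M = {}")
      case True
      then show ?thesis using base[OF s] M(2) by simp
    next
      case False
      then obtain e where e: "e \<in> M" by blast
      have blk: "K2_block G A" if "A \<in> M" for A
        using M(1) that edge_block by (auto simp: induced_matching_def matching_def)
      have "(\<Sum>A\<in>M. card A div 2) = (\<Sum>A\<in>M. 1)"
        by (rule sum.cong) (auto simp: block_card(1)[OF blk])
      then show ?thesis
        using bound[OF s induced_matching_blocks[OF G M(1)] e blk[OF e]] M(2) by simp
    qed
  qed
  let ?S = "{match (induced_subgraph G W) | W. W \<subseteq> verts G \<and> K2_C5_graph (induced_subgraph G W)}"
  have "K2_C5_graph (induced_subgraph G {})"
    by (simp add: K2_C5_graph_def connected_components_def induced_subgraph_def)
  then have "?S \<noteq> {}" by blast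
  moreover have "finite ?S"
    by (rule finite_subset[of _ "(\<lambda>W. match (induced_subgraph G W)) ` UNIV"]) auto
  ultimately have "ind_match_K2_C5 G \<in> ?S" unfolding ind_match_K2_C5_def by (intro Max_in) auto
  then obtain W where W: "K2_C5_graph (induced_subgraph G W)" "ind_match_K2_C5 G = match (induced_subgraph G W)"
    by blast
  define \<C> where "\<C> = verts ` connected_components (induced_subgraph G W)"
  have \<C>: "K2_C5_blocks G \<C>" "\<Union>\<C> = W" unfolding \<C>_def using blocks_of_components[OF G W(1)] by simp_all
  define d where "d = (\<Sum>A\<in>\<C>. card A div 2)"
  have le: "ind_match_K2_C5 G \<le> d" using match_le_blocks[OF G \<C>(1)] unfolding \<C>(2) W(2) d_def .
  have K2C5: "2 * int s + int (ind_match_K2_C5 G) - (if odd (ind_match_K2_C5 G) then 1 else 2) \<le> ?reg s"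
    if s: "1 \<le> s" for s
  proof (cases "\<exists>E\<in>\<C>. K2_block G E")
    case True
    then obtain E where "E \<in> \<C>" "K2_block G E" by blast
    then have "2 * int s + int d - 1 \<le> ?reg s" using bound[OF s \<C>(1)] unfolding d_def by simp
    then show ?thesis using le by auto
  next
    case False
    then have C5: "C5_block G A" if "A \<in> \<C>" for A using \<C>(1) that unfolding K2_C5_blocks_def by blast
    have "d = (\<Sum>A\<in>\<C>. 2)"
      unfolding d_def by (rule sum.cong) (auto simp: block_card(2)[OF C5])
    then have d: "d = 2 * card \<C>" by simp
    show ?thesis
    proof (cases "\<C> = {}")
      case True
      then show ?thesis using base[OF s] le d by simp
    next
      case False
      then obtain A where A: "A \<in> \<C>" by blast
      obtain E where E: "K2_C5_blocks G (insert E (\<C> - {A}))" "K2_block G E" "E \<notin> \<C> - {A}"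
        using C5_blocks_replace_edge[OF G \<C>(1) A C5[OF A]] .
      have "(\<Sum>B\<in>insert E (\<C> - {A}). card B div 2) = 1 + (\<Sum>B\<in>\<C> - {A}. card B div 2)"
        using E(3) block_card(1)[OF E(2)] by simp
      moreover have "d = 2 + (\<Sum>B\<in>\<C> - {A}. card B div 2)"
        unfolding d_def using A block_card(2)[OF C5[OF A]] by (simp add: sum.remove)
      ultimately have "2 * int s + int d - 2 \<le> ?reg s"
        using bound[OF s E(1) _ E(2)] by simp
      moreover have "ind_match_K2_C5 G < d" if "odd (ind_match_K2_C5 G)"
        using le d that by (metis dvd_triv_left order_le_neq_trans)
      ultimately show ?thesis using le by auto
    qed
  qed
  have "2 * int s + int (ind_match_K2_C5 G) - 2 \<le> ?reg s" if "1 \<le> s" for s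
    using K2C5[OF that] by (auto split: if_splits)
  then show ?thesis using ind K2C5 by auto
qed

end
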